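(* Let $n\ge5$, set $m=n(n-2)$, and let $q_n$ denote the number of induced four-cycles in $G_n$. Then $$q_n=n\binom{n-3}{2}+\frac{n(n-3)}2\binom{n-4}{2}.$$ Moreover, $$\beta_{2,4}(S_{G_n}/J_{G_n})=\binom{m}{2}+2n\binom{n-2}{3}+3q_n.$$
   Context: Graph $G_n$: let $X=\{u_0,\dots,u_{n-1}\}$ and $Y=\{v_0,\dots,v_{n-1}\}$ be disjoint, indices modulo $n$. $G_n$ is the bipartite graph on $X\sqcup Y$ with $\{u_i,v_j\}\in E(G_n)$ iff $j\notin\{i,i-1\}$ modulo $n$ (the bipartite complement of the cycle $C_{2n}$ with edges $\{u_i,v_i\},\{u_i,v_{i-1}\}$). Binomial edge ideal: let $\mathbb K$ be an arbitrary field. For a finite simple graph $G$, $S_G=\mathbb K[x_w,y_w:w\in V(G)]$ (standard graded) and $J_G\subseteq S_G$ is the ideal generated by $x_ay_b-x_by_a$ for all edges $\{a,b\}\in E(G)$. $\beta_{i,j}(R)$ denotes the graded Betti number of $R=S_G/J_G$ over $S_G$: the number of summands $S_G(-j)$ in homological degree $i$ of the minimal graded free resolution of $R$. An induced four-cycle of $G_n$ is counted as a 4-element vertex subset whose induced subgraph is isomorphic to $C_4$. *)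

theory Defs
  imports Complex_Main "HOL-Library.Poly_Mapping" "HOL-Number_Theory.Cong"
begin

section \<open>Simple graphs\<close>

record 'v graph =
  verts :: "'v set"
  edges :: "'v set set"

definition graph_iso :: "'v graph \<Rightarrow> 'w graph \<Rightarrow> bool" where
  "graph_iso G H \<longleftrightarrow> (\<exists>f. bij_betw f (verts G) (verts H) \<and>
     (\<forall>a\<in>verts G. \<forall>b\<in>verts G. {a, b} \<in> edges G \<longleftrightarrow> {f a, f b} \<in> edges H))"

definition induced_subgraph :: "'v graph \<Rightarrow> 'v set \<Rightarrow> 'v graph" where
  "induced_subgraph G W = \<lparr>verts = W, edges = {e \<in> edges G. e \<subseteq> W}\<rparr>"

text \<open>The cycle of length \<open>k\<close>; meaningful for \<open>k \<ge> 3\<close>.\<close>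

definition cycle_graph :: "nat \<Rightarrow> nat graph" where
  "cycle_graph k = \<lparr>verts = {..<k}, edges = {{i, (i + 1) mod k} | i. i < k}\<rparr>"

definition induced_four_cycles :: "'v graph \<Rightarrow> 'v set set" where
  "induced_four_cycles G =
     {W. W \<subseteq> verts G \<and> card W = 4 \<and> graph_iso (induced_subgraph G W) (cycle_graph 4)}"

datatype gvertex = U nat | V nat

definition G_graph :: "nat \<Rightarrow> gvertex graph" where
  "G_graph n =
     \<lparr>verts = U ` {..<n} \<union> V ` {..<n},
      edges = {{U i, V j} | i j. i < n \<and> j < n \<and>
                 [int j \<noteq> int i] (mod int n) \<and> [int j \<noteq> int i - 1] (mod int n)}\<rparr>"


section \<open>Polynomial rings\<close>

text \<open>A monomial is its finitely supported exponent function, a polynomial its finitely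
  supported coefficient function. The polynomial ring on a set \<open>W\<close> of variables is the
  subring \<open>poly_ring W\<close> of the ring of all polynomials.\<close>

type_synonym ('x, 'k) mpoly = "('x \<Rightarrow>\<^sub>0 nat) \<Rightarrow>\<^sub>0 'k"

definition mvar :: "'x \<Rightarrow> ('x, 'k::field) mpoly" where
  "mvar x = Poly_Mapping.single (Poly_Mapping.single x 1) 1"

definition poly_ring :: "'x set \<Rightarrow> ('x, 'k::field) mpoly set" where
  "poly_ring W = {p. \<forall>m\<in>Poly_Mapping.keys p. Poly_Mapping.keys m \<subseteq> W}"

definition mon_degree :: "('x \<Rightarrow>\<^sub>0 nat) \<Rightarrow> nat" where
  "mon_degree m = (\<Sum>x\<in>Poly_Mapping.keys m. Poly_Mapping.lookup m x)"

definition ideal_generated :: "'x set \<Rightarrow> ('x, 'k::field) mpoly set \<Rightarrow> ('x, 'k) mpoly set" where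
  "ideal_generated W A =
     {\<Sum>a\<in>B. c a * a | B c. finite B \<and> B \<subseteq> A \<and> (\<forall>a\<in>B. c a \<in> poly_ring W)}"


section \<open>Graded free modules and graded Betti numbers\<close>

text \<open>Let \<open>S = poly_ring W\<close>. A rank function \<open>r\<close> describes the graded free module
  \<open>\<Oplus>\<^sub>j S(-j)^(r j)\<close>. Its basis is indexed by the pairs \<open>(j, k)\<close> with \<open>k < r j\<close>, the
  basis vector \<open>(j, k)\<close> having degree \<open>j\<close>. Only shifts by \<open>j \<ge> 0\<close> are provided: no others
  occur in a minimal resolution of \<open>S/J\<close>. The rank is required to be finite for every single
  \<open>j\<close> only; for finite \<open>W\<close> minimality forces \<open>r j = 0\<close> for almost all \<open>j\<close>.\<close>

type_synonym ('x, 'k) fvec = "(nat \<times> nat) \<Rightarrow>\<^sub>0 ('x, 'k) mpoly"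

definition free_module :: "'x set \<Rightarrow> (nat \<Rightarrow> nat) \<Rightarrow> ('x, 'k::field) fvec set" where
  "free_module W r =
     {v. (\<forall>(j, k)\<in>Poly_Mapping.keys v. k < r j) \<and>
         (\<forall>p. Poly_Mapping.lookup v p \<in> poly_ring W)}"

definition scal :: "('x, 'k::field) mpoly \<Rightarrow> ('x, 'k) fvec \<Rightarrow> ('x, 'k) fvec" where
  "scal c v = Poly_Mapping.map (\<lambda>p. c * p) v"

definition poly_homogeneous :: "nat \<Rightarrow> ('x, 'k::field) mpoly \<Rightarrow> bool" where
  "poly_homogeneous d p \<longleftrightarrow> (\<forall>m\<in>Poly_Mapping.keys p. mon_degree m = d)"

definition fvec_homogeneous :: "nat \<Rightarrow> ('x, 'k::field) fvec \<Rightarrow> bool" where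
  "fvec_homogeneous d v \<longleftrightarrow>
     (\<forall>(j, k)\<in>Poly_Mapping.keys v. \<forall>m\<in>Poly_Mapping.keys (Poly_Mapping.lookup v (j, k)).
        mon_degree m + j = d)"

definition graded_hom ::
  "'x set \<Rightarrow> (nat \<Rightarrow> nat) \<Rightarrow> (nat \<Rightarrow> nat) \<Rightarrow> (('x, 'k::field) fvec \<Rightarrow> ('x, 'k) fvec) \<Rightarrow> bool"
where
  "graded_hom W r s f \<longleftrightarrow>
     (\<forall>v\<in>free_module W r. f v \<in> free_module W s) \<and>
     (\<forall>v\<in>free_module W r. \<forall>w\<in>free_module W r. f (v + w) = f v + f w) \<and>
     (\<forall>c\<in>poly_ring W. \<forall>v\<in>free_module W r. f (scal c v) = scal c (f v)) \<and>
     (\<forall>v\<in>free_module W r. \<forall>d. fvec_homogeneous d v \<longrightarrow> fvec_homogeneous d (f v))"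

definition graded_hom_to_ring ::
  "'x set \<Rightarrow> (nat \<Rightarrow> nat) \<Rightarrow> (('x, 'k::field) fvec \<Rightarrow> ('x, 'k) mpoly) \<Rightarrow> bool"
where
  "graded_hom_to_ring W r f \<longleftrightarrow>
     (\<forall>v\<in>free_module W r. f v \<in> poly_ring W) \<and>
     (\<forall>v\<in>free_module W r. \<forall>w\<in>free_module W r. f (v + w) = f v + f w) \<and>
     (\<forall>c\<in>poly_ring W. \<forall>v\<in>free_module W r. f (scal c v) = c * f v) \<and>
     (\<forall>v\<in>free_module W r. \<forall>d. fvec_homogeneous d v \<longrightarrow> poly_homogeneous d (f v))"

text \<open>Minimal graded free resolutions
    \<open>\<dots> \<rightarrow> F\<^sub>2 \<rightarrow> F\<^sub>1 \<rightarrow> F\<^sub>0 \<rightarrow> S/J \<rightarrow> 0\<close>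
  with \<open>F\<^sub>i = free_module W (b i)\<close>, where \<open>\<delta> i\<close> maps \<open>F\<^sub>i\<close> to \<open>F\<^sub>i\<^sub>-\<^sub>1\<close> for \<open>i \<ge> 1\<close>. The
  augmentation \<open>F\<^sub>0 \<rightarrow> S/J\<close> is represented by a lift \<open>\<epsilon>\<close> to \<open>S\<close>, which exists because
  \<open>F\<^sub>0\<close> is free. The last clause is minimality: the image of \<open>F\<^sub>i\<^sub>+\<^sub>1\<close> in \<open>F\<^sub>i\<close> is
  contained in \<open>\<mm> F\<^sub>i\<close> for the ideal \<open>\<mm>\<close> of polynomials with constant term \<open>0\<close>.\<close>

definition minimal_graded_free_resolution ::
  "'x set \<Rightarrow> ('x, 'k::field) mpoly set \<Rightarrow> (nat \<Rightarrow> nat \<Rightarrow> nat) \<Rightarrow>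
   (('x, 'k) fvec \<Rightarrow> ('x, 'k) mpoly) \<Rightarrow> (nat \<Rightarrow> ('x, 'k) fvec \<Rightarrow> ('x, 'k) fvec) \<Rightarrow> bool"
where
  "minimal_graded_free_resolution W J b \<epsilon> \<delta> \<longleftrightarrow>
     graded_hom_to_ring W (b 0) \<epsilon> \<and>
     (\<forall>i. graded_hom W (b (Suc i)) (b i) (\<delta> (Suc i))) \<and>
     (\<forall>s\<in>poly_ring W. \<exists>v\<in>free_module W (b 0). \<epsilon> v - s \<in> J) \<and>
     {v \<in> free_module W (b 0). \<epsilon> v \<in> J} = \<delta> 1 ` free_module W (b 1) \<and>
     (\<forall>i\<ge>1. {v \<in> free_module W (b i). \<delta> i v = 0} =
               \<delta> (Suc i) ` free_module W (b (Suc i))) \<and>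
     (\<forall>i. \<forall>v\<in>free_module W (b (Suc i)). \<forall>p.
        Poly_Mapping.lookup (Poly_Mapping.lookup (\<delta> (Suc i) v) p) 0 = 0)"

text \<open>\<open>graded_betti W J i j\<close> is \<open>\<beta>\<^sub>i\<^sub>,\<^sub>j(S/J)\<close>. For finite \<open>W\<close> and homogeneous \<open>J\<close> a
  minimal graded free resolution exists and its ranks are unique, so that the description
  determines a number.\<close>

definition graded_betti :: "'x set \<Rightarrow> ('x, 'k::field) mpoly set \<Rightarrow> nat \<Rightarrow> nat \<Rightarrow> nat" where
  "graded_betti W J i j =
     (THE r. \<exists>b \<epsilon> \<delta>. minimal_graded_free_resolution W J b \<epsilon> \<delta> \<and> r = b i j)"


section \<open>Binomial edge ideals\<close>

datatype 'v bvar = Xvar 'v | Yvar 'v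

definition edge_ring_vars :: "'v graph \<Rightarrow> 'v bvar set" where
  "edge_ring_vars G = Xvar ` verts G \<union> Yvar ` verts G"

definition binomial_edge_ideal :: "'v graph \<Rightarrow> ('v bvar, 'k::field) mpoly set" where
  "binomial_edge_ideal G =
     ideal_generated (edge_ring_vars G)
       {mvar (Xvar a) * mvar (Yvar b) - mvar (Xvar b) * mvar (Yvar a) | a b. {a, b} \<in> edges G}"

end

theory Submission
  imports Defs "HOL-Library.Function_Algebras"
begin

text \<open>
  The graph \<open>G\<^sub>n\<close> has no triangle. Hence the generators \<open>f\<^sub>e\<close> of its binomial edge ideal, one
  quadric for each of the \<open>m\<close> edges \<open>e\<close>, admit no syzygy with linear coefficients, and
  nothing in the second step of a minimal resolution lies in a degree below four. Therefore
  \<open>\<beta>\<^sub>2\<^sub>,\<^sub>4\<close> is the dimension of the space of all quadratic syzygies, the families \<open>(c\<^sub>e)\<close> of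
  quadrics with \<open>\<Sum>c\<^sub>e f\<^sub>e = 0\<close> (\<open>resolution_betti_2_4\<close>).

  This dimension is found for every finite bipartite graph by adding the edges one at a time.
  If \<open>E\<close> is the old edge set and \<open>ab\<close> the new edge, the coefficient of \<open>f\<^sub>a\<^sub>b\<close> in a syzygy
  is an arbitrary element of the degree two part of the colon ideal \<open>J\<^sub>E : f\<^sub>a\<^sub>b\<close>, and the
  syzygies in which it vanishes are the old ones (\<open>syz_step\<close>). The colon ideal contains in
  degree two
    \<^item> \<open>f\<^sub>e\<close> for each \<open>e \<in> E\<close>, because of the Koszul syzygies;
    \<^item> \<open>f\<^sub>c\<^sub>d\<close> for two neighbours \<open>c, d\<close> of \<open>a\<close>, or of \<open>b\<close>, because of the Pluecker relation
      \<open>f\<^sub>a\<^sub>b f\<^sub>c\<^sub>d - f\<^sub>a\<^sub>c f\<^sub>b\<^sub>d + f\<^sub>a\<^sub>d f\<^sub>b\<^sub>c = 0\<close>;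
    \<^item> all four monomials \<open>x\<^sub>c x\<^sub>d, y\<^sub>c y\<^sub>d, x\<^sub>c y\<^sub>d, x\<^sub>d y\<^sub>c\<close> for each path \<open>a - d - c - b\<close>,
      because of \<open>x\<^sub>a f\<^sub>b\<^sub>c - x\<^sub>b f\<^sub>a\<^sub>c + x\<^sub>c f\<^sub>a\<^sub>b = 0\<close> and its analogues; as \<open>f\<^sub>c\<^sub>d\<close> was counted
      already, they contribute three new dimensions.
  Nothing else occurs (\<open>colon_has_dim\<close>). Summed over all edges, the three kinds give the
  number of pairs of edges, the number of triples of edges with a common vertex, and three
  times the number of four-cycles.

  For the upper bound the ring is split by the multidegree in which \<open>x\<^sub>v\<close> and \<open>y\<^sub>v\<close> have the
  same degree. In one multidegree every generator of the ideal, times a monomial, is a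
  difference of two monomials that have the same number of \<open>x\<close>-variables at each connected
  component of the graph on the vertices involved. So, if \<open>a\<close> and \<open>b\<close> lie in different
  components, counting these variables gives linear functionals that vanish on the ideal and
  force the coefficients of a polynomial \<open>p\<close> with \<open>p f\<^sub>a\<^sub>b\<close> in the ideal to cancel
  (\<open>class_sum_zero\<close>). In all steps the field is arbitrary.

  The graded Betti number is the number common to all minimal graded free resolutions, so
  that such a resolution must also be shown to exist. It is constructed degree by degree from
  bases of complements of \<open>(\<mm>M)\<^sub>d\<close> in \<open>M\<^sub>d\<close> (\<open>minimal_free_cover\<close>). Finally, degrees and
  four-cycles of \<open>G\<^sub>n\<close> are counted; an induced four-cycle consists of two vertices of one
  side and two common neighbours of them.
\<close>

section \<open>Dimension of subspaces of possibly infinite-dimensional spaces\<close>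

text \<open>
  A relation, because the function \<open>dim\<close> takes the value \<open>0\<close> on infinite-dimensional subspaces,
  and the spaces of polynomials and vectors below have infinite dimension.
\<close>

definition (in vector_space) has_dim :: "'b set \<Rightarrow> nat \<Rightarrow> bool" where
  "has_dim M n \<longleftrightarrow> (\<exists>B. finite B \<and> independent B \<and> span B = M \<and> card B = n)"

lemma (in vector_space) has_dim_unique:
  assumes "has_dim M n" "has_dim M m"
  shows "n = m"
  using assms dim_eq_card unfolding has_dim_def by metis

lemma (in vector_space) has_dim_zero: "has_dim {0} 0"
  unfolding has_dim_def by (rule exI[of _ "{}"]) (simp add: independent_empty)

text \<open>
  A family \<open>g\<close> in \<open>M\<close> is a basis of \<open>M\<close> if functionals \<open>\<phi>\<close> dual to it separate the points of
  \<open>M\<close>: all \<open>\<phi> i\<close> vanish at \<open>v - \<Sum>\<^sub>i \<phi> i v \<cdot> g i\<close>.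
\<close>

lemma (in vector_space) has_dim_dual_family:
  assumes M: "subspace M" and fin: "finite I"
    and g: "\<And>i. i \<in> I \<Longrightarrow> g i \<in> M"
    and add: "\<And>i x y. \<phi> i (x + y) = \<phi> i x + \<phi> i y"
    and sc: "\<And>i c x. \<phi> i (scale c x) = c * \<phi> i x"
    and dual: "\<And>i j. i \<in> I \<Longrightarrow> j \<in> I \<Longrightarrow> \<phi> i (g j) = (if i = j then 1 else 0)"
    and sep: "\<And>v. v \<in> M \<Longrightarrow> (\<And>i. i \<in> I \<Longrightarrow> \<phi> i v = 0) \<Longrightarrow> v = 0"
  shows "has_dim M (card I)"
proof -
  have z: "\<phi> i 0 = 0" for i using sc[of i 0 0] by simp
  have sm: "\<phi> i (sum h A) = (\<Sum>x\<in>A. \<phi> i (h x))" for i A and h :: "_ \<Rightarrow> 'b"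
    by (induct A rule: infinite_finite_induct) (simp_all add: z add)
  have inj: "inj_on g I"
  proof (rule inj_onI)
    fix i j assume ij: "i \<in> I" "j \<in> I" and e: "g i = g j"
    have "\<phi> i (g j) = 1" using dual[OF ij(1) ij(1)] e by simp
    then show "i = j" using dual[OF ij] by (cases "i = j") auto
  qed
  have comb: "\<phi> i (\<Sum>j\<in>I. scale (u j) (g j)) = u i" if "i \<in> I" for i u
  proof -
    have "\<phi> i (\<Sum>j\<in>I. scale (u j) (g j)) = (\<Sum>j\<in>I. u j * (if i = j then 1 else 0))"
      unfolding sm by (rule sum.cong) (simp_all add: sc dual that)
    also have "\<dots> = (\<Sum>j\<in>I. if i = j then u j else 0)" by (rule sum.cong) auto
    also have "\<dots> = u i" using fin that by simp
    finally show ?thesis .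
  qed
  have ind: "independent (g ` I)"
  proof (rule independent_if_scalars_zero)
    show "finite (g ` I)" using fin by simp
    fix u x assume s: "(\<Sum>x\<in>g ` I. scale (u x) x) = 0" and x: "x \<in> g ` I"
    obtain i where i: "i \<in> I" "x = g i" using x by blast
    have "(\<Sum>j\<in>I. scale (u (g j)) (g j)) = 0" using s by (simp add: sum.reindex[OF inj])
    then show "u x = 0" using comb[OF i(1), of "\<lambda>j. u (g j)"] i z by simp
  qed
  have "M \<subseteq> span (g ` I)"
  proof
    fix v assume v: "v \<in> M"
    let ?w = "\<Sum>j\<in>I. scale (\<phi> j v) (g j)"
    have "?w \<in> M" using g M by (intro subspace_sum subspace_scale) auto
    then have d: "v - ?w \<in> M" using v M subspace_diff by blast
    have "\<phi> i (v - ?w) = 0" if "i \<in> I" for i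
    proof -
      have "\<phi> i (v - ?w + ?w) = \<phi> i (v - ?w) + \<phi> i ?w" by (rule add)
      also have "\<phi> i ?w = \<phi> i v" by (rule comb[OF that])
      finally have "\<phi> i v = \<phi> i (v - ?w) + \<phi> i v" by (simp only: diff_add_cancel)
      then show ?thesis by simp
    qed
    then have "v - ?w = 0" using sep[OF d] by blast
    then have "v = ?w" by (simp only: right_minus_eq)
    then show "v \<in> span (g ` I)"
      using span_sum[of I "\<lambda>j. scale (\<phi> j v) (g j)" "g ` I"]
      by (simp add: span_base span_scale)
  qed
  moreover have "span (g ` I) \<subseteq> M" using g M by (intro span_minimal) auto
  ultimately show ?thesis unfolding has_dim_def
    using ind fin inj by (intro exI[of _ "g ` I"]) (auto simp: card_image)
qed

text \<open>
  Linearity is asked on the subspace \<open>M\<close> only, since a graded homomorphism is specified on a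
  free module and arbitrary elsewhere in its type.
\<close>

lemma (in vector_space_pair) rank_nullity_on:
  assumes M: "vs1.subspace M"
    and add: "\<And>x y. x \<in> M \<Longrightarrow> y \<in> M \<Longrightarrow> f (x + y) = f x + f y"
    and sc: "\<And>c x. x \<in> M \<Longrightarrow> f (s1 c x) = s2 c (f x)"
    and ker: "vs1.has_dim {v \<in> M. f v = 0} k"
    and im: "vs2.has_dim (f ` M) n"
  shows "vs1.has_dim M (k + n)"
proof -
  obtain K where K: "finite K" "vs1.independent K" "vs1.span K = {v \<in> M. f v = 0}" "card K = k"
    using ker unfolding vs1.has_dim_def by blast
  obtain P where P: "finite P" "vs2.independent P" "vs2.span P = f ` M" "card P = n"
    using im unfolding vs2.has_dim_def by blast
  have z: "f 0 = 0" using add[of 0 0] M vs1.subspace_0 by fastforce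
  have sm: "f (sum h A) = (\<Sum>x\<in>A. f (h x))" if "\<And>x. x \<in> A \<Longrightarrow> h x \<in> M" for h A
    using that
  proof (induct A rule: infinite_finite_induct)
    case (insert x F)
    then have "sum h F \<in> M" using M vs1.subspace_sum by blast
    then show ?case using insert add by simp
  qed (simp_all add: z)
  have "\<forall>y\<in>P. \<exists>x\<in>M. f x = y"
  proof
    fix y assume "y \<in> P"
    then have "y \<in> f ` M" using vs2.span_base P(3) by metis
    then show "\<exists>x\<in>M. f x = y" by (auto simp: image_iff)
  qed
  then obtain g where g: "\<And>y. y \<in> P \<Longrightarrow> g y \<in> M" "\<And>y. y \<in> P \<Longrightarrow> f (g y) = y" by metis
  have gi: "inj_on g P" using g(2) by (metis inj_onI)
  have KV: "K \<subseteq> M" and Kz: "\<And>x. x \<in> K \<Longrightarrow> f x = 0" using vs1.span_superset[of K] K(3) by auto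
  have disj: "K \<inter> g ` P = {}"
  proof -
    have "0 \<notin> P" using P(2) vs2.dependent_zero by blast
    then show ?thesis using Kz g(2) by force
  qed
  have ind: "vs1.independent (K \<union> g ` P)"
  proof (rule vs1.independent_if_scalars_zero)
    show "finite (K \<union> g ` P)" using K(1) P(1) by simp
    fix u x assume s: "(\<Sum>x\<in>K \<union> g ` P. s1 (u x) x) = 0" and x: "x \<in> K \<union> g ` P"
    have s2: "(\<Sum>x\<in>K. s1 (u x) x) + (\<Sum>y\<in>P. s1 (u (g y)) (g y)) = 0"
      using s K(1) P(1) disj by (simp add: sum.union_disjoint sum.reindex[OF gi])
    have inV: "(\<Sum>x\<in>K. s1 (u x) x) \<in> M" "(\<Sum>y\<in>P. s1 (u (g y)) (g y)) \<in> M"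
      using KV g(1) M by (auto intro!: vs1.subspace_sum vs1.subspace_scale)
    have "f (\<Sum>x\<in>K. s1 (u x) x) = (\<Sum>x\<in>K. s2 (u x) (f x))"
      using KV M by (subst sm) (auto intro!: sum.cong sc vs1.subspace_scale)
    also have "\<dots> = 0" using Kz by simp
    finally have k0: "f (\<Sum>x\<in>K. s1 (u x) x) = 0" .
    have p0: "f (\<Sum>y\<in>P. s1 (u (g y)) (g y)) = (\<Sum>y\<in>P. s2 (u (g y)) y)"
      using g M by (subst sm) (auto intro!: sum.cong simp: sc vs1.subspace_scale)
    have "(\<Sum>y\<in>P. s2 (u (g y)) y) = 0"
      using add[OF inV] s2 k0 p0 z by simp
    then have up: "\<And>y. y \<in> P \<Longrightarrow> u (g y) = 0"
      using vs2.independentD[OF P(2,1) subset_refl, of "\<lambda>y. u (g y)"] by blast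
    then have "(\<Sum>x\<in>K. s1 (u x) x) = 0" using s2 by simp
    then have "\<And>x. x \<in> K \<Longrightarrow> u x = 0" using vs1.independentD[OF K(2,1) subset_refl, of u] by blast
    then show "u x = 0" using up x by blast
  qed
  have "M \<subseteq> vs1.span (K \<union> g ` P)"
  proof
    fix v assume v: "v \<in> M"
    then have "f v \<in> vs2.span P" using P(3) by blast
    then obtain u where u: "f v = (\<Sum>y\<in>P. s2 (u y) y)"
      unfolding vs2.span_finite[OF P(1)] by blast
    let ?w = "\<Sum>y\<in>P. s1 (u y) (g y)"
    have w: "?w \<in> M" using g M by (intro vs1.subspace_sum vs1.subspace_scale) auto
    have fw: "f ?w = (\<Sum>y\<in>P. s2 (u y) y)"
      using g M by (subst sm) (auto intro!: sum.cong simp: sc vs1.subspace_scale)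
    have d: "v - ?w \<in> M" using v w M vs1.subspace_diff by blast
    have "f (v - ?w) + f ?w = f v" using add[OF d w] by simp
    then have "f (v - ?w) = 0" using fw u by simp
    then have "v - ?w \<in> vs1.span K" using d K(3) by blast
    then have 1: "v - ?w \<in> vs1.span (K \<union> g ` P)" using vs1.span_mono[of K "K \<union> g ` P"] by auto
    have "?w \<in> vs1.span (K \<union> g ` P)"
      by (intro vs1.span_sum vs1.span_scale vs1.span_base) auto
    then have "v - ?w + ?w \<in> vs1.span (K \<union> g ` P)" by (rule vs1.span_add[OF 1])
    then show "v \<in> vs1.span (K \<union> g ` P)" by simp
  qed
  moreover have "vs1.span (K \<union> g ` P) \<subseteq> M" using KV g(1) M by (intro vs1.span_minimal) auto
  ultimately show ?thesis unfolding vs1.has_dim_def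
    using ind K P disj gi
    by (intro exI[of _ "K \<union> g ` P"]) (auto simp: card_image card_Un_disjoint)
qed

lemma (in vector_space_pair) subspace_image_on:
  assumes M: "vs1.subspace M"
    and add: "\<And>x y. x \<in> M \<Longrightarrow> y \<in> M \<Longrightarrow> f (x + y) = f x + f y"
    and sc: "\<And>c x. x \<in> M \<Longrightarrow> f (s1 c x) = s2 c (f x)"
  shows "vs2.subspace (f ` M)"
proof (rule vs2.subspaceI)
  have "f 0 = 0" using add[of 0 0] M vs1.subspace_0 by fastforce
  then show "0 \<in> f ` M" using vs1.subspace_0[OF M] by (metis imageI)
  show "x + y \<in> f ` M" if "x \<in> f ` M" "y \<in> f ` M" for x y
  proof -
    obtain u v where "x = f u" "y = f v" "u \<in> M" "v \<in> M" using \<open>x \<in> f ` M\<close> \<open>y \<in> f ` M\<close> by blast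
    then show ?thesis using add[of u v] vs1.subspace_add[OF M, of u v] by (metis imageI)
  qed
  show "s2 c x \<in> f ` M" if "x \<in> f ` M" for c x
  proof -
    obtain u where "x = f u" "u \<in> M" using \<open>x \<in> f ` M\<close> by blast
    then show ?thesis using sc[of u c] vs1.subspace_scale[OF M, of u c] by (metis imageI)
  qed
qed

text \<open>
  This is \<open>rank_nullity_on\<close> for the inverse map, whose kernel is zero.
\<close>

lemma (in vector_space_pair) has_dim_image:
  assumes M: "vs1.subspace M"
    and add: "\<And>x y. x \<in> M \<Longrightarrow> y \<in> M \<Longrightarrow> f (x + y) = f x + f y"
    and sc: "\<And>c x. x \<in> M \<Longrightarrow> f (s1 c x) = s2 c (f x)"
    and inj: "\<And>x. x \<in> M \<Longrightarrow> f x = 0 \<Longrightarrow> x = 0"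
    and dim: "vs1.has_dim M n"
  shows "vs2.has_dim (f ` M) n"
proof -
  interpret swapped: vector_space_pair s2 s1 by unfold_locales
  define g where "g = inv_into M f"
  have z: "f 0 = 0" using add[of 0 0] M vs1.subspace_0 by fastforce
  have ij: "inj_on f M"
  proof (rule inj_onI)
    fix x y assume x: "x \<in> M" and y: "y \<in> M" and e: "f x = f y"
    have d: "x - y \<in> M" using M x y vs1.subspace_diff by blast
    have "f (x - y) + f y = f x" using add[OF d y] by simp
    then show "x = y" using inj[OF d] e by simp
  qed
  have g: "g (f x) = x" if "x \<in> M" for x using inv_into_f_f[OF ij that] by (simp add: g_def)
  have "vs2.has_dim (f ` M) (0 + n)"
  proof (rule swapped.rank_nullity_on[where f = g])
    show "vs2.subspace (f ` M)"
      by (rule subspace_image_on[OF M add sc])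
    show "g (x + y) = g x + g y" if "x \<in> f ` M" "y \<in> f ` M" for x y
    proof -
      obtain u v where "x = f u" "y = f v" "u \<in> M" "v \<in> M" using \<open>x \<in> f ` M\<close> \<open>y \<in> f ` M\<close> by blast
      then show ?thesis using g add vs1.subspace_add[OF M] by metis
    qed
    show "g (s2 c x) = s1 c (g x)" if "x \<in> f ` M" for c x
    proof -
      obtain u where "x = f u" "u \<in> M" using \<open>x \<in> f ` M\<close> by blast
      then show ?thesis using g sc vs1.subspace_scale[OF M] by metis
    qed
    have "{v \<in> f ` M. g v = 0} = {0}"
    proof (intro equalityI subsetI)
      fix v assume "v \<in> {v \<in> f ` M. g v = 0}"
      then show "v \<in> {0}" using g z by auto
    next
      fix v assume "v \<in> {0 :: 'c}"
      then show "v \<in> {v \<in> f ` M. g v = 0}" using g[OF vs1.subspace_0[OF M]] z vs1.subspace_0[OF M] by force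
    qed
    then show "vs2.has_dim {v \<in> f ` M. g v = 0} 0" by (simp add: vs2.has_dim_zero)
    have "g ` f ` M = M" using g by force
    then show "vs1.has_dim (g ` f ` M) n" using dim by simp
  qed
  then show ?thesis by simp
qed

section \<open>Polynomials and free modules as graded vector spaces\<close>

abbreviation lookup :: "('a \<Rightarrow>\<^sub>0 'b::zero) \<Rightarrow> 'a \<Rightarrow> 'b" where
  "lookup \<equiv> Poly_Mapping.lookup"

abbreviation keys :: "('a \<Rightarrow>\<^sub>0 'b::zero) \<Rightarrow> 'a set" where
  "keys \<equiv> Poly_Mapping.keys"

abbreviation single :: "'a \<Rightarrow> 'b \<Rightarrow> 'a \<Rightarrow>\<^sub>0 'b::zero" where
  "single \<equiv> Poly_Mapping.single"

subsection \<open>Scalars\<close>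

lemma lookup_map_times: "lookup (Poly_Mapping.map ((*) (c::'a::mult_zero)) v) p = c * lookup v p"
  by (auto simp: Poly_Mapping.map.rep_eq when_def)

text \<open>
  Three vector spaces over the coefficient field are used: polynomials, elements of free
  modules, and families of polynomials indexed by edges.
\<close>

definition csc :: "'k::field \<Rightarrow> ('x, 'k) mpoly \<Rightarrow> ('x, 'k) mpoly" where
  "csc c p = single 0 c * p"

lemma lookup_csc [simp]: "lookup (csc c p) m = c * lookup p m"
  unfolding csc_def by (simp flip: mult_map_scale_conv_mult add: lookup_map_times)

lemma lookup_scal [simp]: "lookup (scal c v) p = c * lookup v p"
  unfolding scal_def by (rule lookup_map_times)

definition csv :: "'k::field \<Rightarrow> ('x, 'k) fvec \<Rightarrow> ('x, 'k) fvec" where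
  "csv c v = scal (single 0 c) v"

lemma lookup_csv [simp]: "lookup (csv c v) p = csc c (lookup v p)"
  by (simp add: csv_def csc_def)

definition csf :: "'k::field \<Rightarrow> ('e \<Rightarrow> ('x, 'k) mpoly) \<Rightarrow> 'e \<Rightarrow> ('x, 'k) mpoly" where
  "csf c f = (\<lambda>e. csc c (f e))"

global_interpretation mp: vector_space "csc :: 'k::field \<Rightarrow> ('x, 'k) mpoly \<Rightarrow> _"
  by unfold_locales (auto intro!: poly_mapping_eqI simp: lookup_add algebra_simps)

global_interpretation fv: vector_space "csv :: 'k::field \<Rightarrow> ('x, 'k) fvec \<Rightarrow> _"
  by unfold_locales (auto intro!: poly_mapping_eqI simp: lookup_add algebra_simps)

global_interpretation fam: vector_space "csf :: 'k::field \<Rightarrow> ('e \<Rightarrow> ('x, 'k) mpoly) \<Rightarrow> _"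
  by unfold_locales (auto intro!: poly_mapping_eqI simp: csf_def lookup_add algebra_simps)

lemma scal_add_right: "scal c (v + w) = scal c v + scal c w"
  by (rule poly_mapping_eqI) (simp add: lookup_add algebra_simps)

lemma scal_add_left: "scal (c + d) v = scal c v + scal d v"
  by (rule poly_mapping_eqI) (simp add: lookup_add algebra_simps)

lemma scal_scal: "scal c (scal d v) = scal (c * d) v"
  by (rule poly_mapping_eqI) (simp add: algebra_simps)

lemma scal_zero [simp]: "scal 0 v = 0" "scal c 0 = 0" "scal 1 v = v"
  by (rule poly_mapping_eqI; simp)+

lemma scal_sum_right: "scal c (sum f A) = (\<Sum>x\<in>A. scal c (f x))"
  by (induct A rule: infinite_finite_induct) (auto simp: scal_add_right)

lemma scal_sum_left: "scal (sum f A) v = (\<Sum>x\<in>A. scal (f x) v)"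
  by (induct A rule: infinite_finite_induct) (auto simp: scal_add_left)

lemma scal_single [simp]: "scal c (single p q) = single p (c * q)"
  by (rule poly_mapping_eqI) (auto simp: lookup_single when_def)

lemma poly_mapping_sum_singles:
  fixes v :: "'a \<Rightarrow>\<^sub>0 'b::comm_monoid_add"
  assumes "finite A" "keys v \<subseteq> A"
  shows "v = (\<Sum>p\<in>A. single p (lookup v p))"
proof (rule poly_mapping_eqI)
  fix k
  have "lookup (\<Sum>p\<in>A. single p (lookup v p)) k = (\<Sum>p\<in>A. if p = k then lookup v p else 0)"
    unfolding lookup_sum by (rule sum.cong) (auto simp: lookup_single when_def)
  also have "\<dots> = (if k \<in> A then lookup v k else 0)" using assms(1) by simp
  also have "\<dots> = lookup v k" using assms(2) by (auto simp: in_keys_iff)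
  finally show "lookup v k = lookup (\<Sum>p\<in>A. single p (lookup v p)) k" by simp
qed

lemma mon_eq_0_iff: "m + m' = (0 :: 'x \<Rightarrow>\<^sub>0 nat) \<longleftrightarrow> m = 0 \<and> m' = 0"
  by (auto simp: poly_mapping_eq_iff lookup_add fun_eq_iff)

text \<open>
  Only the product of two constant monomials is constant, so the constant term is multiplicative.
\<close>

lemma lookup_mult_0:
  fixes p q :: "('x, 'k::field) mpoly"
  shows "lookup (p * q) 0 = lookup p 0 * lookup q 0"
proof -
  have 1: "lookup (single m c * q) 0 = (if m = 0 then c * lookup q 0 else 0)" for m c
  proof (cases "m = 0")
    case True
    then show ?thesis using lookup_csc[of c q 0] by (simp add: csc_def)
  next
    case False
    then have "0 \<notin> keys (single m c * q)"
      using keys_mult[of "single m c" q] mon_eq_0_iff[of m]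
      by (cases "c = 0") auto
    then show ?thesis using False by (simp add: in_keys_iff)
  qed
  have "lookup (p * q) 0 = (\<Sum>m\<in>keys p. lookup (single m (lookup p m) * q) 0)"
  proof -
    have "p * q = (\<Sum>m\<in>keys p. single m (lookup p m) * q)"
      unfolding sum_distrib_right[symmetric]
      by (rule arg_cong[where f = "\<lambda>x. x * q"]) (rule poly_mapping_sum_singles, auto)
    then show ?thesis by (simp only: lookup_sum)
  qed
  also have "\<dots> = (\<Sum>m\<in>keys p. if m = 0 then lookup p m * lookup q 0 else 0)"
    by (simp add: 1)
  also have "\<dots> = lookup p 0 * lookup q 0"
    by (auto simp: in_keys_iff)
  finally show ?thesis .
qed

subsection \<open>Degrees\<close>

lemma mon_degree_eq:
  assumes "finite A" "keys m \<subseteq> A"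
  shows "mon_degree m = (\<Sum>x\<in>A. lookup m x)"
  unfolding mon_degree_def using assms
  by (intro sum.mono_neutral_left) (auto simp: in_keys_iff)

lemma mon_degree_add: "mon_degree (m + m') = mon_degree m + mon_degree m'"
proof -
  have "mon_degree k = (\<Sum>x\<in>keys m \<union> keys m'. lookup k x)" if "k \<in> {m, m', m + m'}" for k
    using that keys_add[of m m'] by (intro mon_degree_eq) auto
  then show ?thesis by (simp add: lookup_add sum.distrib)
qed

lemma mon_degree_single [simp]: "mon_degree (single x k) = k"
  by (simp add: mon_degree_def)

lemma mon_degree_0 [simp]: "mon_degree 0 = 0"
  by (simp add: mon_degree_def)

lemma mon_degree_eq_0 [simp]: "mon_degree m = 0 \<longleftrightarrow> m = 0"
  by (auto simp: mon_degree_def in_keys_iff intro!: poly_mapping_eqI)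

lemma phom_iff: "poly_homogeneous d p \<longleftrightarrow> (\<forall>m. lookup p m \<noteq> 0 \<longrightarrow> mon_degree m = d)"
  by (auto simp: poly_homogeneous_def in_keys_iff)

lemma fhom_iff: "fvec_homogeneous d v \<longleftrightarrow>
    (\<forall>j k m. lookup (lookup v (j, k)) m \<noteq> 0 \<longrightarrow> mon_degree m + j = d)"
proof
  assume h: "fvec_homogeneous d v"
  show "\<forall>j k m. lookup (lookup v (j, k)) m \<noteq> 0 \<longrightarrow> mon_degree m + j = d"
  proof (intro allI impI)
    fix j k m assume nz: "lookup (lookup v (j, k)) m \<noteq> 0"
    then have "lookup v (j, k) \<noteq> 0" by auto
    then show "mon_degree m + j = d"
      using h nz unfolding fvec_homogeneous_def by (fastforce simp: in_keys_iff)
  qed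
qed (auto simp: fvec_homogeneous_def in_keys_iff)

lemma phomD: "poly_homogeneous d p \<Longrightarrow> lookup p m \<noteq> 0 \<Longrightarrow> mon_degree m = d"
  unfolding phom_iff by blast

lemma fhomD: "fvec_homogeneous d v \<Longrightarrow> lookup (lookup v (j, k)) m \<noteq> 0 \<Longrightarrow> mon_degree m + j = d"
  unfolding fhom_iff by blast

lemma phom_add: "poly_homogeneous d p \<Longrightarrow> poly_homogeneous d q \<Longrightarrow> poly_homogeneous d (p + q)"
  unfolding phom_iff lookup_add by (metis add.left_neutral)

lemma phom_0 [simp]: "poly_homogeneous d 0"
  by (simp add: phom_iff)

lemma phom_csc: "poly_homogeneous d p \<Longrightarrow> poly_homogeneous d (csc c p)"
  by (auto simp: phom_iff)

lemma phom_mult: "poly_homogeneous d p \<Longrightarrow> poly_homogeneous e q \<Longrightarrow> poly_homogeneous (d + e) (p * q)"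
  using keys_mult[of p q] unfolding poly_homogeneous_def
  by (auto simp: mon_degree_add dest!: subsetD)

lemma phom_single: "mon_degree m = d \<Longrightarrow> poly_homogeneous d (single m c)"
  by (auto simp: phom_iff lookup_single when_def)

lemma phom_0_single:
  assumes "poly_homogeneous 0 p"
  shows "p = single 0 (lookup p 0)"
  using assms by (intro poly_mapping_eqI) (auto simp: phom_iff lookup_single when_def)

lemma fhom_0 [simp]: "fvec_homogeneous d 0"
  by (simp add: fhom_iff)

lemma fhom_add: "fvec_homogeneous d p \<Longrightarrow> fvec_homogeneous d q \<Longrightarrow> fvec_homogeneous d (p + q)"
  unfolding fhom_iff lookup_add by (metis add.left_neutral)

lemma fhom_csv: "fvec_homogeneous d p \<Longrightarrow> fvec_homogeneous d (csv c p)"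
  by (auto simp: fhom_iff)

lemma fhom_lookup: "fvec_homogeneous d v \<Longrightarrow> poly_homogeneous (d - j) (lookup v (j, k))"
  unfolding phom_iff using fhomD by fastforce

lemma fhom_lookup_low: "fvec_homogeneous d v \<Longrightarrow> d < j \<Longrightarrow> lookup v (j, k) = 0"
  by (rule poly_mapping_eqI) (metis fhomD lookup_zero not_add_less2)

lemma fhom_sum: "(\<And>x. x \<in> A \<Longrightarrow> fvec_homogeneous d (f x)) \<Longrightarrow> fvec_homogeneous d (sum f A)"
  by (induct A rule: infinite_finite_induct) (auto simp: fhom_add)

lemma fhom_diff: "fvec_homogeneous d p \<Longrightarrow> fvec_homogeneous d q \<Longrightarrow> fvec_homogeneous d (p - q)"
  unfolding fhom_iff lookup_minus by (metis diff_0_right)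

lemma fhom_scal:
  assumes "poly_homogeneous d p" "fvec_homogeneous e v"
  shows "fvec_homogeneous (d + e) (scal p v)"
  unfolding fhom_iff
proof (intro allI impI)
  fix j k m assume a: "lookup (lookup (scal p v) (j, k)) m \<noteq> 0"
  then have nz: "lookup v (j, k) \<noteq> 0" by auto
  then have "j \<le> e" using fhom_lookup_low[OF assms(2)] by (meson not_le)
  moreover have "poly_homogeneous (d + (e - j)) (p * lookup v (j, k))"
    by (intro phom_mult fhom_lookup assms)
  ultimately show "mon_degree m + j = d + e" using a phomD by fastforce
qed

definition bas :: "nat \<times> nat \<Rightarrow> ('x, 'k::field) fvec" where
  "bas p = single p 1"

lemma lookup_bas: "lookup (bas p) q = (if p = q then 1 else 0)"
  by (auto simp: bas_def lookup_single when_def)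

lemma lookup_one_eq: "lookup (1 :: ('x, 'k::field) mpoly) m = (if m = 0 then 1 else 0)"
  by (simp add: lookup_one when_def)

lemma fhom_bas: "fvec_homogeneous j (bas (j, k))"
  by (auto simp: fhom_iff lookup_bas lookup_one_eq)

lemma fvec_expand:
  assumes "finite A" "keys v \<subseteq> A"
  shows "v = (\<Sum>p\<in>A. scal (lookup v p) (bas p))"
  using poly_mapping_sum_singles[OF assms] by (simp add: bas_def)

subsection \<open>Subrings and submodules\<close>

lemma pr_0 [simp]: "0 \<in> poly_ring W" by (simp add: poly_ring_def)

lemma pr_single: "keys m \<subseteq> W \<Longrightarrow> single m c \<in> poly_ring W"
  by (simp add: poly_ring_def)

lemma pr_1 [simp]: "1 \<in> poly_ring W"
  by (simp add: poly_ring_def)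

lemma pr_const [simp]: "single 0 c \<in> poly_ring W"
  by (simp add: pr_single)

lemma pr_add: "p \<in> poly_ring W \<Longrightarrow> q \<in> poly_ring W \<Longrightarrow> p + q \<in> poly_ring W"
  using keys_add[of p q] by (auto simp: poly_ring_def)

lemma pr_uminus: "p \<in> poly_ring W \<Longrightarrow> - p \<in> poly_ring W"
  by (simp add: poly_ring_def in_keys_iff)

lemma pr_mult: "p \<in> poly_ring W \<Longrightarrow> q \<in> poly_ring W \<Longrightarrow> p * q \<in> poly_ring W"
  unfolding poly_ring_def
proof (clarsimp, goal_cases)
  case (1 m x)
  then obtain a b where "a \<in> keys p" "b \<in> keys q" "m = a + b" using keys_mult[of p q] by blast
  then show ?case using 1 keys_add[of a b] by blast
qed

lemma pr_csc: "p \<in> poly_ring W \<Longrightarrow> csc c p \<in> poly_ring W"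
  unfolding csc_def by (intro pr_mult) auto

lemma pr_sum: "(\<And>x. x \<in> A \<Longrightarrow> f x \<in> poly_ring W) \<Longrightarrow> sum f A \<in> poly_ring W"
  by (induct A rule: infinite_finite_induct) (auto simp: pr_add)

lemma fm_lookup: "v \<in> free_module W r \<Longrightarrow> lookup v p \<in> poly_ring W"
  unfolding free_module_def by blast

lemma fm_lookup_0:
  assumes "v \<in> free_module W r" "k \<ge> r j"
  shows "lookup v (j, k) = 0"
proof (rule ccontr)
  assume "lookup v (j, k) \<noteq> 0"
  then have "(j, k) \<in> keys v" by (simp add: in_keys_iff)
  then show False using assms unfolding free_module_def by fastforce
qed

lemma fmI:
  assumes "\<And>p. lookup v p \<in> poly_ring W" "\<And>j k. lookup v (j, k) \<noteq> 0 \<Longrightarrow> k < r j"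
  shows "v \<in> free_module W r"
  unfolding free_module_def using assms by (auto simp: in_keys_iff simp del: split_paired_All)

lemma fm_0 [simp]: "0 \<in> free_module W r" by (simp add: free_module_def)

lemma fm_add: "v \<in> free_module W r \<Longrightarrow> w \<in> free_module W r \<Longrightarrow> v + w \<in> free_module W r"
proof (rule fmI)
  fix j k assume "v \<in> free_module W r" "w \<in> free_module W r" "lookup (v + w) (j, k) \<noteq> 0"
  then show "k < r j" using fm_lookup_0[of v W r j k] fm_lookup_0[of w W r j k]
    by (cases "k < r j") (auto simp: lookup_add)
qed (simp add: lookup_add pr_add fm_lookup)

lemma fm_scal: "c \<in> poly_ring W \<Longrightarrow> v \<in> free_module W r \<Longrightarrow> scal c v \<in> free_module W r"
proof (rule fmI)
  fix j k assume "v \<in> free_module W r" "lookup (scal c v) (j, k) \<noteq> 0"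
  then show "k < r j" using fm_lookup_0[of v W r j k] by (cases "k < r j") auto
qed (simp add: pr_mult fm_lookup)

lemma fm_csv: "v \<in> free_module W r \<Longrightarrow> csv c v \<in> free_module W r"
  unfolding csv_def by (rule fm_scal) auto

lemma fm_subspace: "fv.subspace (free_module W r)"
  by (rule fv.subspaceI) (auto intro: fm_add fm_csv)

lemma fm_diff: "v \<in> free_module W r \<Longrightarrow> w \<in> free_module W r \<Longrightarrow> v - w \<in> free_module W r"
  using fm_subspace fv.subspace_diff by blast

lemma fm_sum: "(\<And>x. x \<in> A \<Longrightarrow> f x \<in> free_module W r) \<Longrightarrow> sum f A \<in> free_module W r"
  using fm_subspace fv.subspace_sum by blast

lemma fm_bas: "k < r j \<Longrightarrow> bas (j, k) \<in> free_module W r"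
  by (rule fmI) (auto simp: lookup_bas split: if_splits)

subsection \<open>Homogeneous components\<close>

text \<open>
  The homogeneous components of polynomials and vectors. The condition \<open>fst q \<le> d\<close> is there
  because the subtraction of natural numbers is truncated.
\<close>

definition pcomp :: "nat \<Rightarrow> ('x, 'k::field) mpoly \<Rightarrow> ('x, 'k) mpoly" where
  "pcomp d p = Poly_Mapping.mapp (\<lambda>m x. if mon_degree m = d then x else 0) p"

definition fcomp :: "nat \<Rightarrow> ('x, 'k::field) fvec \<Rightarrow> ('x, 'k) fvec" where
  "fcomp d v = Poly_Mapping.mapp (\<lambda>q p. if fst q \<le> d then pcomp (d - fst q) p else 0) v"

lemma lookup_pcomp: "lookup (pcomp d p) m = (if mon_degree m = d then lookup p m else 0)"
  by (auto simp: pcomp_def lookup_mapp when_def in_keys_iff)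

lemma pcomp_0 [simp]: "pcomp d 0 = 0"
  by (rule poly_mapping_eqI) (simp add: lookup_pcomp)

lemma lookup_fcomp:
  "lookup (fcomp d v) (j, k) = (if j \<le> d then pcomp (d - j) (lookup v (j, k)) else 0)"
  by (auto simp: fcomp_def lookup_mapp when_def in_keys_iff)

lemma lookup_lookup_fcomp:
  "lookup (lookup (fcomp d v) (j, k)) m = (if mon_degree m + j = d then lookup (lookup v (j, k)) m else 0)"
  by (auto simp: lookup_fcomp lookup_pcomp)

lemma pcomp_add: "pcomp d (p + q) = pcomp d p + pcomp d q"
  by (rule poly_mapping_eqI) (simp add: lookup_pcomp lookup_add)

lemma pcomp_sum: "pcomp d (sum f A) = (\<Sum>x\<in>A. pcomp d (f x))"
  by (induct A rule: infinite_finite_induct) (auto simp: pcomp_add)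

lemma pcomp_hom: "poly_homogeneous d (pcomp d p)"
  by (simp add: phom_iff lookup_pcomp)

lemma pcomp_id: "poly_homogeneous e p \<Longrightarrow> pcomp d p = (if d = e then p else 0)"
  by (rule poly_mapping_eqI) (auto simp: lookup_pcomp dest: phomD)

lemma pcomp_pr: "p \<in> poly_ring W \<Longrightarrow> pcomp d p \<in> poly_ring W"
proof -
  assume "p \<in> poly_ring W"
  moreover have "keys (pcomp d p) \<subseteq> keys p" unfolding pcomp_def by (rule keys_mapp_subset)
  ultimately show ?thesis unfolding poly_ring_def by fast
qed

lemma pcomp_mult_hom:
  assumes "poly_homogeneous e q"
  shows "pcomp d (p * q) = (if e \<le> d then pcomp (d - e) p * q else 0)"
proof -
  have 1: "pcomp d (single m c * q) =
     (if e \<le> d then pcomp (d - e) (single m c) * q else 0)" for m c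
  proof -
    have h: "poly_homogeneous (mon_degree m + e) (single m c * q)"
      by (intro phom_mult phom_single assms refl)
    show ?thesis unfolding pcomp_id[OF h]
      by (auto simp: pcomp_id[OF phom_single[OF refl]])
  qed
  show ?thesis
  proof -
    have p: "p = (\<Sum>m\<in>keys p. single m (lookup p m))"
      by (rule poly_mapping_sum_singles) auto
    have "pcomp d ((\<Sum>m\<in>keys p. single m (lookup p m)) * q) =
      (if e \<le> d then pcomp (d - e) (\<Sum>m\<in>keys p. single m (lookup p m)) * q else 0)"
      by (simp add: sum_distrib_right pcomp_sum 1)
    then show ?thesis using p by metis
  qed
qed

lemma fcomp_add: "fcomp d (v + w) = fcomp d v + fcomp d w"
  by (rule poly_mapping_eqI, rule poly_mapping_eqI) (auto simp: lookup_lookup_fcomp lookup_add)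

lemma fcomp_0 [simp]: "fcomp d 0 = 0"
  by (rule poly_mapping_eqI, rule poly_mapping_eqI) (auto simp: lookup_lookup_fcomp)

lemma fcomp_sum: "fcomp d (sum f A) = (\<Sum>x\<in>A. fcomp d (f x))"
  by (induct A rule: infinite_finite_induct) (auto simp: fcomp_add)

lemma fcomp_hom: "fvec_homogeneous d (fcomp d v)"
  by (auto simp: fhom_iff lookup_lookup_fcomp)

lemma fcomp_id: "fvec_homogeneous e v \<Longrightarrow> fcomp d v = (if d = e then v else 0)"
proof (rule poly_mapping_eqI, rule poly_mapping_eqI)
  fix q m assume "fvec_homogeneous e v"
  then show "lookup (lookup (fcomp d v) q) m = lookup (lookup (if d = e then v else 0) q) m"
    by (cases q) (auto simp: lookup_lookup_fcomp dest: fhomD)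
qed

lemma fcomp_fm: "v \<in> free_module W r \<Longrightarrow> fcomp d v \<in> free_module W r"
proof (rule fmI)
  fix p assume "v \<in> free_module W r"
  then show "lookup (fcomp d v) p \<in> poly_ring W"
    by (cases p) (auto simp: lookup_fcomp intro!: pcomp_pr fm_lookup)
next
  fix j k assume "v \<in> free_module W r" "lookup (fcomp d v) (j, k) \<noteq> 0"
  then show "k < r j" by (metis fm_lookup_0 lookup_fcomp pcomp_0 not_le)
qed

lemma fcomp_decompose:
  "\<exists>D. finite D \<and> v = (\<Sum>d\<in>D. fcomp d v)"
proof -
  define D where "D = (\<Union>q\<in>keys v. (\<lambda>m. mon_degree m + fst q) ` keys (lookup v q))"
  have fD: "finite D" unfolding D_def by auto
  have "v = (\<Sum>d\<in>D. fcomp d v)"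
  proof (rule poly_mapping_eqI, rule poly_mapping_eqI)
    fix q :: "nat \<times> nat" and m
    obtain j k where q: "q = (j, k)" by (cases q)
    have "lookup (lookup (\<Sum>d\<in>D. fcomp d v) q) m =
      (\<Sum>d\<in>D. if mon_degree m + j = d then lookup (lookup v (j, k)) m else 0)"
      by (simp add: lookup_sum lookup_lookup_fcomp q)
    also have "\<dots> = (if mon_degree m + j \<in> D then lookup (lookup v (j, k)) m else 0)"
      using fD by simp
    also have "\<dots> = lookup (lookup v q) m"
    proof (cases "lookup (lookup v (j, k)) m = 0")
      case False
      then have "(j, k) \<in> keys v" "m \<in> keys (lookup v (j, k))" by (auto simp: in_keys_iff)
      then have "mon_degree m + j \<in> D" unfolding D_def by force
      then show ?thesis using q by simp
    qed (use q in simp)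
    finally show "lookup (lookup v q) m = lookup (lookup (\<Sum>d\<in>D. fcomp d v) q) m" by simp
  qed
  with fD show ?thesis by blast
qed

subsection \<open>Graded homomorphisms\<close>

lemma graded_homD:
  assumes "graded_hom W r s f"
  shows "v \<in> free_module W r \<Longrightarrow> f v \<in> free_module W s"
    and "v \<in> free_module W r \<Longrightarrow> w \<in> free_module W r \<Longrightarrow> f (v + w) = f v + f w"
    and "c \<in> poly_ring W \<Longrightarrow> v \<in> free_module W r \<Longrightarrow> f (scal c v) = scal c (f v)"
    and "v \<in> free_module W r \<Longrightarrow> fvec_homogeneous d v \<Longrightarrow> fvec_homogeneous d (f v)"
  using assms unfolding graded_hom_def by blast+

lemma graded_hom_0: "graded_hom W r s f \<Longrightarrow> f 0 = 0"
  using graded_homD(2)[of W r s f 0 0] by fastforce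

lemma graded_hom_sum:
  assumes "graded_hom W r s f" "\<And>x. x \<in> A \<Longrightarrow> h x \<in> free_module W r"
  shows "f (sum h A) = (\<Sum>x\<in>A. f (h x))"
  using assms(2)
proof (induct A rule: infinite_finite_induct)
  case (insert x F)
  then have "sum h F \<in> free_module W r" by (intro fm_sum) auto
  then show ?case using insert graded_homD(2)[OF assms(1)] by simp
qed (auto simp: graded_hom_0[OF assms(1)])

text \<open>
  A graded homomorphism maps the decomposition of \<open>v\<close> into homogeneous components to that
  of \<open>f v\<close>.
\<close>

lemma graded_hom_fcomp:
  assumes f: "graded_hom W r s f" and v: "v \<in> free_module W r"
  shows "f (fcomp d v) = fcomp d (f v)"
proof -
  obtain D where D: "finite D" "v = (\<Sum>d\<in>D. fcomp d v)" using fcomp_decompose by blast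
  have "f v = (\<Sum>e\<in>D. f (fcomp e v))"
    using graded_hom_sum[OF f, of D "\<lambda>d. fcomp d v"] fcomp_fm[OF v] D(2) by metis
  then have "fcomp d (f v) = (\<Sum>e\<in>D. fcomp d (f (fcomp e v)))"
    by (simp only: fcomp_sum)
  also have "\<dots> = (\<Sum>e\<in>D. if d = e then f (fcomp d v) else 0)"
    by (rule sum.cong)
      (auto simp: fcomp_id[OF graded_homD(4)[OF f fcomp_fm[OF v] fcomp_hom]])
  also have "\<dots> = f (fcomp d v)"
  proof (cases "d \<in> D")
    case False
    have "fcomp d v = (\<Sum>e\<in>D. fcomp d (fcomp e v))"
      using D(2) fcomp_sum by metis
    also have "\<dots> = 0" using False by (intro sum.neutral) (auto simp: fcomp_id[OF fcomp_hom])
    finally show ?thesis using False graded_hom_0[OF f] D(1) by simp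
  qed (use D(1) in simp)
  finally show ?thesis by simp
qed

section \<open>Separating functionals for the ideal of a bipartite graph\<close>

text \<open>
  An edge is an ordered pair, so that every edge has one generator with a definite sign.
\<close>

definition ebin :: "'v \<times> 'v \<Rightarrow> ('v bvar, 'k::field) mpoly" where
  "ebin e = mvar (Xvar (fst e)) * mvar (Yvar (snd e)) - mvar (Xvar (snd e)) * mvar (Yvar (fst e))"

text \<open>
  In a bipartite graph all edges can be oriented from one side to the other, and then no vertex
  is both a source and a target. In this form the two sides need not be named.
\<close>

definition bip :: "('v \<times> 'v) set \<Rightarrow> bool" where
  "bip E \<longleftrightarrow> fst ` E \<inter> snd ` E = {}"

definition mx :: "'v \<Rightarrow> 'v bvar \<Rightarrow>\<^sub>0 nat" where "mx v = single (Xvar v) 1"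
definition my :: "'v \<Rightarrow> 'v bvar \<Rightarrow>\<^sub>0 nat" where "my v = single (Yvar v) 1"

lemma ebin_single:
  "ebin (a, b) = single (mx a + my b) 1 - single (mx b + my a) 1"
  by (simp add: ebin_def mvar_def mult_single mx_def my_def)

text \<open>
  For the grading by \<open>vdeg\<close> the two variables at a vertex have the same degree; edge
  binomials and monomials are homogeneous. The functions \<open>xcount\<close> refine this grading for monomials.
\<close>

definition vdeg :: "('v bvar \<Rightarrow>\<^sub>0 nat) \<Rightarrow> 'v \<Rightarrow> nat" where
  "vdeg m v = lookup m (Xvar v) + lookup m (Yvar v)"

definition xcount :: "'v set \<Rightarrow> ('v bvar \<Rightarrow>\<^sub>0 nat) \<Rightarrow> nat" where
  "xcount A m = (\<Sum>v\<in>A. lookup m (Xvar v))"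

lemma vdeg_add: "vdeg (m + m') v = vdeg m v + vdeg m' v"
  by (simp add: vdeg_def lookup_add)

lemma vdeg_mx [simp]: "vdeg (mx u) v = (if v = u then 1 else 0)"
  by (simp add: vdeg_def mx_def my_def lookup_single when_def)

lemma vdeg_my [simp]: "vdeg (my u) v = (if v = u then 1 else 0)"
  by (simp add: vdeg_def mx_def my_def lookup_single when_def)

lemma xcount_add: "xcount A (m + m') = xcount A m + xcount A m'"
  by (simp add: xcount_def lookup_add sum.distrib)

lemma xcount_mx [simp]: "finite A \<Longrightarrow> xcount A (mx u) = (if u \<in> A then 1 else 0)"
  by (simp add: xcount_def mx_def my_def lookup_single when_def eq_commute[of u])

lemma xcount_my [simp]: "xcount A (my u) = 0"
  by (simp add: xcount_def mx_def my_def lookup_single when_def)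

text \<open>
  The functionals that will vanish on the ideal: sums of the coefficients over a class of monomials.
\<close>

definition csum :: "(('x \<Rightarrow>\<^sub>0 nat) \<Rightarrow> bool) \<Rightarrow> ('x, 'k::field) mpoly \<Rightarrow> 'k" where
  "csum Q p = (\<Sum>m\<in>keys p. if Q m then lookup p m else 0)"

lemma csum_superset:
  assumes "finite A" "keys p \<subseteq> A"
  shows "csum Q p = (\<Sum>m\<in>A. if Q m then lookup p m else 0)"
  unfolding csum_def using assms by (intro sum.mono_neutral_left) (auto simp: in_keys_iff)

lemma csum_add: "csum Q (p + q) = csum Q p + csum Q q"
proof -
  have *: "csum Q r = (\<Sum>m\<in>keys p \<union> keys q. if Q m then lookup r m else 0)" if "r \<in> {p, q, p + q}" for r
    using that keys_add[of p q] by (intro csum_superset) auto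
  then have "csum Q p + csum Q q = (\<Sum>m\<in>keys p \<union> keys q. (if Q m then lookup p m else 0) + (if Q m then lookup q m else 0))"
    by (simp add: sum.distrib)
  also have "\<dots> = (\<Sum>m\<in>keys p \<union> keys q. if Q m then lookup (p + q) m else 0)"
    by (rule sum.cong) (auto simp: lookup_add)
  finally show ?thesis using * by simp
qed

lemma csum_0 [simp]: "csum Q 0 = 0"
  by (simp add: csum_def)

lemma csum_diff: "csum Q (p - q) = csum Q p - csum Q q"
  using csum_add[of Q "p - q" q] by simp

lemma csum_sum: "csum Q (sum f A) = (\<Sum>x\<in>A. csum Q (f x))"
  by (induct A rule: infinite_finite_induct) (auto simp: csum_add)

lemma csum_single [simp]: "csum Q (single m c) = (if Q m then c else 0)"
  by (cases "c = 0") (auto simp: csum_def)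

lemma csum_mult_single:
  "csum Q (p * single s 1) = csum (\<lambda>m. Q (m + s)) p"
proof -
  have "p * single s 1 = (\<Sum>m\<in>keys p. single m (lookup p m)) * single s 1"
    by (rule arg_cong[where f = "\<lambda>x. x * _"]) (rule poly_mapping_sum_singles, auto)
  then have "csum Q (p * single s 1) =
      (\<Sum>m\<in>keys p. if Q (m + s) then lookup p m else 0)"
    by (simp only: sum_distrib_right csum_sum mult_single csum_single mult_1_right)
  then show ?thesis by (simp add: csum_def)
qed

lemma csum_unique:
  assumes "finite M" "\<And>m. m \<in> M \<Longrightarrow> Q m" "\<And>m. Q m \<Longrightarrow> lookup p m \<noteq> 0 \<Longrightarrow> m \<in> M"
  shows "csum Q p = (\<Sum>m\<in>M. lookup p m)"
proof -
  have "csum Q p = (\<Sum>m\<in>keys p \<union> M. if Q m then lookup p m else 0)"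
    using assms(1) by (intro csum_superset) auto
  also have "\<dots> = (\<Sum>m\<in>M. if Q m then lookup p m else 0)"
    using assms by (intro sum.mono_neutral_right) auto
  also have "\<dots> = (\<Sum>m\<in>M. lookup p m)" using assms(2) by (intro sum.cong) auto
  finally show ?thesis .
qed

text \<open>
  Within \<open>T\<close>, the set \<open>A\<close> is a union of connected components.
\<close>

definition closed_in :: "('v \<times> 'v) set \<Rightarrow> 'v set \<Rightarrow> 'v set \<Rightarrow> bool" where
  "closed_in E T A \<longleftrightarrow> (\<forall>(s, t)\<in>E. s \<in> T \<longrightarrow> t \<in> T \<longrightarrow> (s \<in> A \<longleftrightarrow> t \<in> A))"

text \<open>
  Let \<open>\<alpha>\<close> be the multidegree \<open>\<beta>\<close> enlarged by \<open>a\<close> and \<open>b\<close>. The sum of the coefficients over the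
  monomials of multidegree \<open>\<alpha>\<close> with given numbers of \<open>x\<close>-variables at \<open>A\<close> and at \<open>T\<close> vanishes
  on the ideal, as the two monomials of a multiple of \<open>ebin e\<close> are in the same class: either
  both ends of \<open>e\<close> are in \<open>A\<close>, or none is, or \<open>e\<close> leaves \<open>T\<close> and the multidegree is not \<open>\<alpha>\<close>.
  As \<open>a \<in> A\<close> and \<open>b \<notin> A\<close>, multiplication of \<open>p\<close> by the first monomial of \<open>ebin (a, b)\<close>
  raises the count at \<open>A\<close>, while multiplication by the second one does not. So the class sums of
  \<open>p\<close> for the counts \<open>k\<close> and \<open>k + 1\<close> agree, and the one for \<open>0\<close> vanishes.
\<close>

lemma class_sum_zero:
  fixes p :: "('v bvar, 'k::field) mpoly"
  assumes T: "finite T" "A \<subseteq> T" "a \<in> A" "b \<in> T - A" "\<And>v. \<beta> v \<noteq> 0 \<Longrightarrow> v \<in> T"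
    and cl: "closed_in E T A"
    and eq: "p * ebin (a, b) = (\<Sum>e\<in>E. c e * ebin e)"
  shows "csum (\<lambda>m. vdeg m = \<beta> \<and> xcount A m = k \<and> xcount T m = l) p = 0"
proof -
  define \<alpha> where "\<alpha> = (\<lambda>v. \<beta> v + (if v = a then 1 else 0) + (if v = b then 1 else 0))"
  define Q where "Q k m \<longleftrightarrow> vdeg m = \<alpha> \<and> xcount A m = k \<and> xcount T m = Suc l" for k m
  define R where "R k m \<longleftrightarrow> vdeg m = \<beta> \<and> xcount A m = k \<and> xcount T m = l" for k m
  have fA: "finite A" using T finite_subset by blast
  have ab: "a \<noteq> b" "a \<in> T" "b \<in> T" "b \<notin> A" using T by auto
  have \<alpha>T: "v \<in> T" if "\<alpha> v \<noteq> 0" for v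
    using that ab T(5) by (auto simp: \<alpha>_def split: if_splits)
  have eb: "csum (Q k) (q * ebin (s, t)) =
    csum (\<lambda>m. Q k (m + (mx s + my t))) q - csum (\<lambda>m. Q k (m + (mx t + my s))) q" for k q s t
    by (simp add: ebin_single right_diff_distrib csum_diff csum_mult_single)
  have zero: "csum (Q k) (q * ebin e) = 0" if "e \<in> E" for k q e
  proof -
    obtain s t where e: "e = (s, t)" by (cases e)
    have vd: "vdeg (m + (mx s + my t)) = vdeg (m + (mx t + my s))" for m
      by (auto simp: fun_eq_iff vdeg_add)
    have "Q k (m + (mx s + my t)) = Q k (m + (mx t + my s))" for m
    proof (cases "s \<in> T \<and> t \<in> T")
      case True
      then have "s \<in> A \<longleftrightarrow> t \<in> A" using cl that e unfolding closed_in_def by auto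
      then show ?thesis using True vd[of m] fA T(1) by (simp add: Q_def xcount_add)
    next
      case False
      have "vdeg (m + (mx s + my t)) \<noteq> \<alpha>"
      proof
        assume "vdeg (m + (mx s + my t)) = \<alpha>"
        then have "\<alpha> s \<noteq> 0" "\<alpha> t \<noteq> 0" by (auto simp: vdeg_add)
        then show False using \<alpha>T False by blast
      qed
      then show ?thesis using vd[of m] by (simp add: Q_def)
    qed
    then show ?thesis unfolding e eb by simp
  qed
  have Qp: "csum (Q k) (p * ebin (a, b)) = 0" for k
    unfolding eq csum_sum by (rule sum.neutral) (blast intro: zero)
  have \<alpha>\<beta>: "vdeg (m + (mx a + my b)) = \<alpha> \<longleftrightarrow> vdeg m = \<beta>" "vdeg (m + (mx b + my a)) = \<alpha> \<longleftrightarrow> vdeg m = \<beta>" for m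
    using ab by (auto simp: fun_eq_iff vdeg_add \<alpha>_def)
  have Q1: "(\<lambda>m. Q (Suc k) (m + (mx a + my b))) = R k" for k
    using fA T(1,3) ab by (intro ext) (simp add: Q_def R_def \<alpha>\<beta> xcount_add)
  have Q2: "(\<lambda>m. Q k (m + (mx b + my a))) = R k" for k
    using fA T(1) ab by (intro ext) (simp add: Q_def R_def \<alpha>\<beta> xcount_add)
  \<comment> \<open>The first monomial contributes a variable at \<open>A\<close>: this starts the induction.\<close>
  have Q0: "\<not> Q 0 (m + (mx a + my b))" for m
    using fA T(3) by (simp add: Q_def xcount_add)
  have "csum (R k) p = 0" for k
  proof (induct k)
    case 0
    have "csum (\<lambda>m. Q 0 (m + (mx a + my b))) p = 0" by (simp add: Q0 csum_def)
    then show ?case using Qp[of 0] unfolding eb Q2 by simp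
  next
    case (Suc k)
    then show ?case using Qp[of "Suc k"] unfolding eb Q1 Q2 by simp
  qed
  then show ?thesis unfolding R_def .
qed

subsection \<open>Monomials of degree one and two\<close>

lemma mon_degree_SucE:
  assumes "mon_degree m = Suc n"
  obtains z m' where "m = single z 1 + m'" "mon_degree m' = n"
proof -
  have "keys m \<noteq> {}"
  proof
    assume "keys m = {}"
    then show False using assms unfolding mon_degree_def by simp
  qed
  then obtain z where "z \<in> keys m" by blast
  then have z: "lookup m z \<noteq> 0" by (simp only: in_keys_iff not_False_eq_True)
  have "m = single z 1 + (m - single z 1)"
    using z by (intro poly_mapping_eqI) (auto simp: lookup_add lookup_minus lookup_single when_def)
  moreover have "mon_degree (single z 1 + (m - single z 1)) = Suc n"
    using calculation assms by simp
  then have "mon_degree (m - single z 1) = n" by (simp add: mon_degree_add)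
  ultimately show ?thesis using that by blast
qed

lemma mon_degree_1_cases:
  assumes "mon_degree m = 1"
  obtains c where "m = mx c" | c where "m = my c"
proof -
  obtain z m' where "m = single z 1 + m'" "mon_degree m' = 0"
    using assms mon_degree_SucE[of m 0] by auto
  then have "m = single z 1" by (simp only: mon_degree_eq_0 add_0_right)
  then show ?thesis using that by (cases z) (auto simp: mx_def my_def)
qed

lemma mon_degree_2_cases:
  assumes "mon_degree m = 2"
  obtains c d where "m = mx c + mx d" | c d where "m = my c + my d" | c d where "m = mx c + my d"
proof -
  obtain z m' where m: "m = single z 1 + m'" "mon_degree m' = 1"
    using assms mon_degree_SucE[of m 1] by (auto simp: numeral_2_eq_2)
  show ?thesis
  proof (cases z; rule mon_degree_1_cases[OF m(2)])
    fix u v assume "z = Yvar u" "m' = mx v"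
    then show ?thesis using m(1) that(3)[of v u] by (simp add: add.commute my_def)
  qed (use m(1) that in \<open>auto simp: mx_def my_def\<close>)
qed

lemma pair_fun_eq:
  assumes "(\<lambda>v. (if v = u then 1 else 0) + (if v = w then 1 else (0::nat))) =
           (\<lambda>v. (if v = c then 1 else 0) + (if v = d then 1 else 0))"
  shows "u = c \<and> w = d \<or> u = d \<and> w = c"
proof -
  have e: "(if v = u then 1 else 0) + (if v = w then 1 else (0::nat)) =
      (if v = c then 1 else 0) + (if v = d then 1 else 0)" for v
    using fun_cong[OF assms, of v] .
  show ?thesis
  proof (cases "u = c")
    case True
    then show ?thesis using e[of w] e[of d] by (cases "w = d") (simp_all split: if_split_asm)
  next
    case False
    then have "u = d" using e[of u] by (simp split: if_split_asm)
    then show ?thesis using False e[of w] e[of c] by (cases "w = c") (simp_all split: if_split_asm)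
  qed
qed

lemma vdeg_pair:
  "vdeg (mx u + mx w) = (\<lambda>v. (if v = u then 1 else 0) + (if v = w then 1 else 0))"
  "vdeg (my u + my w) = (\<lambda>v. (if v = u then 1 else 0) + (if v = w then 1 else 0))"
  "vdeg (mx u + my w) = (\<lambda>v. (if v = u then 1 else 0) + (if v = w then 1 else 0))"
  by (auto simp: fun_eq_iff vdeg_add)

lemma pair_mon_eq [simp]:
  "mx u + my w = mx u' + my w' \<longleftrightarrow> u = u' \<and> w = w'"
  "mx u + mx w = mx u' + mx w' \<longleftrightarrow> u = u' \<and> w = w' \<or> u = w' \<and> w = u'"
  "my u + my w = my u' + my w' \<longleftrightarrow> u = u' \<and> w = w' \<or> u = w' \<and> w = u'"
  "mx u + mx w \<noteq> mx u' + my w'" "mx u' + my w' \<noteq> mx u + mx w"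
  "my u + my w \<noteq> mx u' + my w'" "mx u' + my w' \<noteq> my u + my w"
  "mx u + mx w \<noteq> my u' + my w'" "my u' + my w' \<noteq> mx u + mx w"
proof -
  let ?T = "{u, w, u', w'}"
  have x: "xcount ?T (mx u + mx w) = 2" "xcount ?T (mx u' + mx w') = 2"
    "xcount ?T (mx u + my w) = 1" "xcount ?T (mx u' + my w') = 1"
    "xcount ?T (my u + my w) = 0" "xcount ?T (my u' + my w') = 0"
    by (auto simp: xcount_add)
  show "mx u + my w = mx u' + my w' \<longleftrightarrow> u = u' \<and> w = w'"
  proof
    assume e: "mx u + my w = mx u' + my w'"
    have "lookup (mx u + my w) (Xvar u) = 1" "lookup (mx u + my w) (Yvar w) = 1"
      by (auto simp: lookup_add lookup_single when_def mx_def my_def)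
    then show "u = u' \<and> w = w'"
      unfolding e by (auto simp: lookup_add lookup_single when_def mx_def my_def split: if_splits)
  qed simp
  show "mx u + mx w = mx u' + mx w' \<longleftrightarrow> u = u' \<and> w = w' \<or> u = w' \<and> w = u'"
  proof
    assume "mx u + mx w = mx u' + mx w'"
    then have "vdeg (mx u + mx w) = vdeg (mx u' + mx w')" by simp
    then show "u = u' \<and> w = w' \<or> u = w' \<and> w = u'" unfolding vdeg_pair by (rule pair_fun_eq)
  qed (auto simp: add.commute)
  show "my u + my w = my u' + my w' \<longleftrightarrow> u = u' \<and> w = w' \<or> u = w' \<and> w = u'"
  proof
    assume "my u + my w = my u' + my w'"
    then have "vdeg (my u + my w) = vdeg (my u' + my w')" by simp
    then show "u = u' \<and> w = w' \<or> u = w' \<and> w = u'" unfolding vdeg_pair by (rule pair_fun_eq)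
  qed (auto simp: add.commute)
  show "mx u + mx w \<noteq> mx u' + my w'" "mx u' + my w' \<noteq> mx u + mx w"
  "my u + my w \<noteq> mx u' + my w'" "mx u' + my w' \<noteq> my u + my w"
  "mx u + mx w \<noteq> my u' + my w'" "my u' + my w' \<noteq> mx u + mx w"
    by - ((rule notI, drule arg_cong[of _ _ "xcount ?T"], (simp only: x; simp))+)
qed

text \<open>
  The classes of quadratic monomials for the vertices \<open>c, d\<close>: those of \<open>x\<^sub>c x\<^sub>d\<close> and \<open>y\<^sub>c y\<^sub>d\<close> are
  singletons, and \<open>x\<^sub>c y\<^sub>d\<close> shares its class with \<open>x\<^sub>d y\<^sub>c\<close> unless \<open>A\<close> separates \<open>c\<close> from \<open>d\<close>.
\<close>

lemma csum_class_xx: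
  assumes T: "finite T" "A \<subseteq> T" "c \<in> T" "d \<in> T" and p: "poly_homogeneous 2 p"
  shows "csum (\<lambda>m. vdeg m = vdeg (mx c + mx d) \<and> xcount A m = xcount A (mx c + mx d) \<and> xcount T m = 2) p
    = lookup p (mx c + mx d)"
proof -
  have "csum (\<lambda>m. vdeg m = vdeg (mx c + mx d) \<and> xcount A m = xcount A (mx c + mx d) \<and> xcount T m = 2) p
    = (\<Sum>m\<in>{mx c + mx d}. lookup p m)"
  proof (rule csum_unique)
    fix m assume Q: "vdeg m = vdeg (mx c + mx d) \<and> xcount A m = xcount A (mx c + mx d) \<and> xcount T m = 2"
      and nz: "lookup p m \<noteq> 0"
    have "mon_degree m = 2" using p nz phomD by blast
    then show "m \<in> {mx c + mx d}"
    proof (cases rule: mon_degree_2_cases)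
      case (1 u v)
      then have "u = c \<and> v = d \<or> u = d \<and> v = c" using Q by (auto simp: vdeg_pair dest!: pair_fun_eq)
      then show ?thesis using 1 by auto
    qed (use Q T in \<open>auto simp: xcount_add split: if_splits\<close>)
  qed (use T in \<open>auto simp: xcount_add\<close>)
  then show ?thesis by simp
qed

lemma csum_class_yy:
  assumes T: "finite T" "A \<subseteq> T" "c \<in> T" "d \<in> T" and p: "poly_homogeneous 2 p"
  shows "csum (\<lambda>m. vdeg m = vdeg (my c + my d) \<and> xcount A m = 0 \<and> xcount T m = 0) p
    = lookup p (my c + my d)"
proof -
  have "csum (\<lambda>m. vdeg m = vdeg (my c + my d) \<and> xcount A m = 0 \<and> xcount T m = 0) p
    = (\<Sum>m\<in>{my c + my d}. lookup p m)"
  proof (rule csum_unique)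
    fix m assume Q: "vdeg m = vdeg (my c + my d) \<and> xcount A m = 0 \<and> xcount T m = 0"
      and nz: "lookup p m \<noteq> 0"
    have "mon_degree m = 2" using p nz phomD by blast
    then show "m \<in> {my c + my d}"
    proof (cases rule: mon_degree_2_cases)
      case (1 u v)
      then have "u = c \<and> v = d \<or> u = d \<and> v = c" using Q by (auto simp: vdeg_pair dest!: pair_fun_eq)
      then show ?thesis using 1 Q T by (auto simp: xcount_add)
    next
      case (2 u v)
      then have "u = c \<and> v = d \<or> u = d \<and> v = c" using Q by (auto simp: vdeg_pair dest!: pair_fun_eq)
      then show ?thesis using 2 by auto
    next
      case (3 u v)
      then have "u = c \<and> v = d \<or> u = d \<and> v = c" using Q by (auto simp: vdeg_pair dest!: pair_fun_eq)
      then show ?thesis using 3 Q T by (auto simp: xcount_add)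
    qed
  qed (use T in \<open>auto simp: xcount_add\<close>)
  then show ?thesis by simp
qed

lemma csum_class_xy:
  assumes T: "finite T" "A \<subseteq> T" "c \<in> T" "d \<in> T" and p: "poly_homogeneous 2 p"
  shows "csum (\<lambda>m. vdeg m = vdeg (mx c + my d) \<and> xcount A m = xcount A (mx c + my d) \<and> xcount T m = 1) p
    = lookup p (mx c + my d) + (if c \<noteq> d \<and> (c \<in> A \<longleftrightarrow> d \<in> A) then lookup p (mx d + my c) else 0)"
proof -
  let ?M = "insert (mx c + my d) (if c \<noteq> d \<and> (c \<in> A \<longleftrightarrow> d \<in> A) then {mx d + my c} else {})"
  have fA: "finite A" using T finite_subset by blast
  have "csum (\<lambda>m. vdeg m = vdeg (mx c + my d) \<and> xcount A m = xcount A (mx c + my d) \<and> xcount T m = 1) p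
    = (\<Sum>m\<in>?M. lookup p m)"
  proof (rule csum_unique)
    fix m assume Q: "vdeg m = vdeg (mx c + my d) \<and> xcount A m = xcount A (mx c + my d) \<and> xcount T m = 1"
      and nz: "lookup p m \<noteq> 0"
    have "mon_degree m = 2" using p nz phomD by blast
    then show "m \<in> ?M"
    proof (cases rule: mon_degree_2_cases)
      case (1 u v)
      then have "u = c \<and> v = d \<or> u = d \<and> v = c" using Q by (auto simp: vdeg_pair dest!: pair_fun_eq)
      then show ?thesis using 1 Q T by (auto simp: xcount_add)
    next
      case (3 u v)
      then have "u = c \<and> v = d \<or> u = d \<and> v = c" using Q by (auto simp: vdeg_pair dest!: pair_fun_eq)
      then show ?thesis using 3 Q T fA by (auto simp: xcount_add split: if_splits)
    qed (use Q T in \<open>auto simp: xcount_add\<close>)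
  next
    fix m assume "m \<in> ?M"
    then show "vdeg m = vdeg (mx c + my d) \<and> xcount A m = xcount A (mx c + my d) \<and> xcount T m = 1"
      using T fA by (auto simp: xcount_add vdeg_pair fun_eq_iff split: if_splits)
  qed auto
  then show ?thesis by (auto simp: eq_commute[of c d])
qed

section \<open>Quadratic syzygies of the edge binomials\<close>

text \<open>
  The coefficients of a syzygy are extended by \<open>0\<close> outside the edge set, so that all syzygies
  over subsets of the edges live in one vector space. The set \<open>colon_part W E e\<close> is the degree
  two part of the colon ideal of \<open>ebin e\<close>, and \<open>quartic_part W E\<close> is the degree four part of the
  ideal of \<open>E\<close>.
\<close>

definition hpoly :: "nat \<Rightarrow> 'x set \<Rightarrow> ('x, 'k::field) mpoly set" where
  "hpoly d W = {p \<in> poly_ring W. poly_homogeneous d p}"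

definition bvars :: "'v set \<Rightarrow> 'v bvar set" where
  "bvars T = Xvar ` T \<union> Yvar ` T"

definition syz :: "nat \<Rightarrow> 'v bvar set \<Rightarrow> ('v \<times> 'v) set \<Rightarrow> ('v \<times> 'v \<Rightarrow> ('v bvar, 'k::field) mpoly) set" where
  "syz d W E = {c. (\<forall>e. e \<notin> E \<longrightarrow> c e = 0) \<and> (\<forall>e\<in>E. c e \<in> hpoly d W) \<and> (\<Sum>e\<in>E. c e * ebin e) = 0}"

definition quartic_part :: "'v bvar set \<Rightarrow> ('v \<times> 'v) set \<Rightarrow> ('v bvar, 'k::field) mpoly set" where
  "quartic_part W E = {\<Sum>e\<in>E. c e * ebin e | c. \<forall>e\<in>E. c e \<in> hpoly 2 W}"

definition colon_part :: "'v bvar set \<Rightarrow> ('v \<times> 'v) set \<Rightarrow> 'v \<times> 'v \<Rightarrow> ('v bvar, 'k::field) mpoly set" where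
  "colon_part W E e0 = {p \<in> hpoly 2 W. p * ebin e0 \<in> quartic_part W E}"

lemma hpoly_subspace: "mp.subspace (hpoly d W)"
  by (rule mp.subspaceI) (auto simp: hpoly_def pr_add phom_add pr_csc phom_csc)

lemma csc_mult: "csc c p * q = csc c (p * q)"
  by (simp add: csc_def mult.assoc)

lemma csc_sum: "csc c (sum f A) = (\<Sum>x\<in>A. csc c (f x))"
  by (rule mp.scale_sum_right)

lemma quartic_part_subspace: "mp.subspace (quartic_part W E :: ('v bvar, 'k::field) mpoly set)"
proof (rule mp.subspaceI)
  show "0 \<in> quartic_part W E" unfolding quartic_part_def
    using mp.subspace_0[OF hpoly_subspace] by (intro CollectI exI[of _ "\<lambda>_. 0"]) auto
next
  fix x y :: "('v bvar, 'k) mpoly" assume "x \<in> quartic_part W E" "y \<in> quartic_part W E"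
  then obtain c d where "x = (\<Sum>e\<in>E. c e * ebin e)" "\<forall>e\<in>E. c e \<in> hpoly 2 W"
    "y = (\<Sum>e\<in>E. d e * ebin e)" "\<forall>e\<in>E. d e \<in> hpoly 2 W"
    unfolding quartic_part_def by blast
  then show "x + y \<in> quartic_part W E" unfolding quartic_part_def
    by (intro CollectI exI[of _ "\<lambda>e. c e + d e"])
      (auto simp: distrib_right sum.distrib intro!: mp.subspace_add[OF hpoly_subspace])
next
  fix k and x :: "('v bvar, 'k) mpoly" assume "x \<in> quartic_part W E"
  then obtain c where "x = (\<Sum>e\<in>E. c e * ebin e)" "\<forall>e\<in>E. c e \<in> hpoly 2 W"
    unfolding quartic_part_def by blast
  then show "csc k x \<in> quartic_part W E" unfolding quartic_part_def
    by (intro CollectI exI[of _ "\<lambda>e. csc k (c e)"])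
      (auto simp: csc_mult csc_sum intro!: mp.subspace_scale[OF hpoly_subspace])
qed

lemma quartic_part_mult:
  assumes "finite E" "e \<in> E" "q \<in> hpoly 2 W"
  shows "q * ebin e \<in> quartic_part W E"
  unfolding quartic_part_def using assms mp.subspace_0[OF hpoly_subspace]
  by (intro CollectI exI[of _ "\<lambda>x. if x = e then q else 0"]) (auto simp: if_distrib[of "\<lambda>x. x * _"] cong: if_cong)

lemma colon_part_subspace: "mp.subspace (colon_part W E e :: ('v bvar, 'k::field) mpoly set)"
proof (rule mp.subspaceI)
  show "0 \<in> colon_part W E e"
    using mp.subspace_0[OF hpoly_subspace] mp.subspace_0[OF quartic_part_subspace]
    by (auto simp: colon_part_def)
next
  fix x y :: "('v bvar, 'k) mpoly" assume "x \<in> colon_part W E e" "y \<in> colon_part W E e"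
  then show "x + y \<in> colon_part W E e"
    using mp.subspace_add[OF hpoly_subspace] mp.subspace_add[OF quartic_part_subspace]
    by (auto simp: colon_part_def distrib_right)
next
  fix k and x :: "('v bvar, 'k) mpoly" assume "x \<in> colon_part W E e"
  then show "csc k x \<in> colon_part W E e"
    using mp.subspace_scale[OF hpoly_subspace] mp.subspace_scale[OF quartic_part_subspace]
    by (auto simp: colon_part_def csc_mult)
qed

lemma syz_subspace: "fam.subspace (syz d W E :: ('a \<times> 'a \<Rightarrow> ('a bvar, 'b::field) mpoly) set)"
proof (rule fam.subspaceI)
  show "0 \<in> syz d W E" using mp.subspace_0[OF hpoly_subspace] by (auto simp: syz_def)
next
  fix x y :: "'a \<times> 'a \<Rightarrow> ('a bvar, 'b) mpoly"
  assume "x \<in> syz d W E" "y \<in> syz d W E"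
  then show "x + y \<in> syz d W E"
    by (auto simp: syz_def distrib_right sum.distrib intro!: mp.subspace_add[OF hpoly_subspace])
next
  fix k and x :: "'a \<times> 'a \<Rightarrow> ('a bvar, 'b) mpoly" assume "x \<in> syz d W E"
  then show "csf k x \<in> syz d W E"
    by (auto simp: syz_def csf_def csc_mult simp flip: csc_sum intro!: mp.subspace_scale[OF hpoly_subspace])
qed

lemma fun_poly_pair: "vector_space_pair (csf :: 'k::field \<Rightarrow> ('e \<Rightarrow> ('x, 'k) mpoly) \<Rightarrow> _) (csc :: 'k \<Rightarrow> ('x, 'k) mpoly \<Rightarrow> _)"
  by (simp add: vector_space_pair_def fam.vector_space_axioms mp.vector_space_axioms)

text \<open>
  The coefficient of the new edge is a linear map on the syzygies. Its kernel consists of the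
  old syzygies; its image is the colon ideal, since \<open>p f\<close> is in the old ideal if and only if \<open>p\<close>
  can be completed to a syzygy.
\<close>

lemma syz_step:
  fixes W :: "'v bvar set"
  assumes fin: "finite E" and new: "e0 \<notin> E"
    and s: "fam.has_dim (syz 2 W E :: ('v \<times> 'v \<Rightarrow> ('v bvar, 'k::field) mpoly) set) k"
    and p: "mp.has_dim (colon_part W E e0 :: ('v bvar, 'k) mpoly set) n"
  shows "fam.has_dim (syz 2 W (insert e0 E) :: ('v \<times> 'v \<Rightarrow> ('v bvar, 'k) mpoly) set) (k + n)"
proof (rule vector_space_pair.rank_nullity_on[OF fun_poly_pair, where f = "\<lambda>c. c e0"])
  have k: "{c \<in> syz 2 W (insert e0 E). c e0 = 0} = (syz 2 W E :: ('v \<times> 'v \<Rightarrow> ('v bvar, 'k) mpoly) set)"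
  proof (intro equalityI subsetI)
    fix c :: "'v \<times> 'v \<Rightarrow> ('v bvar, 'k) mpoly" assume c: "c \<in> {c \<in> syz 2 W (insert e0 E). c e0 = 0}"
    then have "c e = 0" if "e \<notin> E" for e using that unfolding syz_def by (cases "e = e0") blast+
    then show "c \<in> syz 2 W E" using c fin new by (simp add: syz_def)
  next
    fix c :: "'v \<times> 'v \<Rightarrow> ('v bvar, 'k) mpoly" assume c: "c \<in> syz 2 W E"
    then have "c e0 = 0" using new unfolding syz_def by blast
    then show "c \<in> {c \<in> syz 2 W (insert e0 E). c e0 = 0}"
      using c fin new mp.subspace_0[OF hpoly_subspace] by (simp add: syz_def)
  qed
  show "fam.has_dim {c \<in> syz 2 W (insert e0 E). c e0 = (0 :: ('v bvar, 'k) mpoly)} k" unfolding k by (rule s)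
  have "(\<lambda>c. c e0) ` syz 2 W (insert e0 E) = (colon_part W E e0 :: ('v bvar, 'k) mpoly set)"
  proof (intro equalityI subsetI)
    fix p :: "('v bvar, 'k) mpoly" assume "p \<in> (\<lambda>c. c e0) ` syz 2 W (insert e0 E)"
    then obtain c where c: "p = c e0" "c \<in> syz 2 W (insert e0 E)" by blast
    have "p * ebin e0 + (\<Sum>e\<in>E. c e * ebin e) = 0" and h: "p \<in> hpoly 2 W" "\<forall>e\<in>E. c e \<in> hpoly 2 W"
      using c fin new by (auto simp: syz_def)
    then have "p * ebin e0 = (\<Sum>e\<in>E. (- c e) * ebin e)"
      by (simp add: sum_negf eq_neg_iff_add_eq_0)
    moreover have "\<forall>e\<in>E. - c e \<in> hpoly 2 W" using h mp.subspace_neg[OF hpoly_subspace] by blast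
    ultimately show "p \<in> colon_part W E e0" using h unfolding colon_part_def quartic_part_def
      by (intro CollectI conjI exI[of _ "\<lambda>e. - c e"]) auto
  next
    fix p :: "('v bvar, 'k) mpoly" assume "p \<in> colon_part W E e0"
    then obtain c where c: "p \<in> hpoly 2 W" "p * ebin e0 = (\<Sum>e\<in>E. c e * ebin e)" "\<forall>e\<in>E. c e \<in> hpoly 2 W"
      unfolding colon_part_def quartic_part_def by blast
    define c' where "c' = (\<lambda>e. if e = e0 then p else if e \<in> E then - c e else 0)"
    have "(\<Sum>e\<in>E. c' e * ebin e) = (\<Sum>e\<in>E. - (c e * ebin e))"
      using new by (intro sum.cong) (auto simp: c'_def)
    then have "(\<Sum>e\<in>insert e0 E. c' e * ebin e) = 0"
      using fin new c(2) by (simp add: sum_negf) (simp add: c'_def)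
    then have "c' \<in> syz 2 W (insert e0 E)"
      using c mp.subspace_neg[OF hpoly_subspace] by (auto simp: syz_def c'_def)
    moreover have "p = c' e0" by (simp add: c'_def)
    ultimately show "p \<in> (\<lambda>c. c e0) ` syz 2 W (insert e0 E)" by blast
  qed
  then show "mp.has_dim ((\<lambda>c. c e0) ` (syz 2 W (insert e0 E) :: ('v \<times> 'v \<Rightarrow> ('v bvar, 'k) mpoly) set)) n"
    using p by simp
qed (simp_all add: syz_subspace csf_def)

subsection \<open>Independence in degrees zero and one\<close>

lemma bipD:
  assumes "bip E" "(u, w) \<in> E"
  shows "(v, u) \<notin> E" "(w, v) \<notin> E" "u \<noteq> w"
  using assms unfolding bip_def by force+

text \<open>
  If \<open>c\<^sub>e \<noteq> 0\<close> for \<open>e = ab\<close>, then \<open>c\<^sub>e f\<^sub>e\<close> is in the ideal of the other edges. A monomial of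
  degree at most one involves a single vertex \<open>z\<close> besides \<open>a\<close> and \<open>b\<close>, and \<open>z\<close> cannot be adjacent to both as the
  graph has no triangle. So \<open>a\<close> is separated from \<open>b\<close>, and the classes of such monomials are
  singletons.
\<close>

lemma no_linear_syzygies:
  fixes c :: "'v \<times> 'v \<Rightarrow> ('v bvar, 'k::field) mpoly"
  assumes fin: "finite E" and b: "bip E" and d: "d \<le> 1"
    and h: "\<And>e. e \<in> E \<Longrightarrow> poly_homogeneous d (c e)"
    and s: "(\<Sum>e\<in>E. c e * ebin e) = 0" and e: "e \<in> E"
  shows "c e = 0"
proof (rule poly_mapping_eqI, rule ccontr)
  fix m assume "lookup (c e) m \<noteq> lookup 0 m"
  then have nz: "lookup (c e) m \<noteq> 0" by simp
  obtain a b' where e': "e = (a, b')" by (cases e)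
  have ab: "a \<noteq> b'" using bipD(3)[OF b] e e' by blast
  have "c e * ebin e + (\<Sum>e\<in>E - {e}. c e * ebin e) = 0"
    using s fin e by (simp add: sum.remove)
  then have eq: "c e * ebin (a, b') = (\<Sum>e\<in>E - {e}. (- c e) * ebin e)"
    by (simp add: sum_negf eq_neg_iff_add_eq_0 e')
  have md: "mon_degree m = d" using h[OF e] nz phomD by blast
  obtain z where z: "d = 0 \<and> m = 0 \<or> d = 1 \<and> (m = mx z \<or> m = my z)"
  proof (cases "d = 0")
    case True then show ?thesis using md that[of a] by simp
  next
    case False
    then have d1: "d = 1" and "mon_degree m = 1" using d md by simp_all
    then show ?thesis using that d1 by (metis mon_degree_1_cases)
  qed
  define T where "T = {a, b', z}"
  define A where "A = (if (a, z) \<in> E \<and> z \<noteq> b' then {a, z} else {a})"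
  have "closed_in (E - {e}) T A"
    unfolding closed_in_def
  proof (clarsimp)
    fix s t assume st: "(s, t) \<in> E" "(s, t) \<noteq> e" "s \<in> T" "t \<in> T"
    have n: "s \<noteq> b'" "t \<noteq> a" "s \<noteq> t" "s = a \<Longrightarrow> t \<noteq> b'"
      using bipD[OF b] e e' st by blast+
    have n': "(a, z) \<in> E \<Longrightarrow> s \<noteq> z" using bipD[OF b] st(1) by blast
    show "s \<in> A \<longleftrightarrow> t \<in> A" using st n n' e' by (auto simp: T_def A_def)
  qed
  moreover have "b' \<in> T - A" "A \<subseteq> T" "a \<in> A"
    using ab e e' bipD(1,2)[OF b, of a b'] by (auto simp: T_def A_def dest: bipD(2)[OF b])
  moreover have "vdeg m v \<noteq> 0 \<Longrightarrow> v \<in> T" for v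
    using z by (auto simp: T_def vdeg_def mx_def my_def lookup_single when_def split: if_splits)
  ultimately have "csum (\<lambda>n. vdeg n = vdeg m \<and> xcount A n = xcount A m \<and> xcount T n = xcount T m) (c e) = 0"
    by (intro class_sum_zero[OF _ _ _ _ _ _ eq]) (auto simp: T_def)
  moreover have "csum (\<lambda>n. vdeg n = vdeg m \<and> xcount A n = xcount A m \<and> xcount T n = xcount T m) (c e)
     = (\<Sum>n\<in>{m}. lookup (c e) n)"
  proof (rule csum_unique)
    fix n assume Q: "vdeg n = vdeg m \<and> xcount A n = xcount A m \<and> xcount T n = xcount T m"
      and "lookup (c e) n \<noteq> 0"
    then have nd: "mon_degree n = d" using h[OF e] phomD by blast
    show "n \<in> {m}"
    proof (cases "d = 0")
      case True
      then show ?thesis using nd z by simp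
    next
      case False
      then have d1: "mon_degree n = 1" and m: "m = mx z \<or> m = my z" using nd z by auto
      have vz: "vdeg n z = 1" using Q m by auto
      have fT: "finite T" "z \<in> T" by (auto simp: T_def)
      show ?thesis
      proof (rule mon_degree_1_cases[OF d1])
        fix u assume n: "n = mx u"
        then have "u = z" using vz by (simp split: if_splits)
        then show ?thesis using n Q m fT by auto
      next
        fix u assume n: "n = my u"
        then have "u = z" using vz by (simp split: if_splits)
        then show ?thesis using n Q m fT by auto
      qed
    qed
  qed auto
  ultimately show False using nz by simp
qed

section \<open>Adding one edge\<close>

lemma keys_pair:
  assumes "u \<in> T" "v \<in> T"
  shows "keys (mx u + my v) \<subseteq> bvars T" "keys (mx u + mx v) \<subseteq> bvars T" "keys (my u + my v) \<subseteq> bvars T"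
proof -
  have k: "keys (mx w) = {Xvar w}" "keys (my w) = {Yvar w}" for w :: 'a
    by (simp_all add: mx_def my_def)
  show "keys (mx u + my v) \<subseteq> bvars T" "keys (mx u + mx v) \<subseteq> bvars T" "keys (my u + my v) \<subseteq> bvars T"
    using assms by - (rule order_trans[OF keys_add], simp add: k bvars_def)+
qed

lemma mon_degree_pair:
  "mon_degree (mx u + my v) = 2" "mon_degree (mx u + mx v) = 2" "mon_degree (my u + my v) = 2"
  by (simp_all add: mon_degree_add mx_def my_def)

lemma mon_hpoly:
  assumes "u \<in> T" "v \<in> T"
  shows "single (mx u + my v) 1 \<in> hpoly 2 (bvars T)"
    "single (mx u + mx v) 1 \<in> hpoly 2 (bvars T)"
    "single (my u + my v) 1 \<in> hpoly 2 (bvars T)"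
  using assms unfolding hpoly_def
  by (simp_all add: pr_single phom_single keys_pair mon_degree_pair)

lemma ebin_hpoly:
  assumes "a \<in> T" "b \<in> T"
  shows "ebin (a, b) \<in> hpoly 2 (bvars T)"
  unfolding ebin_single using assms
  by (intro mp.subspace_diff[OF hpoly_subspace] mon_hpoly)

lemma lookup_ebin:
  "lookup (ebin (u, w)) (mx c + my d) = (if u = c \<and> w = d then 1 else 0) - (if u = d \<and> w = c then 1 else 0)"
  "lookup (ebin (u, w)) (mx c + mx d) = 0"
  "lookup (ebin (u, w)) (my c + my d) = 0"
  by (auto simp: ebin_single lookup_minus lookup_single when_def)

lemma mvar_mult_single:
  "single (mx u + my v) 1 = mvar (Xvar u) * mvar (Yvar v)"
  "single (mx u + mx v) 1 = mvar (Xvar u) * mvar (Xvar v)"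
  "single (my u + my v) 1 = mvar (Yvar u) * mvar (Yvar v)"
  by (simp_all add: mvar_def mult_single mx_def my_def)

text \<open>
  An injection into the natural numbers selects one order of each pair of vertices.
\<close>

lemma card_ordered_pairs:
  fixes \<rho> :: "'v \<Rightarrow> nat"
  assumes fin: "finite N" and inj: "inj_on \<rho> N"
  shows "card {(c, d). c \<in> N \<and> d \<in> N \<and> \<rho> c < \<rho> d} = card N choose 2"
proof -
  let ?P = "{(c, d). c \<in> N \<and> d \<in> N \<and> \<rho> c < \<rho> d}"
  have "bij_betw (\<lambda>(c, d). {c, d}) ?P {A. A \<subseteq> N \<and> card A = 2}"
  proof (rule bij_betwI')
    fix x y assume "x \<in> ?P" "y \<in> ?P"
    then show "((\<lambda>(c, d). {c, d}) x = (\<lambda>(c, d). {c, d}) y) = (x = y)"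
      by (cases x; cases y) (auto simp: doubleton_eq_iff)
  next
    fix x assume "x \<in> ?P"
    then show "(\<lambda>(c, d). {c, d}) x \<in> {A. A \<subseteq> N \<and> card A = 2}"
      by (cases x) (auto simp: card_2_iff)
  next
    fix A assume "A \<in> {A. A \<subseteq> N \<and> card A = 2}"
    then obtain c d where A: "A = {c, d}" "c \<noteq> d" "c \<in> N" "d \<in> N" by (auto simp: card_2_iff)
    then have "\<rho> c \<noteq> \<rho> d" using inj by (auto dest: inj_onD)
    then have "(c, d) \<in> ?P \<or> (d, c) \<in> ?P" using A by auto
    then show "\<exists>x\<in>?P. A = (\<lambda>(c, d). {c, d}) x" using A(1) by (auto simp: insert_commute)
  qed
  then show ?thesis using n_subsets[OF fin, of 2] bij_betw_same_card by fastforce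
qed

text \<open>
  The map \<open>\<rho>\<close> serves to select one of the generators \<open>ebin (c, d)\<close> and \<open>ebin (d, c)\<close> for a pair
  of vertices on the same side.
\<close>

locale new_edge =
  fixes E :: "('v \<times> 'v) set" and a b :: 'v and T :: "'v set" and \<rho> :: "'v \<Rightarrow> nat"
  assumes finT: "finite T" and ET: "insert (a, b) E \<subseteq> T \<times> T"
    and bip: "bip (insert (a, b) E)" and new: "(a, b) \<notin> E" and rho: "inj_on \<rho> T"
begin

definition "Na = {d. (a, d) \<in> E}"
definition "Nb = {c. (c, b) \<in> E}"
definition "Paths = {(c, d) \<in> E. (a, d) \<in> E \<and> (c, b) \<in> E}"

text \<open>
  Indices for a basis of the degree two part of the colon ideal. Tag \<open>0\<close> stands for the old
  edges, tags \<open>1\<close> and \<open>2\<close> for the pairs of neighbours of \<open>a\<close> and of \<open>b\<close>, and the tags \<open>3\<close> to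
  \<open>5\<close> for the monomials from a path \<open>a - w - u - b\<close>. Every index has a monomial \<open>lead_mon\<close>,
  whose coefficient is the dual functional. For this duality the element for an old edge
  \<open>(u, w)\<close> on such a path is the monomial \<open>x\<^sub>u y\<^sub>w\<close> instead of the binomial: otherwise
  the binomial would contain the monomial with tag \<open>5\<close>.
\<close>

definition index_set :: "(nat \<times> 'v \<times> 'v) set" where
  "index_set = {0} \<times> E \<union> {1} \<times> {(c, d). c \<in> Na \<and> d \<in> Na \<and> \<rho> c < \<rho> d}
     \<union> {2} \<times> {(c, d). c \<in> Nb \<and> d \<in> Nb \<and> \<rho> c < \<rho> d} \<union> {3, 4, 5} \<times> Paths"

fun lead_mon :: "nat \<times> 'v \<times> 'v \<Rightarrow> 'v bvar \<Rightarrow>\<^sub>0 nat" where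
  "lead_mon (t, u, w) = (if t = 3 then mx u + mx w else if t = 4 then my u + my w
      else if t = 5 then mx w + my u else mx u + my w)"

fun colon_gen :: "nat \<times> 'v \<times> 'v \<Rightarrow> ('v bvar, 'k::field) mpoly" where
  "colon_gen (t, u, w) = (if t \<ge> 3 \<or> t = 0 \<and> (u, w) \<in> Paths then single (lead_mon (t, u, w)) 1 else ebin (u, w))"

lemma lead_mon_simps:
  "lead_mon (0, u, w) = mx u + my w" "lead_mon (1, u, w) = mx u + my w" "lead_mon (2, u, w) = mx u + my w"
  "lead_mon (3, u, w) = mx u + mx w" "lead_mon (4, u, w) = my u + my w" "lead_mon (5, u, w) = mx w + my u"
  by simp_all

declare lead_mon.simps [simp del] colon_gen.simps [simp del]

lemma finE: "finite E"
  using ET finT by (meson finite_SigmaI finite_subset subset_insertI subset_trans)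

lemma sides:
  "(u, w) \<in> E \<Longrightarrow> (w, v) \<notin> E" "(u, w) \<in> E \<Longrightarrow> (v, u) \<notin> E" "(u, a) \<notin> E" "(b, u) \<notin> E" "a \<noteq> b"
  "(u, w) \<in> E \<Longrightarrow> u \<noteq> w" "(u, w) \<in> E \<Longrightarrow> w \<noteq> a"  "(u, w) \<in> E \<Longrightarrow> u \<noteq> b"
  using bip unfolding bip_def by force+

lemma Na_sub: "Na \<subseteq> T" "Nb \<subseteq> T" "finite Na" "finite Nb" "a \<in> T" "b \<in> T"
  using ET finT by (auto simp: Na_def Nb_def dest: subsetD intro: finite_subset[of _ T])

lemma Paths_sub: "Paths \<subseteq> E" "finite Paths"
  using finE by (auto simp: Paths_def intro: finite_subset[of _ E])

lemma card_index_set: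
  "card index_set = card E + (card Na choose 2) + (card Nb choose 2) + 3 * card Paths"
proof -
  let ?A = "{(c, d). c \<in> Na \<and> d \<in> Na \<and> \<rho> c < \<rho> d}" and ?B = "{(c, d). c \<in> Nb \<and> d \<in> Nb \<and> \<rho> c < \<rho> d}"
  have fA: "finite ?A" by (rule finite_subset[of _ "Na \<times> Na"]) (use Na_sub in auto)
  have fB: "finite ?B" by (rule finite_subset[of _ "Nb \<times> Nb"]) (use Na_sub in auto)
  have "card index_set = card ({0::nat} \<times> E) + card ({1::nat} \<times> ?A) + card ({2::nat} \<times> ?B) + card ({3::nat, 4, 5} \<times> Paths)"
    unfolding index_set_def using finE fA fB Paths_sub(2)
    by (subst card_Un_disjoint | (auto; fail))+
  moreover have "card ?A = card Na choose 2"
    using Na_sub rho by (intro card_ordered_pairs) (auto intro: inj_on_subset)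
  moreover have "card ?B = card Nb choose 2"
    using Na_sub rho by (intro card_ordered_pairs) (auto intro: inj_on_subset)
  ultimately show ?thesis by (simp add: card_cartesian_product)
qed

lemma finite_index_set: "finite index_set"
proof -
  have "index_set \<subseteq> {0, 1, 2, 3, 4, 5} \<times> T \<times> T"
    using ET Na_sub Paths_sub(1) by (auto simp: index_set_def)
  then show ?thesis using finT by (meson finite.emptyI finite.insertI finite_SigmaI finite_subset)
qed

text \<open>
  The mixed monomials are told apart by their ordered pairs \<open>pr\<close> of vertices. The second
  monomial of a binomial is not a leading monomial (\<open>swap\<close>): its two vertices would be on the
  wrong sides, or in the wrong order with respect to \<open>\<rho>\<close>, or it would have tag \<open>5\<close>, and then
  the binomial has been replaced by a monomial.
\<close>

lemma colon_gen_dual: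
  assumes "i \<in> index_set" "j \<in> index_set"
  shows "lookup (colon_gen i :: ('v bvar, 'k::field) mpoly) (lead_mon j) = (if i = j then 1 else 0)"
proof -
  obtain t u w t' u' w' where ij: "i = (t, u, w)" "j = (t', u', w')" by (metis prod_cases3)
  define sx where "sx v \<longleftrightarrow> v \<in> fst ` insert (a, b) E" for v
  have s1: "(c, d) \<in> E \<Longrightarrow> sx c" "(c, d) \<in> E \<Longrightarrow> \<not> sx d" for c d
  proof -
    assume "(c, d) \<in> E"
    then have m: "c \<in> fst ` insert (a, b) E" "d \<in> snd ` insert (a, b) E" by force+
    show "sx c" using m by (simp add: sx_def)
    show "\<not> sx d" using m(2) bip unfolding bip_def sx_def by blast
  qed
  have r: "t = 0 \<and> sx u \<and> \<not> sx w \<or> t = 1 \<and> \<not> sx u \<and> \<not> sx w \<and> \<rho> u < \<rho> w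
      \<or> t = 2 \<and> sx u \<and> sx w \<and> \<rho> u < \<rho> w \<or> (t = 3 \<or> t = 4 \<or> t = 5) \<and> sx u \<and> \<not> sx w \<and> (u, w) \<in> Paths"
    if "(t, u, w) \<in> index_set" for t :: nat and u w
  proof -
    have "t = 0 \<and> (u, w) \<in> E \<or> t = 1 \<and> (a, u) \<in> E \<and> (a, w) \<in> E \<and> \<rho> u < \<rho> w
      \<or> t = 2 \<and> (u, b) \<in> E \<and> (w, b) \<in> E \<and> \<rho> u < \<rho> w
      \<or> (t = 3 \<or> t = 4 \<or> t = 5) \<and> (u, w) \<in> E \<and> (u, w) \<in> Paths"
      using that Paths_sub(1) unfolding index_set_def Na_def Nb_def by auto
    then show ?thesis using s1 by blast
  qed
  note i = r[OF assms(1)[unfolded ij]] and j = r[OF assms(2)[unfolded ij]]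
  define pr where "pr = (\<lambda>(t :: nat, u :: 'v, w :: 'v). if t = 5 then (w, u) else (u, w))"
  have xx: "(u = u' \<and> w = w' \<or> u = w' \<and> w = u') \<longleftrightarrow> u = u' \<and> w = w'"
    if "t = 3 \<and> t' = 3 \<or> t = 4 \<and> t' = 4"
    using that i j by auto
  have inj: "pr i = pr j \<longleftrightarrow> i = j" if "t \<noteq> 3" "t \<noteq> 4" "t' \<noteq> 3" "t' \<noteq> 4"
  proof
    assume "pr i = pr j"
    then consider "t = 5" "t' = 5" "w = w'" "u = u'" | "t = 5" "t' \<noteq> 5" "w = u'" "u = w'"
      | "t \<noteq> 5" "t' = 5" "w = u'" "u = w'" | "t \<noteq> 5" "t' \<noteq> 5" "u = u'" "w = w'"
      by (auto simp: pr_def ij split: if_splits)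
    then show "i = j" by cases (use i j that in \<open>auto simp: ij\<close>)
  qed simp
  have swap: "pr j \<noteq> (w, u)" if "t \<noteq> 3" "t \<noteq> 4" "t \<noteq> 5" "t' \<noteq> 3" "t' \<noteq> 4" "\<not> (t = 0 \<and> (u, w) \<in> Paths)"
  proof
    assume "pr j = (w, u)"
    then consider "t' = 5" "w = w'" "u = u'" | "t' \<noteq> 5" "w = u'" "u = w'"
      by (auto simp: pr_def ij split: if_splits)
    then show False by cases (use i j that in auto)
  qed
  have lead_mon_pr: "lead_mon k = mx (fst (pr k)) + my (snd (pr k))" if "fst k \<noteq> 3" "fst k \<noteq> 4" for k
    using that by (cases k) (auto simp: pr_def lead_mon.simps)
  show ?thesis
  proof (cases "t' = 3 \<or> t' = 4")
    case t': True
    show ?thesis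
    proof (cases "t \<ge> 3 \<or> t = 0 \<and> (u, w) \<in> Paths")
      case True
      then have g: "lookup (colon_gen i :: ('v bvar, 'k) mpoly) (lead_mon j) = (if lead_mon i = lead_mon j then 1 else 0)"
        by (simp add: ij colon_gen.simps lookup_single when_def)
      have "lead_mon i = lead_mon j \<longleftrightarrow> i = j"
        using t' xx True unfolding ij by (auto simp: lead_mon.simps)
      then show ?thesis unfolding g by simp
    next
      case False
      then have "t \<noteq> t'" using t' by auto
      then have "i \<noteq> j" by (simp add: ij)
      have "lead_mon j = mx u' + mx w' \<or> lead_mon j = my u' + my w'" using t' by (auto simp: ij lead_mon.simps)
      then have "lookup (ebin (u, w) :: ('v bvar, 'k) mpoly) (lead_mon j) = 0" by (metis lookup_ebin(2,3))
      then show ?thesis using False \<open>i \<noteq> j\<close> by (simp only: ij colon_gen.simps if_False)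
    qed
  next
    case t': False
    then have lj: "lead_mon j = mx (fst (pr j)) + my (snd (pr j))" using lead_mon_pr[of j] ij by simp
    show ?thesis
    proof (cases "t \<ge> 3 \<or> t = 0 \<and> (u, w) \<in> Paths")
      case True
      then have g: "lookup (colon_gen i :: ('v bvar, 'k) mpoly) (lead_mon j) = (if lead_mon i = lead_mon j then 1 else 0)"
        by (simp add: ij colon_gen.simps lookup_single when_def)
      have "lead_mon i = lead_mon j \<longleftrightarrow> i = j"
      proof (cases "t = 3 \<or> t = 4")
        case True
        then have "lead_mon i \<noteq> lead_mon j" "i \<noteq> j" unfolding lj using t' by (auto simp: ij lead_mon.simps)
        then show ?thesis by simp
      next
        case False
        then have "lead_mon i = mx (fst (pr i)) + my (snd (pr i))" using lead_mon_pr[of i] ij by simp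
        then have "lead_mon i = lead_mon j \<longleftrightarrow> pr i = pr j" unfolding lj by (simp add: prod_eq_iff)
        then show ?thesis using inj False t' by simp
      qed
      then show ?thesis unfolding g by simp
    next
      case False
      then have t: "t \<noteq> 3" "t \<noteq> 4" "t \<noteq> 5" "\<not> (t = 0 \<and> (u, w) \<in> Paths)" by auto
      have sw: "\<not> (u = snd (pr j) \<and> w = fst (pr j))" using swap t t' by (metis prod.collapse)
      have "lookup (colon_gen i :: ('v bvar, 'k) mpoly) (lead_mon j) = (if u = fst (pr j) \<and> w = snd (pr j) then 1 else 0)"
        using False unfolding ij(1) lj colon_gen.simps by (simp only: if_False lookup_ebin sw diff_zero)
      also have "(u = fst (pr j) \<and> w = snd (pr j)) \<longleftrightarrow> pr i = pr j"
        using t by (cases "pr j") (simp add: ij(1) pr_def)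
      finally show ?thesis using inj t t' by simp
    qed
  qed
qed

text \<open>
  Explicit quadratic coefficients, from the Koszul, Pluecker and three-term relations.
\<close>

lemma colon_gen_in_colon:
  assumes "i \<in> index_set"
  shows "(colon_gen i :: ('v bvar, 'k::field) mpoly) \<in> colon_part (bvars T) E (a, b)"
proof -
  obtain t u w where i: "i = (t, u, w)" by (metis prod_cases3)
  let ?J = "quartic_part (bvars T) E :: ('v bvar, 'k) mpoly set"
  have J: "q * ebin e \<in> ?J" if "e \<in> E" "q \<in> hpoly 2 (bvars T)" for e q
    using quartic_part_mult[OF finE that] .
  note add = mp.subspace_add[OF quartic_part_subspace] and diff = mp.subspace_diff[OF quartic_part_subspace]
  have ETD: "(c, d) \<in> E \<Longrightarrow> c \<in> T \<and> d \<in> T" for c d using ET by auto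
  note defs = ebin_def mvar_mult_single fst_conv snd_conv algebra_simps
  have edge: "ebin (u, w) * ebin (a, b) \<in> ?J" if "(u, w) \<in> E"
    using J[OF that ebin_hpoly[of a T b]] Na_sub by (simp add: mult.commute)
  have inT: "u \<in> T" "w \<in> T"
    using assms Na_sub ETD Paths_sub(1) unfolding i index_set_def by auto
  have path: "single (lead_mon (t, u, w)) 1 * ebin (a, b) \<in> ?J" if p: "(u, w) \<in> Paths" and t: "t = 0 \<or> t \<ge> 3" for t
  proof -
    have e: "(u, w) \<in> E" "(a, w) \<in> E" "(u, b) \<in> E" using p by (auto simp: Paths_def)
    note m = mon_hpoly
    \<comment> \<open>Each of these applies the three-term relation twice, along the path.\<close>
    have 3: "single (mx u + mx w) 1 * ebin (a, b) =
      single (mx a + mx w) 1 * ebin (u, b) - single (mx a + mx b) 1 * ebin (u, w)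
      + single (mx b + mx u) (1::'k) * ebin (a, w)"
      by (simp add: defs)
    have 4: "single (my u + my w) 1 * ebin (a, b) =
      single (my a + my w) 1 * ebin (u, b) - single (my a + my b) 1 * ebin (u, w)
      + single (my b + my u) (1::'k) * ebin (a, w)"
      by (simp add: defs)
    have 0: "single (mx u + my w) 1 * ebin (a, b) =
      single (mx a + my w) 1 * ebin (u, b) - single (mx b + my a) 1 * ebin (u, w)
      + single (mx b + my u) (1::'k) * ebin (a, w)"
      by (simp add: defs)
    have 5: "single (mx w + my u) 1 * ebin (a, b) =
      single (mx w + my a) 1 * ebin (u, b) - single (mx a + my b) 1 * ebin (u, w)
      + single (mx u + my b) (1::'k) * ebin (a, w)"
      by (simp add: defs)
    have "single (mx u + mx w) 1 * ebin (a, b) \<in> ?J"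
      "single (my u + my w) 1 * ebin (a, b) \<in> ?J"
      "single (mx u + my w) 1 * ebin (a, b) \<in> ?J"
      "single (mx w + my u) 1 * ebin (a, b) \<in> ?J"
      unfolding 0 3 4 5 using Na_sub inT e by (intro add diff J m; simp)+
    then show ?thesis using t by (auto simp: lead_mon.simps)
  qed
  \<comment> \<open>Pluecker relations; \<open>ebin (b, w)\<close> and the like are coefficients, not generators.\<close>
  have Pl: "ebin (u, w) * ebin (a, b) = ebin (b, w) * ebin (a, u) - ebin (b, u) * (ebin (a, w) :: ('v bvar, 'k) mpoly)"
    by (simp add: defs)
  have Na2: "ebin (u, w) * ebin (a, b) \<in> ?J" if "(a, u) \<in> E" "(a, w) \<in> E"
    unfolding Pl using that inT Na_sub by (intro diff J ebin_hpoly)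
  have Pl': "ebin (u, w) * ebin (a, b) = ebin (a, w) * ebin (u, b) - ebin (a, u) * (ebin (w, b) :: ('v bvar, 'k) mpoly)"
    by (simp add: defs)
  have Nb2: "ebin (u, w) * ebin (a, b) \<in> ?J" if "(u, b) \<in> E" "(w, b) \<in> E"
    unfolding Pl' using that inT Na_sub by (intro diff J ebin_hpoly)
  have "colon_gen i * ebin (a, b) \<in> ?J"
    using assms path[of t] edge Na2 Nb2 unfolding i index_set_def Na_def Nb_def
    by (auto simp: colon_gen.simps)
  moreover have "(colon_gen i :: ('v bvar, 'k) mpoly) \<in> hpoly 2 (bvars T)"
    unfolding i using inT by (auto simp: colon_gen.simps lead_mon.simps intro!: mon_hpoly ebin_hpoly)
  ultimately show ?thesis by (simp add: colon_part_def)
qed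

text \<open>
  On the vertices \<open>a, b, c, d\<close> a path from \<open>a\<close> to \<open>b\<close> without the edge \<open>ab\<close> has odd length, hence
  length three, and runs through both \<open>c\<close> and \<open>d\<close>. Otherwise the component of \<open>a\<close>, its vertices
  of distance at most two, does not contain \<open>b\<close>.
\<close>

lemma separating_set:
  assumes np: "(c, d) \<notin> Paths" "(d, c) \<notin> Paths"
  shows "\<exists>A\<subseteq>{a, b, c, d}. a \<in> A \<and> b \<notin> A \<and> closed_in E {a, b, c, d} A"
proof -
  define A where "A = {a} \<union> {t \<in> {c, d}. (a, t) \<in> E} \<union> {t \<in> {c, d}. \<exists>s\<in>{c, d}. (a, s) \<in> E \<and> (t, s) \<in> E}"
  have "b \<notin> A" using new sides(4,5) by (auto simp: A_def)
  moreover have "closed_in E {a, b, c, d} A"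
    unfolding closed_in_def
  proof (clarify, rule iffI)
    fix s t assume st: "(s, t) \<in> E" "s \<in> {a, b, c, d}" "t \<in> {a, b, c, d}"
    have ne: "s \<noteq> b" "t \<noteq> a" "s \<noteq> t" using sides st(1) by blast+
    {
      assume "s \<in> A"
      then consider "s = a" | "(a, s) \<in> E" | s' where "s \<in> {c, d}" "s' \<in> {c, d}" "(a, s') \<in> E" "(s, s') \<in> E"
        unfolding A_def by blast
      then show "t \<in> A"
      proof cases
        case 1
        then show ?thesis using st ne new by (auto simp: A_def)
      next
        case 2
        then show ?thesis using st(1) sides(1) by blast
      next
        case 3
        have "s \<noteq> s'" using sides(6) 3(4) by blast
        then have "(s, s') \<notin> Paths" using np 3(1,2) by blast
        then have "t \<noteq> b" using 3 st(1) by (auto simp: Paths_def)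
        then have "t = s'" using st(3) ne 3(1,2) \<open>s \<noteq> s'\<close> by auto
        then show ?thesis using 3 by (auto simp: A_def)
      qed
    next
      assume "t \<in> A"
      then have "t \<in> {c, d}" "(a, t) \<in> E" using ne st(1) sides(1) by (auto simp: A_def)
      then show "s \<in> A" using st(1,2) ne by (auto simp: A_def)
    }
  qed
  ultimately show ?thesis by (intro exI[of _ A]) (auto simp: A_def)
qed

text \<open>
  If \<open>c\<close> and \<open>d\<close> are neither adjacent nor both neighbours of the same end of the new edge, they
  are in different components. One of them is then in the component of \<open>a\<close>, or one that
  is not connected with \<open>b\<close> can be added to this component.
\<close>

lemma separating_set_pair:
  assumes ne: "c \<noteq> d" and cd: "(c, d) \<notin> E" "(d, c) \<notin> E"
    and N: "\<not> (c \<in> Na \<and> d \<in> Na)" "\<not> (c \<in> Nb \<and> d \<in> Nb)"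
  shows "\<exists>A\<subseteq>{a, b, c, d}. a \<in> A \<and> b \<notin> A \<and> closed_in E {a, b, c, d} A \<and> (c \<in> A) \<noteq> (d \<in> A)"
proof -
  have loop: "(v, v) \<notin> E" for v using sides(6) by blast
  note no = new sides(3) sides(4) cd loop
  define A where "A = {a} \<union> {t \<in> {c, d}. (a, t) \<in> E}"
  have A: "b \<notin> A" "A \<subseteq> {a, b, c, d}" using new sides(5) by (auto simp: A_def)
  have src: "(a, s) \<in> E \<Longrightarrow> (s, t) \<notin> E" for s t using sides(1) by blast
  have clA: "closed_in E {a, b, c, d} A" unfolding closed_in_def A_def using no src by auto
  show ?thesis
  proof (cases "(c \<in> A) = (d \<in> A)")
    case False
    then show ?thesis using A clA by (intro exI[of _ A]) (auto simp: A_def)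
  next
    case True
    have nA: "c \<notin> A" "d \<notin> A"
      using True ne cd N(1) by (auto simp: A_def Na_def)
    then have n: "c \<noteq> a" "d \<noteq> a" "(a, c) \<notin> E" "(a, d) \<notin> E" by (auto simp: A_def)
    show ?thesis
    proof (cases "c \<noteq> b \<and> (c, b) \<notin> E")
      case True
      have "closed_in E {a, b, c, d} {a, c}" unfolding closed_in_def using no n True by auto
      then show ?thesis using True n ne sides(5) by (intro exI[of _ "{a, c}"]) auto
    next
      case False
      then have d: "d \<noteq> b" "(d, b) \<notin> E" using ne cd N(2) by (auto simp: Nb_def)
      have "closed_in E {a, b, c, d} {a, d}" unfolding closed_in_def using no n d by auto
      then show ?thesis using d n ne sides(5) by (intro exI[of _ "{a, d}"]) auto
    qed
  qed
qed

text \<open>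
  The upper bound: an element of the colon ideal without leading monomials is zero. If the
  vertices \<open>c, d\<close> of a monomial lie on a path from \<open>a\<close> to \<open>b\<close>, all monomials in \<open>c, d\<close> are
  leading. Otherwise the functionals apply, and a class with two monomials contains a leading
  one unless \<open>A\<close> can be chosen to separate \<open>c\<close> from \<open>d\<close>.
\<close>

lemma colon_zero:
  fixes p :: "('v bvar, 'k::field) mpoly"
  assumes p: "p \<in> colon_part W E (a, b)" and z: "\<And>i. i \<in> index_set \<Longrightarrow> lookup p (lead_mon i) = 0"
  shows "p = 0"
proof (rule poly_mapping_eqI)
  fix \<mu>
  have hp: "poly_homogeneous 2 p" using p by (simp add: colon_part_def hpoly_def)
  obtain q where q: "p * ebin (a, b) = (\<Sum>e\<in>E. q e * ebin e)"
    using p unfolding colon_part_def quartic_part_def by blast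
  have sep: "csum (\<lambda>m. vdeg m = vdeg \<mu> \<and> xcount A m = k \<and> xcount {a, b, c, d} m = l) p = 0"
    if "A \<subseteq> {a, b, c, d}" "a \<in> A" "b \<notin> A" "closed_in E {a, b, c, d} A" "\<And>v. vdeg \<mu> v \<noteq> 0 \<Longrightarrow> v \<in> {c, d}"
    for A c d k l \<mu>
    using that by (intro class_sum_zero[OF _ _ _ _ _ _ q]) auto
  have vd: "vdeg (mx c + mx d) v \<noteq> 0 \<Longrightarrow> v \<in> {c, d}" "vdeg (my c + my d) v \<noteq> 0 \<Longrightarrow> v \<in> {c, d}"
    "vdeg (mx c + my d) v \<noteq> 0 \<Longrightarrow> v \<in> {c, d}" for c d v :: 'v
    by (auto simp: vdeg_add split: if_splits)
  have path0: "lookup p (mx c + mx d) = 0" "lookup p (my c + my d) = 0" "lookup p (mx c + my d) = 0"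
    if "(c, d) \<in> Paths \<or> (d, c) \<in> Paths" for c d
    using z[of "(3, c, d)"] z[of "(4, c, d)"] z[of "(0, c, d)"] z[of "(3, d, c)"] z[of "(4, d, c)"] z[of "(5, d, c)"]
      that Paths_sub(1)
    by (auto simp: index_set_def lead_mon_simps add.commute)
  have xx: "lookup p (mx c + mx d) = 0" for c d
  proof (cases "(c, d) \<in> Paths \<or> (d, c) \<in> Paths")
    case False
    then obtain A where A: "A \<subseteq> {a, b, c, d}" "a \<in> A" "b \<notin> A" "closed_in E {a, b, c, d} A"
      using separating_set by blast
    have "lookup p (mx c + mx d) = csum (\<lambda>m. vdeg m = vdeg (mx c + mx d) \<and> xcount A m = xcount A (mx c + mx d)
        \<and> xcount {a, b, c, d} m = 2) p"
      using A(1) hp by (intro csum_class_xx[symmetric]) auto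
    also have "\<dots> = 0" by (rule sep[OF A vd(1)])
    finally show ?thesis .
  qed (use path0 in blast)
  have yy: "lookup p (my c + my d) = 0" for c d
  proof (cases "(c, d) \<in> Paths \<or> (d, c) \<in> Paths")
    case False
    then obtain A where A: "A \<subseteq> {a, b, c, d}" "a \<in> A" "b \<notin> A" "closed_in E {a, b, c, d} A"
      using separating_set by blast
    have "lookup p (my c + my d) = csum (\<lambda>m. vdeg m = vdeg (my c + my d) \<and> xcount A m = 0
        \<and> xcount {a, b, c, d} m = 0) p"
      using A(1) hp by (intro csum_class_yy[symmetric]) auto
    also have "\<dots> = 0" by (rule sep[OF A vd(2)])
    finally show ?thesis .
  qed (use path0 in blast)
  have xy: "lookup p (mx c + my d) = 0" for c d
  proof (cases "(c, d) \<in> Paths \<or> (d, c) \<in> Paths")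
    case False
    have cls: "lookup p (mx c + my d) + (if c \<noteq> d \<and> (c \<in> A \<longleftrightarrow> d \<in> A) then lookup p (mx d + my c) else 0) = 0"
      if A: "A \<subseteq> {a, b, c, d}" "a \<in> A" "b \<notin> A" "closed_in E {a, b, c, d} A" for A
    proof -
      have "csum (\<lambda>m. vdeg m = vdeg (mx c + my d) \<and> xcount A m = xcount A (mx c + my d)
          \<and> xcount {a, b, c, d} m = 1) p = 0" by (rule sep[OF A vd(3)])
      then show ?thesis using csum_class_xy[of "{a, b, c, d}" A c d p] A(1) hp by simp
    qed
    obtain A where A: "A \<subseteq> {a, b, c, d}" "a \<in> A" "b \<notin> A" "closed_in E {a, b, c, d} A"
      using separating_set False by blast
    show ?thesis
    proof (cases "c = d")
      case True
      then show ?thesis using cls[OF A] by simp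
    next
      case ne: False
      show ?thesis
      proof (cases "(c, d) \<in> E \<or> (d, c) \<in> E \<or> c \<in> Na \<and> d \<in> Na \<or> c \<in> Nb \<and> d \<in> Nb")
        case True
        have r: "\<rho> c < \<rho> d \<or> \<rho> d < \<rho> c" if "c \<in> T" "d \<in> T"
          using that ne rho by (metis inj_onD nat_neq_iff)
        have "lookup p (mx c + my d) = 0 \<or> lookup p (mx d + my c) = 0"
          using True r Na_sub
            z[of "(0, c, d)"] z[of "(0, d, c)"] z[of "(1, c, d)"] z[of "(1, d, c)"] z[of "(2, c, d)"] z[of "(2, d, c)"]
          by (auto simp: index_set_def lead_mon.simps)
        then show ?thesis using cls[OF A] by (auto split: if_splits)
      next
        case False
        then obtain A where A: "A \<subseteq> {a, b, c, d}" "a \<in> A" "b \<notin> A" "closed_in E {a, b, c, d} A"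
            and cd: "(c \<in> A) \<noteq> (d \<in> A)"
          using separating_set_pair[OF ne] by blast
        then show ?thesis using cls[OF A] by (auto split: if_splits)
      qed
    qed
  qed (use path0 in blast)
  show "lookup p \<mu> = lookup 0 \<mu>"
  proof (rule ccontr)
    assume "lookup p \<mu> \<noteq> lookup 0 \<mu>"
    then have nz: "lookup p \<mu> \<noteq> 0" by simp
    then have "mon_degree \<mu> = 2" using hp phomD by blast
    then show False by (cases rule: mon_degree_2_cases) (use nz xx yy xy in auto)
  qed
qed

lemma colon_has_dim:
  "mp.has_dim (colon_part (bvars T) E (a, b) :: ('v bvar, 'k::field) mpoly set)
     (card E + (card Na choose 2) + (card Nb choose 2) + 3 * card Paths)"
  unfolding card_index_set[symmetric]
  by (rule mp.has_dim_dual_family[where g = colon_gen and \<phi> = "\<lambda>i p. lookup p (lead_mon i)"])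
    (auto simp: colon_part_subspace finite_index_set colon_gen_in_colon lookup_add colon_gen_dual
      intro: colon_zero)

end

section \<open>The number of quadratic syzygies\<close>

text \<open>
  The complete bipartite subgraphs with two vertices on each side, which are the four-cycles
  of a bipartite graph.
\<close>

definition quads :: "('v \<times> 'v) set \<Rightarrow> ('v set \<times> 'v set) set" where
  "quads E = {(A, B). card A = 2 \<and> card B = 2 \<and> A \<times> B \<subseteq> E}"

definition syz_count :: "'v set \<Rightarrow> ('v \<times> 'v) set \<Rightarrow> nat" where
  "syz_count T E = (card E choose 2) +
     (\<Sum>v\<in>T. (card {d. (v, d) \<in> E} choose 3) + (card {c. (c, v) \<in> E} choose 3)) + 3 * card (quads E)"

lemma finite_quads:
  assumes "finite T" "E \<subseteq> T \<times> T"
  shows "finite (quads E)"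
proof (rule finite_subset)
  show "quads E \<subseteq> Pow T \<times> Pow T"
  proof
    fix q assume "q \<in> quads E"
    then obtain A B where q: "q = (A, B)" "card A = 2" "card B = 2" "A \<times> B \<subseteq> T \<times> T"
      using assms(2) by (auto simp: quads_def)
    then have "A \<noteq> {}" "B \<noteq> {}" by auto
    then show "q \<in> Pow T \<times> Pow T" using q(1,4) by (auto simp: times_subset_iff)
  qed
qed (use assms(1) in auto)

lemma choose_Suc_3: "Suc n choose 3 = (n choose 3) + (n choose 2)"
  by (simp add: numeral_3_eq_3 numeral_2_eq_2)

lemma choose_Suc_2: "Suc n choose 2 = (n choose 2) + n"
  by (simp add: numeral_2_eq_2)

context new_edge
begin

text \<open>
  The new four-cycles are closed by the edge \<open>ab\<close> from a path \<open>a - d - c - b\<close>.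
\<close>

lemma card_quads_insert: "card (quads (insert (a, b) E)) = card (quads E) + card Paths"
proof -
  let ?N = "(\<lambda>(c, d). ({a, c}, {b, d})) ` Paths"
  have P: "c \<noteq> a" "d \<noteq> b" if "(c, d) \<in> Paths" for c d
    using that new by (auto simp: Paths_def)
  have eq: "quads (insert (a, b) E) = quads E \<union> ?N"
  proof (intro equalityI subsetI)
    fix q assume "q \<in> quads (insert (a, b) E)"
    then obtain A B where q: "q = (A, B)" "card A = 2" "card B = 2" "A \<times> B \<subseteq> insert (a, b) E"
      by (auto simp: quads_def)
    show "q \<in> quads E \<union> ?N"
    proof (cases "a \<in> A \<and> b \<in> B")
      case False
      then show ?thesis using q by (auto simp: quads_def)
    next
      case True
      obtain c where c: "A = {a, c}" "c \<noteq> a" using q(2) True by (auto simp: card_2_iff)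
      obtain d where d: "B = {b, d}" "d \<noteq> b" using q(3) True by (auto simp: card_2_iff)
      have "(c, d) \<in> Paths" using q(4) c d by (auto simp: Paths_def)
      then show ?thesis using q(1) c d by force
    qed
  next
    fix q assume "q \<in> quads E \<union> ?N"
    then show "q \<in> quads (insert (a, b) E)"
    proof
      assume "q \<in> ?N"
      then obtain c d where cd: "q = ({a, c}, {b, d})" "(c, d) \<in> Paths" by auto
      then show ?thesis using P[OF cd(2)] by (auto simp: quads_def Paths_def)
    qed (auto simp: quads_def)
  qed
  have "quads E \<inter> ?N = {}" using new by (auto simp: quads_def)
  moreover have "inj_on (\<lambda>(c, d). ({a, c}, {b, d})) Paths"
    using P by (auto simp: inj_on_def doubleton_eq_iff)
  moreover have "finite (quads E)" using finite_quads[OF finT] ET by blast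
  ultimately show ?thesis unfolding eq
    by (simp add: card_Un_disjoint Paths_sub(2) card_image)
qed

lemma syz_count_insert:
  "syz_count T (insert (a, b) E) =
     syz_count T E + (card E + (card Na choose 2) + (card Nb choose 2) + 3 * card Paths)"
proof -
  have o: "card {d. (v, d) \<in> insert (a, b) E} choose 3 =
     (card {d. (v, d) \<in> E} choose 3) + (if v = a then card Na choose 2 else 0)" for v
  proof (cases "v = a")
    case True
    have "{d. (v, d) \<in> insert (a, b) E} = insert b Na" using True by (auto simp: Na_def)
    moreover have "b \<notin> Na" using new by (simp add: Na_def)
    ultimately show ?thesis using True Na_sub(3) choose_Suc_3[of "card Na"] by (simp add: Na_def)
  qed simp
  have i: "card {c. (c, v) \<in> insert (a, b) E} choose 3 =
     (card {c. (c, v) \<in> E} choose 3) + (if v = b then card Nb choose 2 else 0)" for v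
  proof (cases "v = b")
    case True
    have "{c. (c, v) \<in> insert (a, b) E} = insert a Nb" using True by (auto simp: Nb_def)
    moreover have "a \<notin> Nb" using new by (simp add: Nb_def)
    ultimately show ?thesis using True Na_sub(4) choose_Suc_3[of "card Nb"] by (simp add: Nb_def)
  qed simp
  have "(\<Sum>v\<in>T. (card {d. (v, d) \<in> insert (a, b) E} choose 3) + (card {c. (c, v) \<in> insert (a, b) E} choose 3))
    = (\<Sum>v\<in>T. (card {d. (v, d) \<in> E} choose 3) + (card {c. (c, v) \<in> E} choose 3))
      + (\<Sum>v\<in>T. if v = a then card Na choose 2 else 0) + (\<Sum>v\<in>T. if v = b then card Nb choose 2 else 0)"
    unfolding o i sum.distrib by (simp add: algebra_simps)
  also have "(\<Sum>v\<in>T. if v = a then card Na choose 2 else 0) = card Na choose 2"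
    using finT Na_sub(5) by simp
  also have "(\<Sum>v\<in>T. if v = b then card Nb choose 2 else 0) = card Nb choose 2"
    using finT Na_sub(6) by simp
  finally show ?thesis
    unfolding syz_count_def card_quads_insert
    using finE new choose_Suc_2[of "card E"] by simp
qed

end

lemma syz_has_dim:
  assumes fT: "finite T"
  shows "E \<subseteq> T \<times> T \<Longrightarrow> bip E \<Longrightarrow>
    fam.has_dim (syz 2 (bvars T) E :: ('v \<times> 'v \<Rightarrow> ('v bvar, 'k::field) mpoly) set) (syz_count T E)"
proof -
  obtain \<rho> :: "'v \<Rightarrow> nat" where rho: "inj_on \<rho> T"
    using finite_imp_inj_to_nat_seg[OF fT] by blast
  have "finite E \<Longrightarrow> E \<subseteq> T \<times> T \<Longrightarrow> bip E \<Longrightarrow>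
    fam.has_dim (syz 2 (bvars T) E :: ('v \<times> 'v \<Rightarrow> ('v bvar, 'k::field) mpoly) set) (syz_count T E)"
  proof (induct E rule: finite_induct)
    case empty
    have "(syz 2 (bvars T) {} :: ('v \<times> 'v \<Rightarrow> ('v bvar, 'k::field) mpoly) set) = {0}"
      by (auto simp: syz_def fun_eq_iff)
    moreover have "quads ({} :: ('v \<times> 'v) set) = {}" by (auto simp: quads_def)
    then have "syz_count T ({} :: ('v \<times> 'v) set) = 0"
      by (simp add: syz_count_def binomial_eq_0)
    ultimately show ?case using fam.has_dim_zero by simp
  next
    case (insert e F)
    obtain a b where e: "e = (a, b)" by (cases e)
    interpret new_edge F a b T \<rho>
      using insert fT rho by unfold_locales (auto simp: e)
    have "bip F" using insert(5) unfolding bip_def by blast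
    then have "fam.has_dim (syz 2 (bvars T) F :: ('v \<times> 'v \<Rightarrow> ('v bvar, 'k::field) mpoly) set) (syz_count T F)"
      using insert by blast
    then show ?case unfolding e syz_count_insert
      using insert(2) by (intro syz_step[OF insert(1) _ _ colon_has_dim]) (auto simp: e)
  qed
  then show "E \<subseteq> T \<times> T \<Longrightarrow> bip E \<Longrightarrow> ?thesis"
    using fT by (meson finite_SigmaI finite_subset)
qed

section \<open>Existence of minimal graded free resolutions\<close>

text \<open>
  Closure under \<open>fcomp\<close> says that the submodule is spanned by its homogeneous elements.
\<close>

definition graded_submodule :: "'x set \<Rightarrow> (nat \<Rightarrow> nat) \<Rightarrow> ('x, 'k::field) fvec set \<Rightarrow> bool" where
  "graded_submodule W r M \<longleftrightarrow> M \<subseteq> free_module W r \<and> 0 \<in> M \<and> (\<forall>v\<in>M. \<forall>w\<in>M. v + w \<in> M) \<and>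
     (\<forall>c\<in>poly_ring W. \<forall>v\<in>M. scal c v \<in> M) \<and> (\<forall>v\<in>M. \<forall>d. fcomp d v \<in> M)"

lemma graded_submoduleD:
  assumes "graded_submodule W r M"
  shows "v \<in> M \<Longrightarrow> v \<in> free_module W r" "0 \<in> M" "v \<in> M \<Longrightarrow> w \<in> M \<Longrightarrow> v + w \<in> M"
    "c \<in> poly_ring W \<Longrightarrow> v \<in> M \<Longrightarrow> scal c v \<in> M" "v \<in> M \<Longrightarrow> fcomp d v \<in> M"
  using assms unfolding graded_submodule_def by blast+

lemma graded_submodule_subspace: "graded_submodule W r M \<Longrightarrow> fv.subspace M"
  by (rule fv.subspaceI) (auto simp: csv_def intro: graded_submoduleD)

definition hpart :: "nat \<Rightarrow> ('x, 'k::field) fvec set \<Rightarrow> ('x, 'k) fvec set" where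
  "hpart d M = {v \<in> M. fvec_homogeneous d v}"

lemma hpart_subspace: "fv.subspace M \<Longrightarrow> fv.subspace (hpart d M)"
  unfolding hpart_def
  by (rule fv.subspaceI) (auto intro: fv.subspace_0 fv.subspace_add fv.subspace_scale fhom_add fhom_csv)

lemma finite_monomials:
  assumes "finite W"
  shows "finite {m :: 'x \<Rightarrow>\<^sub>0 nat. keys m \<subseteq> W \<and> mon_degree m \<le> d}" (is "finite ?S")
proof -
  have "finite ((lookup :: ('x \<Rightarrow>\<^sub>0 nat) \<Rightarrow> _) ` ?S)"
  proof (rule finite_subset)
    show "lookup ` ?S \<subseteq> {f. \<forall>x. (x \<in> W \<longrightarrow> f x \<in> {..d}) \<and> (x \<notin> W \<longrightarrow> f x = 0)}"
    proof (clarify, intro conjI allI impI)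
      fix m :: "'x \<Rightarrow>\<^sub>0 nat" and x assume m: "keys m \<subseteq> W" "mon_degree m \<le> d"
      have "lookup m x \<le> (\<Sum>x\<in>W. lookup m x)" if "x \<in> W"
        using that assms by (intro member_le_sum) auto
      then show "x \<in> W \<Longrightarrow> lookup m x \<in> {..d}" using mon_degree_eq[OF assms m(1)] m(2) by simp
      show "x \<notin> W \<Longrightarrow> lookup m x = 0" using m(1) by (auto simp: in_keys_iff)
    qed
    show "finite {f. \<forall>x. (x \<in> W \<longrightarrow> f x \<in> {..d}) \<and> (x \<notin> W \<longrightarrow> f x = (0::nat))}"
      by (rule finite_set_of_finite_funs) (use assms in auto)
  qed
  then show ?thesis by (rule finite_imageD) (rule inj_onI, simp only: poly_mapping_eq_iff)
qed

text \<open>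
  In a fixed degree only finitely many basis vectors and monomials occur. The rank function of
  the free module need not have finite support for this.
\<close>

lemma hpart_free_finite_span:
  assumes "finite W"
  shows "\<exists>T. finite T \<and> hpart d (free_module W r) \<subseteq> fv.span (T :: ('x, 'k::field) fvec set)"
proof -
  define I where "I = (SIGMA p:(SIGMA j:{..d}. {..<r j}). {m :: 'x \<Rightarrow>\<^sub>0 nat. keys m \<subseteq> W \<and> mon_degree m \<le> d})"
  define T where "T = (\<lambda>(p, m). single p (single m 1) :: ('x, 'k) fvec) ` I"
  have fI: "finite I" unfolding I_def by (intro finite_SigmaI finite_monomials assms) auto
  have "v \<in> fv.span T" if v: "v \<in> free_module W r" "fvec_homogeneous d v" for v
  proof -
    have "single p (lookup v p) \<in> fv.span T" if p: "p \<in> keys v" for p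
    proof -
      obtain j k where jk: "p = (j, k)" by (cases p)
      have nz: "lookup v (j, k) \<noteq> 0" using p jk by (simp add: in_keys_iff)
      then have "k < r j" "j \<le> d"
        using fm_lookup_0[OF v(1), of j k] fhom_lookup_low[OF v(2), of j k] by (meson not_le)+
      have "single p (single m (lookup (lookup v p) m)) \<in> fv.span T"
        if m: "m \<in> keys (lookup v p)" for m
      proof -
        have "lookup (lookup v (j, k)) m \<noteq> 0" using m jk by (simp add: in_keys_iff)
        then have "mon_degree m \<le> d" using fhomD[OF v(2)] by fastforce
        moreover have "keys m \<subseteq> W" using fm_lookup[OF v(1), of p] m by (auto simp: poly_ring_def)
        ultimately have "(p, m) \<in> I" using \<open>k < r j\<close> \<open>j \<le> d\<close> jk by (simp add: I_def)
        then have "single p (single m 1) \<in> T" unfolding T_def by force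
        moreover have "single p (single m c) =
          csv c (single p (single m 1))" for c :: 'k
          by (simp add: csv_def mult_single)
        ultimately show ?thesis by (metis fv.span_base fv.span_scale)
      qed
      moreover have "single p (lookup v p) =
        (\<Sum>m\<in>keys (lookup v p). single p (single m (lookup (lookup v p) m)))"
      proof -
        have s: "single p (sum f A) = (\<Sum>x\<in>A. single p (f x))" for f :: "_ \<Rightarrow> ('x, 'k) mpoly" and A
          by (induct A rule: infinite_finite_induct) (auto simp: single_add)
        have "lookup v p = (\<Sum>m\<in>keys (lookup v p). single m (lookup (lookup v p) m))"
          by (rule poly_mapping_sum_singles) auto
        then show ?thesis using s by metis
      qed
      ultimately show ?thesis by (metis (no_types, lifting) fv.span_sum)
    qed
    moreover have "v = (\<Sum>p\<in>keys v. single p (lookup v p))"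
      by (rule poly_mapping_sum_singles) auto
    ultimately show ?thesis by (metis (no_types, lifting) fv.span_sum)
  qed
  moreover have "finite T" unfolding T_def using fI by simp
  ultimately show ?thesis by (intro exI[of _ T]) (auto simp: hpart_def)
qed

text \<open>
  A basis of \<open>M\<close> modulo \<open>N\<close>: extend a basis of \<open>N\<close> and take the vectors that were added.
\<close>

lemma complement_basis:
  fixes M N :: "('x, 'k::field) fvec set"
  assumes T: "finite T" "M \<subseteq> fv.span T" and NM: "fv.subspace N" "N \<subseteq> M"
  shows "\<exists>(k :: nat) g. (\<forall>i<k. g i \<in> M) \<and> M \<subseteq> fv.span (N \<union> g ` {..<k}) \<and>
     (\<forall>u. (\<Sum>i<k. csv (u i) (g i)) \<in> N \<longrightarrow> (\<forall>i<k. u i = 0))"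
proof -
  obtain S where S: "S \<subseteq> N" "fv.independent S" "N \<subseteq> fv.span S"
    using fv.maximal_independent_subset by blast
  obtain B where B: "S \<subseteq> B" "B \<subseteq> M" "fv.independent B" "M \<subseteq> fv.span B"
    using fv.maximal_independent_subset_extend[of S M] S NM by blast
  have fB: "finite B" using fv.independent_span_bound[OF T(1) B(3)] B(2) T(2) by blast
  obtain g where g: "bij_betw g {..<card (B - S)} (B - S)"
    using ex_bij_betw_nat_finite[of "B - S"] fB by (auto simp: atLeast0LessThan)
  let ?k = "card (B - S)"
  have gim: "g ` {..<?k} = B - S" and gij: "inj_on g {..<?k}" using g by (auto simp: bij_betw_def)
  have "M \<subseteq> fv.span (N \<union> g ` {..<?k})"
  proof -
    have "B \<subseteq> N \<union> g ` {..<?k}" using gim S(1) by blast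
    then show ?thesis using B(4) fv.span_mono by blast
  qed
  moreover have "\<forall>i<?k. u i = 0" if u: "(\<Sum>i<?k. csv (u i) (g i)) \<in> N" for u
  proof -
    have fS: "finite S" using fB B(1) finite_subset by blast
    obtain w where w: "(\<Sum>i<?k. csv (u i) (g i)) = (\<Sum>s\<in>S. csv (w s) s)"
      using u S(3) unfolding fv.span_finite[OF fS] by blast
    define h where "h b = (if b \<in> S then - w b else u (inv_into {..<?k} g b))" for b
    have "(\<Sum>b\<in>B. csv (h b) b) = (\<Sum>b\<in>S. csv (h b) b) + (\<Sum>b\<in>B - S. csv (h b) b)"
      using sum.subset_diff[OF B(1) fB, of "\<lambda>b. csv (h b) b"] by (simp add: add.commute)
    also have "(\<Sum>b\<in>S. csv (h b) b) = - (\<Sum>s\<in>S. csv (w s) s)"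
      by (simp add: h_def sum_negf)
    also have "(\<Sum>b\<in>B - S. csv (h b) b) = (\<Sum>i<?k. csv (h (g i)) (g i))"
      using sum.reindex[OF gij, of "\<lambda>b. csv (h b) b"] gim by simp
    also have "\<dots> = (\<Sum>i<?k. csv (u i) (g i))"
    proof (rule sum.cong)
      fix i assume i: "i \<in> {..<?k}"
      then have "g i \<notin> S" using gim by blast
      then show "csv (h (g i)) (g i) = csv (u i) (g i)"
        using inv_into_f_f[OF gij i] by (simp add: h_def)
    qed simp
    finally have z: "(\<Sum>b\<in>B. csv (h b) b) = 0" using w by simp
    show ?thesis
    proof (intro allI impI)
      fix i assume i: "i < ?k"
      then have gi: "g i \<in> B - S" using gim by blast
      then have "h (g i) = 0" using fv.independentD[OF B(3) fB subset_refl z] by blast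
      then show "u i = 0" using gi inv_into_f_f[OF gij, of i] i by (simp add: h_def)
    qed
  qed
  moreover have "\<forall>i<?k. g i \<in> M" using gim B(2) by blast
  ultimately show ?thesis by blast
qed


text \<open>
  The degree \<open>d\<close> part of \<open>\<mm>M\<close> for the irrelevant ideal \<open>\<mm>\<close>.
\<close>

definition mpart :: "'x set \<Rightarrow> nat \<Rightarrow> ('x, 'k::field) fvec set \<Rightarrow> ('x, 'k) fvec set" where
  "mpart W d M = fv.span {scal p v | p v j. j < d \<and> p \<in> hpoly (d - j) W \<and> v \<in> hpart j M}"

lemma mpart_sub:
  assumes "graded_submodule W r M"
  shows "mpart W d M \<subseteq> hpart d M"
  unfolding mpart_def
proof (rule fv.span_minimal)
  show "{scal p v | p v j. j < d \<and> p \<in> hpoly (d - j) W \<and> v \<in> hpart j M} \<subseteq> hpart d M"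
  proof clarify
    fix p :: "('a, 'b) mpoly" and v j assume a: "j < d" "p \<in> hpoly (d - j) W" "v \<in> hpart j M"
    then have "fvec_homogeneous (d - j + j) (scal p v)"
      by (intro fhom_scal) (auto simp: hpoly_def hpart_def)
    then show "scal p v \<in> hpart d M"
      using a graded_submoduleD(4)[OF assms] by (simp add: hpart_def hpoly_def)
  qed
  show "fv.subspace (hpart d M)" by (rule hpart_subspace[OF graded_submodule_subspace[OF assms]])
qed

text \<open>
  The homomorphism of free modules that maps the basis vectors to the values of \<open>g\<close>.
\<close>

definition lincomb :: "(nat \<times> nat \<Rightarrow> ('x, 'k::field) fvec) \<Rightarrow> ('x, 'k) fvec \<Rightarrow> ('x, 'k) fvec" where
  "lincomb g v = (\<Sum>q\<in>keys v. scal (lookup v q) (g q))"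

lemma lincomb_superset:
  assumes "finite A" "keys v \<subseteq> A"
  shows "lincomb g v = (\<Sum>q\<in>A. scal (lookup v q) (g q))"
  unfolding lincomb_def using assms by (intro sum.mono_neutral_left) (auto simp: in_keys_iff)

lemma lincomb_add: "lincomb g (v + w) = lincomb g v + lincomb g w"
proof -
  have *: "lincomb g u = (\<Sum>q\<in>keys v \<union> keys w. scal (lookup u q) (g q))" if "u \<in> {v, w, v + w}" for u
    using that keys_add[of v w] by (intro lincomb_superset) auto
  show ?thesis by (simp add: * lookup_add scal_add_left sum.distrib)
qed

lemma lincomb_scal: "lincomb g (scal c v) = scal c (lincomb g v)"
proof -
  have "keys (scal c v) \<subseteq> keys v"
  proof
    fix q assume "q \<in> keys (scal c v)"
    then have "c * lookup v q \<noteq> 0" by (simp only: in_keys_iff lookup_scal not_False_eq_True)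
    then show "q \<in> keys v" by (auto simp: in_keys_iff)
  qed
  then have "lincomb g (scal c v) = (\<Sum>q\<in>keys v. scal (lookup (scal c v) q) (g q))"
    by (intro lincomb_superset) auto
  then show ?thesis by (simp add: lincomb_def scal_sum_right scal_scal)
qed

lemma lincomb_bas: "lincomb g (bas q) = g q"
  by (simp add: lincomb_def bas_def)

lemma lincomb_graded_hom:
  fixes g :: "nat \<times> nat \<Rightarrow> ('x, 'k::field) fvec"
  assumes g: "\<And>j k. k < r j \<Longrightarrow> g (j, k) \<in> hpart j (free_module W s)"
  shows "graded_hom W r s (lincomb g)"
  unfolding graded_hom_def
proof (intro conjI ballI allI impI)
  fix v :: "('x, 'k) fvec" assume v: "v \<in> free_module W r"
  have kr: "k < r j" if "(j, k) \<in> keys v" for j k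
    using that fm_lookup_0[OF v, of j k] by (auto simp: in_keys_iff not_le[symmetric])
  have gq: "g q \<in> free_module W s" "fvec_homogeneous (fst q) (g q)" if "q \<in> keys v" for q
    using that kr g by (cases q; auto simp: hpart_def)+
  show "lincomb g v \<in> free_module W s"
    unfolding lincomb_def by (intro fm_sum fm_scal fm_lookup[OF v] gq)
  fix d assume h: "fvec_homogeneous d v"
  show "fvec_homogeneous d (lincomb g v)" unfolding lincomb_def
  proof (rule fhom_sum)
    fix q assume q: "q \<in> keys v"
    obtain j k where jk: "q = (j, k)" by (cases q)
    have "j \<le> d" using q fhom_lookup_low[OF h, of j k] jk by (auto simp: in_keys_iff not_le[symmetric])
    moreover have "fvec_homogeneous (d - j + j) (scal (lookup v q) (g q))"
      using gq(2)[OF q] fhom_lookup[OF h, of j k] jk by (intro fhom_scal) auto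
    ultimately show "fvec_homogeneous d (scal (lookup v q) (g q))" by simp
  qed
qed (simp_all add: lincomb_add lincomb_scal)

lemma fun_fvec_pair: "vector_space_pair (csf :: 'k::field \<Rightarrow> ('e \<Rightarrow> ('x, 'k) mpoly) \<Rightarrow> _) (csv :: 'k \<Rightarrow> ('x, 'k) fvec \<Rightarrow> _)"
  by (simp add: vector_space_pair_def fam.vector_space_axioms fv.vector_space_axioms)

lemma fvec_pair: "vector_space_pair (csv :: 'k::field \<Rightarrow> ('x, 'k) fvec \<Rightarrow> _) (csv :: 'k \<Rightarrow> ('x, 'k) fvec \<Rightarrow> _)"
  by (simp add: vector_space_pair_def fv.vector_space_axioms)

lemma graded_hom_image_subspace:
  assumes f: "graded_hom W r s f"
  shows "fv.subspace (f ` free_module W r)"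
  using graded_homD(2,3)[OF f]
  by (intro vector_space_pair.subspace_image_on[OF fvec_pair fm_subspace]) (auto simp: csv_def)

text \<open>
  In each degree \<open>d\<close> choose a basis of \<open>M\<^sub>d\<close> modulo \<open>(\<mm>M)\<^sub>d\<close>. These elements generate \<open>M\<close> by
  induction on the degree. If a relation between them had a nonzero constant coefficient at an
  element of degree \<open>d\<close>, the degree \<open>d\<close> component of this relation would be a linear dependence
  modulo \<open>(\<mm>M)\<^sub>d\<close>.
\<close>

lemma minimal_free_cover:
  fixes M :: "('x, 'k::field) fvec set"
  assumes W: "finite W" and M: "graded_submodule W s M"
  shows "\<exists>r f. graded_hom W r s f \<and> f ` free_module W r = M \<and>
    (\<forall>v\<in>free_module W r. f v = 0 \<longrightarrow> (\<forall>p. lookup (lookup v p) 0 = 0))"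
proof -
  define R where "R d k g \<longleftrightarrow> (\<forall>i<k. g i \<in> hpart d M) \<and> hpart d M \<subseteq> fv.span (mpart W d M \<union> g ` {..<k}) \<and>
     (\<forall>u. (\<Sum>i<k. csv (u i) (g i)) \<in> mpart W d M \<longrightarrow> (\<forall>i<k. u i = 0))"
    for d and k :: nat and g
  have "\<exists>k g. R d k g" for d
  proof -
    obtain T where "finite T" "hpart d (free_module W s) \<subseteq> fv.span (T :: ('x, 'k) fvec set)"
      using hpart_free_finite_span[OF W] by blast
    moreover have "hpart d M \<subseteq> hpart d (free_module W s)"
      using graded_submoduleD(1)[OF M] by (auto simp: hpart_def)
    moreover have "fv.subspace (mpart W d M)" unfolding mpart_def by (rule fv.subspace_span)
    ultimately show ?thesis
      unfolding R_def using mpart_sub[OF M] by (intro complement_basis[of T]) (auto simp del: fv.subspace_span)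
  qed
  then obtain r g where R: "\<And>d. R d (r d) (g d)" by metis
  have g: "\<And>d i. i < r d \<Longrightarrow> g d i \<in> hpart d M"
    and sp: "\<And>d. hpart d M \<subseteq> fv.span (mpart W d M \<union> g d ` {..<r d})"
    and ind: "\<And>d u i. (\<Sum>i<r d. csv (u i) (g d i)) \<in> mpart W d M \<Longrightarrow> i < r d \<Longrightarrow> u i = 0"
    using R unfolding R_def by blast+
  define f where "f = lincomb (\<lambda>(j, k). g j k)"
  have hom: "graded_hom W r s f"
    unfolding f_def using g graded_submoduleD(1)[OF M]
    by (intro lincomb_graded_hom) (auto simp: hpart_def)
  have inM: "scal p (g j k) \<in> M" if "p \<in> poly_ring W" "k < r j" for p j k
    using that g graded_submoduleD(4)[OF M] by (auto simp: hpart_def)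
  have kr: "k < r j" if "v \<in> free_module W r" "(j, k) \<in> keys v" for j k and v :: "('x, 'k) fvec"
    using that fm_lookup_0[OF that(1), of j k] by (auto simp: in_keys_iff not_le[symmetric])
  have sub: "f ` free_module W r \<subseteq> M"
  proof clarify
    fix v :: "('x, 'k) fvec" assume v: "v \<in> free_module W r"
    show "f v \<in> M" unfolding f_def lincomb_def
      using kr[OF v] fm_lookup[OF v]
      by (intro fv.subspace_sum[OF graded_submodule_subspace[OF M]]) (auto intro: inM)
  qed
  have im: "hpart d M \<subseteq> f ` free_module W r" for d
  proof (induct d rule: less_induct)
    case (less d)
    have "mpart W d M \<subseteq> f ` free_module W r"
      unfolding mpart_def
    proof (rule fv.span_minimal[OF _ graded_hom_image_subspace[OF hom]], clarify)
      fix p :: "('x, 'k) mpoly" and v j assume a: "j < d" "p \<in> hpoly (d - j) W" "v \<in> hpart j M"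
      then obtain w where w: "v = f w" "w \<in> free_module W r" using less by blast
      then have "scal p v = f (scal p w)" using a graded_homD(3)[OF hom] by (simp add: hpoly_def)
      moreover have "scal p w \<in> free_module W r" using a w by (intro fm_scal) (auto simp: hpoly_def)
      ultimately show "scal p v \<in> f ` free_module W r" by blast
    qed
    moreover have "g d ` {..<r d} \<subseteq> f ` free_module W r"
    proof clarify
      fix i assume "i < r d"
      then show "g d i \<in> f ` free_module W r"
        using fm_bas[of i r d W] by (intro image_eqI[of _ _ "bas (d, i)"]) (auto simp: f_def lincomb_bas)
    qed
    ultimately have "fv.span (mpart W d M \<union> g d ` {..<r d}) \<subseteq> f ` free_module W r"
      by (intro fv.span_minimal[OF _ graded_hom_image_subspace[OF hom]]) auto
    then show ?case using sp by blast
  qed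
  have "M \<subseteq> f ` free_module W r"
  proof
    fix v assume v: "v \<in> M"
    obtain D where D: "finite D" "v = (\<Sum>d\<in>D. fcomp d v)" using fcomp_decompose by blast
    have "fcomp d v \<in> f ` free_module W r" for d
    proof -
      have "fcomp d v \<in> hpart d M"
        unfolding hpart_def using graded_submoduleD(5)[OF M v] fcomp_hom by blast
      then show ?thesis using im by blast
    qed
    then show "v \<in> f ` free_module W r"
      by (subst D(2)) (intro fv.subspace_sum[OF graded_hom_image_subspace[OF hom]])
  qed
  moreover have "lookup (lookup v (d, k)) 0 = 0" if v: "v \<in> free_module W r" and z: "f v = 0" for v d k
  proof (cases "k < r d")
    case False
    then show ?thesis using fm_lookup_0[OF v, of d k] by simp
  next
    case True
    \<comment> \<open>The coefficients of \<open>w\<close> at generators of degree \<open>d\<close> are the constants \<open>u\<close>; all others are in \<open>\<mm>\<close>.\<close>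
    define w where "w = fcomp d v"
    define u where "u i = lookup (lookup v (d, i)) 0" for i
    have w: "w \<in> free_module W r" "fvec_homogeneous d w" unfolding w_def by (auto intro: fcomp_fm v fcomp_hom)
    have "f w = 0" unfolding w_def graded_hom_fcomp[OF hom v] z by simp
    let ?B = "{d} \<times> {..<r d}"
    let ?C = "{q \<in> keys w. fst q < d}"
    have keys_w: "keys w \<subseteq> ?B \<union> ?C"
    proof
      fix q assume q: "q \<in> keys w"
      obtain j k where jk: "q = (j, k)" by (cases q)
      have "\<not> d < j" using q fhom_lookup_low[OF w(2), of j k] jk by (auto simp: in_keys_iff)
      then show "q \<in> ?B \<union> ?C" using q jk kr[OF w(1), of j k] by auto
    qed
    have "f w = (\<Sum>q\<in>?B \<union> ?C. scal (lookup w q) (case q of (j, k) \<Rightarrow> g j k))"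
      unfolding f_def using keys_w by (intro lincomb_superset) auto
    also have "\<dots> = (\<Sum>q\<in>?B. scal (lookup w q) (case q of (j, k) \<Rightarrow> g j k))
        + (\<Sum>q\<in>?C. scal (lookup w q) (case q of (j, k) \<Rightarrow> g j k))"
      by (intro sum.union_disjoint) auto
    also have "(\<Sum>q\<in>?B. scal (lookup w q) (case q of (j, k) \<Rightarrow> g j k)) = (\<Sum>i<r d. csv (u i) (g d i))"
    proof -
      have "lookup w (d, i) = single 0 (u i)" for i
        unfolding w_def u_def lookup_fcomp
        by (auto intro!: poly_mapping_eqI simp: lookup_pcomp lookup_single when_def)
      then have "scal (lookup w (d, i)) (g d i) = csv (u i) (g d i)" for i by (simp add: csv_def)
      moreover have "?B = Pair d ` {..<r d}" by auto
      ultimately show ?thesis by (simp add: sum.reindex inj_on_def)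
    qed
    finally have "(\<Sum>i<r d. csv (u i) (g d i)) = - (\<Sum>q\<in>?C. scal (lookup w q) (case q of (j, k) \<Rightarrow> g j k))"
      using \<open>f w = 0\<close> by (simp add: eq_neg_iff_add_eq_0)
    moreover have "(\<Sum>q\<in>?C. scal (lookup w q) (case q of (j, k) \<Rightarrow> g j k)) \<in> mpart W d M"
      unfolding mpart_def
    proof (intro fv.span_sum fv.span_base CollectI)
      fix q assume q: "q \<in> ?C"
      obtain j k where jk: "q = (j, k)" by (cases q)
      then have "j < d" "g j k \<in> hpart j M" using q kr[OF w(1), of j k] g by auto
      moreover have "lookup w q \<in> hpoly (d - j) W"
        using fm_lookup[OF w(1)] fhom_lookup[OF w(2)] jk by (auto simp: hpoly_def)
      ultimately show "\<exists>p v j. scal (lookup w q) (case q of (j, k) \<Rightarrow> g j k) = scal p v \<and>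
          j < d \<and> p \<in> hpoly (d - j) W \<and> v \<in> hpart j M"
        using jk by auto
    qed
    ultimately have "(\<Sum>i<r d. csv (u i) (g d i)) \<in> mpart W d M"
      unfolding mpart_def by (simp add: fv.span_neg)
    then show ?thesis using ind[OF _ True, of u] by (simp add: u_def)
  qed
  ultimately show ?thesis using hom sub by (intro exI[of _ r] exI[of _ f]) auto
qed

lemma graded_hom_kernel:
  assumes f: "graded_hom W r s f"
  shows "graded_submodule W r {v \<in> free_module W r. f v = 0}"
  unfolding graded_submodule_def
  using graded_homD(2,3)[OF f] graded_hom_0[OF f] graded_hom_fcomp[OF f]
  by (auto intro: fm_add fm_scal fcomp_fm)

definition homogeneous_ideal :: "'x set \<Rightarrow> ('x, 'k::field) mpoly set \<Rightarrow> bool" where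
  "homogeneous_ideal W J \<longleftrightarrow> J \<subseteq> poly_ring W \<and> 0 \<in> J \<and> (\<forall>p\<in>J. \<forall>q\<in>J. p + q \<in> J) \<and>
     (\<forall>c\<in>poly_ring W. \<forall>p\<in>J. c * p \<in> J) \<and> (\<forall>p\<in>J. \<forall>d. pcomp d p \<in> J)"

text \<open>
  Start with the ring itself as \<open>F\<^sub>0\<close> and cover the kernel of the preceding map repeatedly. A
  kernel is contained in \<open>\<mm>F\<close> by the minimality of the cover, which makes the next map minimal.
\<close>

lemma minimal_resolution_exists:
  fixes J :: "('x, 'k::field) mpoly set"
  assumes W: "finite W" and J: "homogeneous_ideal W J" and proper: "\<And>p. p \<in> J \<Longrightarrow> lookup p 0 = 0"
  shows "\<exists>b \<epsilon> \<delta>. minimal_graded_free_resolution W J b \<epsilon> \<delta>"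
proof -
  define r0 where "r0 = (\<lambda>j :: nat. if j = 0 then 1 else 0 :: nat)"
  define \<epsilon> where "\<epsilon> = (\<lambda>v :: ('x, 'k) fvec. lookup v (0, 0))"
  define M0 where "M0 = {v \<in> free_module W r0. \<epsilon> v \<in> J}"
  have J': "J \<subseteq> poly_ring W" "0 \<in> J" "\<And>p q. p \<in> J \<Longrightarrow> q \<in> J \<Longrightarrow> p + q \<in> J"
    "\<And>c p. c \<in> poly_ring W \<Longrightarrow> p \<in> J \<Longrightarrow> c * p \<in> J" "\<And>p d. p \<in> J \<Longrightarrow> pcomp d p \<in> J"
    using J unfolding homogeneous_ideal_def by blast+
  have M0: "graded_submodule W r0 M0"
    unfolding graded_submodule_def M0_def \<epsilon>_def using J'
    by (auto intro: fm_add fm_scal fcomp_fm simp: lookup_add lookup_fcomp)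
  have M0c: "lookup (lookup v p) 0 = 0" if v: "v \<in> M0" for v p
  proof (cases "p = (0, 0)")
    case True
    then show ?thesis using v proper by (simp add: M0_def \<epsilon>_def)
  next
    case False
    obtain j k where "p = (j, k)" by (cases p)
    moreover have "r0 j \<le> k" using False calculation by (auto simp: r0_def)
    ultimately show ?thesis using v fm_lookup_0[of v W r0 j k] by (simp add: M0_def)
  qed
  \<comment> \<open>A state consists of a rank function, the submodule to be covered next, and the preceding map, which is arbitrary at the start.\<close>
  define P where "P = (\<lambda>x :: (nat \<Rightarrow> nat) \<times> ('x, 'k) fvec set \<times> (('x, 'k) fvec \<Rightarrow> ('x, 'k) fvec).
     graded_submodule W (fst x) (fst (snd x)) \<and> (\<forall>v\<in>fst (snd x). \<forall>p. lookup (lookup v p) 0 = 0))"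
  define Q where "Q = (\<lambda>(x :: (nat \<Rightarrow> nat) \<times> ('x, 'k) fvec set \<times> (('x, 'k) fvec \<Rightarrow> ('x, 'k) fvec))
      (y :: (nat \<Rightarrow> nat) \<times> ('x, 'k) fvec set \<times> (('x, 'k) fvec \<Rightarrow> ('x, 'k) fvec)).
     graded_hom W (fst y) (fst x) (snd (snd y)) \<and> snd (snd y) ` free_module W (fst y) = fst (snd x) \<and>
     fst (snd y) = {v \<in> free_module W (fst y). snd (snd y) v = 0})"
  have "\<exists>y. P y \<and> Q x y" if "P x" for x
  proof -
    have "graded_submodule W (fst x) (fst (snd x))" using that by (simp add: P_def)
    then obtain r f where rf: "graded_hom W r (fst x) f" "f ` free_module W r = fst (snd x)"
      "\<And>v p. v \<in> free_module W r \<Longrightarrow> f v = 0 \<Longrightarrow> lookup (lookup v p) 0 = 0"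
      using minimal_free_cover[OF W] by metis
    then show ?thesis using graded_hom_kernel[OF rf(1)]
      by (intro exI[of _ "(r, {v \<in> free_module W r. f v = 0}, f)"]) (auto simp: P_def Q_def)
  qed
  moreover have "P (r0, M0, id)" using M0 M0c by (simp add: P_def)
  ultimately have "\<exists>st. \<forall>n. (P (st n) \<and> (n = 0 \<longrightarrow> st n = (r0, M0, id))) \<and> Q (st n) (st (Suc n))"
    by (intro dependent_nat_choice) blast+
  then obtain st where st: "st 0 = (r0, M0, id)" "\<And>n. P (st n)" "\<And>n. Q (st n) (st (Suc n))"
    by blast
  define b where "b n = fst (st n)" for n
  define \<delta> where "\<delta> n = snd (snd (st n))" for n
  have M: "fst (snd (st (Suc n))) = {v \<in> free_module W (b (Suc n)). \<delta> (Suc n) v = 0}" for n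
    using st(3)[of n] by (simp add: Q_def b_def \<delta>_def)
  have im: "\<delta> (Suc n) ` free_module W (b (Suc n)) = fst (snd (st n))" for n
    using st(3)[of n] by (simp add: Q_def b_def \<delta>_def)
  have b0: "b 0 = r0" by (simp add: b_def st(1))
  have "minimal_graded_free_resolution W J b \<epsilon> \<delta>"
    unfolding minimal_graded_free_resolution_def
  proof (intro conjI allI ballI impI)
    show "graded_hom_to_ring W (b 0) \<epsilon>"
      unfolding graded_hom_to_ring_def \<epsilon>_def
      by (auto simp: lookup_add intro: fm_lookup) (metis diff_zero fhom_lookup)
    show "graded_hom W (b (Suc i)) (b i) (\<delta> (Suc i))" for i
      using st(3)[of i] by (simp add: Q_def b_def \<delta>_def)
    show "\<exists>v\<in>free_module W (b 0). \<epsilon> v - s \<in> J" if s: "s \<in> poly_ring W" for s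
    proof
      show "scal s (bas (0, 0)) \<in> free_module W (b 0)"
        unfolding b0 by (intro fm_scal fm_bas s) (simp add: r0_def)
      show "\<epsilon> (scal s (bas (0, 0))) - s \<in> J" using J'(2) by (simp add: \<epsilon>_def lookup_bas)
    qed
    show "{v \<in> free_module W (b 0). \<epsilon> v \<in> J} = \<delta> 1 ` free_module W (b 1)"
      using im[of 0] by (simp add: st(1) M0_def b0)
    show "{v \<in> free_module W (b i). \<delta> i v = 0} = \<delta> (Suc i) ` free_module W (b (Suc i))" if "1 \<le> i" for i
      using that im[of i] M[of "i - 1"] by simp
    show "lookup (lookup (\<delta> (Suc i) v) p) 0 = 0" if "v \<in> free_module W (b (Suc i))" for i v p
    proof -
      have "\<delta> (Suc i) v \<in> fst (snd (st i))" using im that by blast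
      then show ?thesis using st(2)[of i] unfolding P_def by blast
    qed
  qed
  then show ?thesis by blast
qed

section \<open>The second Betti number in degree four\<close>

definition bideal :: "'v bvar set \<Rightarrow> ('v \<times> 'v) set \<Rightarrow> ('v bvar, 'k::field) mpoly set" where
  "bideal W E = {\<Sum>e\<in>E. c e * ebin e | c. \<forall>e\<in>E. c e \<in> poly_ring W}"

lemma ebin_phom: "poly_homogeneous 2 (ebin e :: ('v bvar, 'k::field) mpoly)"
proof -
  have "(ebin (fst e, snd e) :: ('v bvar, 'k) mpoly) \<in> hpoly 2 (bvars UNIV)" by (rule ebin_hpoly) auto
  then show ?thesis by (simp add: hpoly_def)
qed

lemma pcomp_bideal:
  "pcomp d (\<Sum>e\<in>E. c e * ebin e) = (if 2 \<le> d then \<Sum>e\<in>E. pcomp (d - 2) (c e) * ebin e else 0)"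
  by (simp add: pcomp_sum pcomp_mult_hom[OF ebin_phom])

lemma bideal_homogeneous_ideal:
  assumes "E \<subseteq> T \<times> T"
  shows "homogeneous_ideal (bvars T) (bideal (bvars T) E :: ('v bvar, 'k::field) mpoly set)"
proof -
  have eb: "(ebin e :: ('v bvar, 'k) mpoly) \<in> poly_ring (bvars T)" if "e \<in> E" for e
    using ebin_hpoly[of "fst e" T "snd e"] assms that by (auto simp: hpoly_def)
  show ?thesis unfolding homogeneous_ideal_def
  proof (intro conjI ballI allI)
    show "bideal (bvars T) E \<subseteq> (poly_ring (bvars T) :: ('v bvar, 'k) mpoly set)"
      using eb by (auto simp: bideal_def intro!: pr_sum pr_mult)
    show "0 \<in> (bideal (bvars T) E :: ('v bvar, 'k) mpoly set)"
      unfolding bideal_def by (intro CollectI exI[of _ "\<lambda>_. 0"]) auto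
  next
    fix p q :: "('v bvar, 'k) mpoly" assume "p \<in> bideal (bvars T) E" "q \<in> bideal (bvars T) E"
    then obtain c d where "p = (\<Sum>e\<in>E. c e * ebin e)" "\<forall>e\<in>E. c e \<in> poly_ring (bvars T)"
      "q = (\<Sum>e\<in>E. d e * ebin e)" "\<forall>e\<in>E. d e \<in> poly_ring (bvars T)" unfolding bideal_def by blast
    then show "p + q \<in> bideal (bvars T) E" unfolding bideal_def
      by (intro CollectI exI[of _ "\<lambda>e. c e + d e"]) (auto simp: distrib_right sum.distrib intro!: pr_add)
  next
    fix k p :: "('v bvar, 'k) mpoly" assume k: "k \<in> poly_ring (bvars T)" and "p \<in> bideal (bvars T) E"
    then obtain c where "p = (\<Sum>e\<in>E. c e * ebin e)" "\<forall>e\<in>E. c e \<in> poly_ring (bvars T)"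
      unfolding bideal_def by blast
    then show "k * p \<in> bideal (bvars T) E" unfolding bideal_def using k
      by (intro CollectI exI[of _ "\<lambda>e. k * c e"]) (auto simp: sum_distrib_left mult.assoc intro!: pr_mult)
  next
    fix p :: "('v bvar, 'k) mpoly" and d assume "p \<in> bideal (bvars T) E"
    then obtain c where c: "p = (\<Sum>e\<in>E. c e * ebin e)" "\<forall>e\<in>E. c e \<in> poly_ring (bvars T)"
      unfolding bideal_def by blast
    have "pcomp d p = (\<Sum>e\<in>E. (if 2 \<le> d then pcomp (d - 2) (c e) else 0) * ebin e)"
      unfolding c(1) pcomp_bideal by auto
    then show "pcomp d p \<in> bideal (bvars T) E" unfolding bideal_def using c(2)
      by (intro CollectI exI[of _ "\<lambda>e. if 2 \<le> d then pcomp (d - 2) (c e) else 0"]) (auto intro!: pcomp_pr)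
  qed
qed

text \<open>
  The coefficients of a homogeneous element can be replaced by their components of the
  appropriate degree.
\<close>

lemma bideal_homogeneous_element:
  assumes p: "p \<in> bideal W E" and h: "poly_homogeneous d p"
  shows "d < 2 \<Longrightarrow> p = 0"
    and "2 \<le> d \<Longrightarrow> \<exists>c. (\<forall>e\<in>E. c e \<in> hpoly (d - 2) W) \<and> p = (\<Sum>e\<in>E. c e * ebin e)"
proof -
  obtain c where c: "p = (\<Sum>e\<in>E. c e * ebin e)" "\<forall>e\<in>E. c e \<in> poly_ring W"
    using p unfolding bideal_def by blast
  have "p = pcomp d p" using pcomp_id[OF h, of d] by simp
  then have eq: "p = (if 2 \<le> d then \<Sum>e\<in>E. pcomp (d - 2) (c e) * ebin e else 0)"
    unfolding c(1) pcomp_bideal .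
  show "d < 2 \<Longrightarrow> p = 0" using eq by simp
  show "2 \<le> d \<Longrightarrow> \<exists>c. (\<forall>e\<in>E. c e \<in> hpoly (d - 2) W) \<and> p = (\<Sum>e\<in>E. c e * ebin e)"
    using eq c(2)
    by (intro exI[of _ "\<lambda>e. pcomp (d - 2) (c e)"]) (auto simp: hpoly_def intro!: pcomp_pr pcomp_hom)
qed

lemma bideal_const:
  fixes p :: "('v bvar, 'k::field) mpoly"
  assumes "p \<in> bideal W E"
  shows "lookup p 0 = 0"
proof -
  have e: "lookup (ebin e :: ('v bvar, 'k) mpoly) 0 = 0" for e :: "'v \<times> 'v"
    using phomD[OF ebin_phom, of e 0] by force
  obtain c where "p = (\<Sum>e\<in>E. c e * ebin e)" using assms unfolding bideal_def by blast
  then show ?thesis by (simp only: lookup_sum lookup_mult_0 e mult_zero_right sum.neutral_const)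
qed

subsection \<open>Minimal covers of the ideal\<close>

text \<open>
  The map from the first free module of a minimal resolution onto the ideal, with the target
  identified with the ring. Minimality of the second map is expressed by its image, which is
  the kernel of \<open>d1\<close>.
\<close>

locale minimal_ideal_cover =
  fixes T :: "'v set" and E :: "('v \<times> 'v) set" and r :: "nat \<Rightarrow> nat"
    and d1 :: "('v bvar, 'k::field) fvec \<Rightarrow> ('v bvar, 'k) mpoly"
  assumes finT: "finite T" and ET: "E \<subseteq> T \<times> T" and bip: "bip E"
    and add: "\<And>v w. v \<in> free_module (bvars T) r \<Longrightarrow> w \<in> free_module (bvars T) r \<Longrightarrow> d1 (v + w) = d1 v + d1 w"
    and scal: "\<And>c v. c \<in> poly_ring (bvars T) \<Longrightarrow> v \<in> free_module (bvars T) r \<Longrightarrow> d1 (scal c v) = c * d1 v"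
    and comp: "\<And>d v. v \<in> free_module (bvars T) r \<Longrightarrow> d1 (fcomp d v) = pcomp d (d1 v)"
    and into: "\<And>v. v \<in> free_module (bvars T) r \<Longrightarrow> d1 v \<in> bideal (bvars T) E"
    and onto: "\<And>p. p \<in> bideal (bvars T) E \<Longrightarrow> \<exists>v\<in>free_module (bvars T) r. d1 v = p"
    and minimal: "\<And>v q. v \<in> free_module (bvars T) r \<Longrightarrow> d1 v = 0 \<Longrightarrow> lookup (lookup v q) 0 = 0"
begin

abbreviation "W \<equiv> bvars T"
abbreviation "F \<equiv> free_module (bvars T) r"

lemma finE: "finite E"
  using finT ET by (meson finite_SigmaI finite_subset)

lemma d1_0: "d1 0 = 0"
  using add[of 0 0] by fastforce

lemma d1_sum: "(\<And>x. x \<in> A \<Longrightarrow> h x \<in> F) \<Longrightarrow> d1 (sum h A) = (\<Sum>x\<in>A. d1 (h x))"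
proof (induct A rule: infinite_finite_induct)
  case (insert x A)
  then have "sum h A \<in> F" by (intro fm_sum) auto
  then show ?case using insert add by simp
qed (auto simp: d1_0)

lemma d1_diff: "v \<in> F \<Longrightarrow> w \<in> F \<Longrightarrow> d1 (v - w) = d1 v - d1 w"
  using add[of "v - w" w] fm_diff[of v W r w] by (simp add: eq_diff_eq)

lemma d1_hom: "v \<in> F \<Longrightarrow> fvec_homogeneous d v \<Longrightarrow> poly_homogeneous d (d1 v)"
  using comp[of v d] pcomp_hom[of d "d1 v"] fcomp_id[of d v d] by simp

text \<open>
  The ideal starts in degree two, so a basis vector of lower degree would be in the kernel.
\<close>

lemma rank_low:
  assumes "j < 2" shows "r j = 0"
proof (rule ccontr)
  assume "r j \<noteq> 0"
  then have b: "bas (j, 0) \<in> F" by (intro fm_bas) simp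
  have "d1 (bas (j, 0)) = 0"
    using bideal_homogeneous_element(1)[OF into[OF b] d1_hom[OF b fhom_bas] assms] .
  then show False using minimal[OF b, of "(j, 0)"] by (simp add: lookup_bas)
qed

text \<open>
  The lifts of the generators turn out to form a basis of the free module: they generate it by
  \<open>lift_sum_onto\<close> and are independent by \<open>lift_sum_inj\<close>. So kernel elements correspond to syzygies
  of the binomials, whichever basis of the free module is given.
\<close>

definition gen_lift :: "'v \<times> 'v \<Rightarrow> ('v bvar, 'k) fvec" where
  "gen_lift e = (SOME v. v \<in> F \<and> fvec_homogeneous 2 v \<and> d1 v = ebin e)"

lemma gen_lift:
  assumes e: "e \<in> E"
  shows "gen_lift e \<in> F" "fvec_homogeneous 2 (gen_lift e)" "d1 (gen_lift e) = ebin e"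
proof -
  have "ebin e = (\<Sum>x\<in>E. (if x = e then 1 else 0) * (ebin x :: ('v bvar, 'k) mpoly))"
    using e finE by (simp add: if_distrib[of "\<lambda>x. x * _"] cong: if_cong)
  then have "(ebin e :: ('v bvar, 'k) mpoly) \<in> bideal W E"
    unfolding bideal_def by (intro CollectI exI[of _ "\<lambda>x. if x = e then 1 else 0"]) auto
  then obtain v where v: "v \<in> F" "d1 v = ebin e" using onto by blast
  then have "fcomp 2 v \<in> F \<and> fvec_homogeneous 2 (fcomp 2 v) \<and> d1 (fcomp 2 v) = ebin e"
    using comp[OF v(1), of 2] pcomp_id[OF ebin_phom[of e], of 2] by (simp add: fcomp_fm fcomp_hom)
  then have "gen_lift e \<in> F \<and> fvec_homogeneous 2 (gen_lift e) \<and> d1 (gen_lift e) = ebin e"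
    unfolding gen_lift_def by (rule someI)
  then show "gen_lift e \<in> F" "fvec_homogeneous 2 (gen_lift e)" "d1 (gen_lift e) = ebin e" by blast+
qed

definition lift_sum :: "('v \<times> 'v \<Rightarrow> ('v bvar, 'k) mpoly) \<Rightarrow> ('v bvar, 'k) fvec" where
  "lift_sum c = (\<Sum>e\<in>E. scal (c e) (gen_lift e))"

lemma lift_sum_F: "(\<And>e. e \<in> E \<Longrightarrow> c e \<in> poly_ring W) \<Longrightarrow> lift_sum c \<in> F"
  unfolding lift_sum_def by (intro fm_sum fm_scal gen_lift)

lemma d1_lift_sum: "(\<And>e. e \<in> E \<Longrightarrow> c e \<in> poly_ring W) \<Longrightarrow> d1 (lift_sum c) = (\<Sum>e\<in>E. c e * ebin e)"
  unfolding lift_sum_def using gen_lift by (subst d1_sum) (auto intro!: fm_scal sum.cong simp: scal)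

lemma lift_sum_hom:
  assumes "\<And>e. e \<in> E \<Longrightarrow> poly_homogeneous d (c e)" "k = d + 2"
  shows "fvec_homogeneous k (lift_sum c)"
  unfolding lift_sum_def assms(2) by (intro fhom_sum fhom_scal gen_lift(2) assms(1))

lemma gen_lift_lookup:
  assumes "e \<in> E"
  shows "lookup (gen_lift e) (j, k) =
    (if j = 2 then single 0 (lookup (lookup (gen_lift e) (2, k)) 0) else 0)"
proof -
  consider "j < 2" | "j = 2" | "2 < j" by linarith
  then show ?thesis
  proof cases
    case 1
    then show ?thesis using fm_lookup_0[OF gen_lift(1)[OF assms], of j k] rank_low[OF 1] by simp
  next
    case 2
    then show ?thesis using phom_0_single fhom_lookup[OF gen_lift(2)[OF assms], of 2 k] by force
  next
    case 3
    then show ?thesis using fhom_lookup_low[OF gen_lift(2)[OF assms] 3] by simp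
  qed
qed

text \<open>
  A basis vector of degree above two has the same image as a combination of the lifts. Their
  difference is in the kernel but has the constant coefficient \<open>1\<close>.
\<close>

lemma rank_high:
  assumes "2 < j" shows "r j = 0"
proof (rule ccontr)
  assume "r j \<noteq> 0"
  then have b: "bas (j, 0) \<in> F" by (intro fm_bas) simp
  have "2 \<le> j" using assms by simp
  then obtain c where c: "\<And>e. e \<in> E \<Longrightarrow> c e \<in> hpoly (j - 2) W" "d1 (bas (j, 0)) = (\<Sum>e\<in>E. c e * ebin e)"
    using bideal_homogeneous_element(2)[OF into[OF b] d1_hom[OF b fhom_bas]] by blast
  then have pr: "\<And>e. e \<in> E \<Longrightarrow> c e \<in> poly_ring W" by (simp add: hpoly_def)
  have "d1 (bas (j, 0) - lift_sum c) = 0"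
    using d1_diff[OF b lift_sum_F[OF pr]] d1_lift_sum[OF pr] c(2) by simp
  then have "lookup (lookup (bas (j, 0) - lift_sum c) (j, 0)) 0 = 0"
    by (intro minimal fm_diff b lift_sum_F[OF pr])
  moreover have "lookup (lift_sum c) (j, 0) = 0"
    using assms gen_lift_lookup[of _ j 0] by (simp add: lift_sum_def lookup_sum)
  ultimately show False by (simp add: lookup_minus lookup_bas)
qed

lemma lookup_F:
  assumes "v \<in> F" "j \<noteq> 2"
  shows "lookup v (j, k) = 0"
  using assms rank_low[of j] rank_high[of j] fm_lookup_0[OF assms(1), of j k]
  by (metis linorder_neqE_nat not_less_zero not_le)

text \<open>
  The basis vector and a combination of lifts with the same image differ by an element of the
  kernel; being homogeneous of degree two, it has constant coefficients, which vanish.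
\<close>

lemma basis_lift:
  assumes k: "k < r 2"
  shows "\<exists>c. (\<forall>e\<in>E. c e \<in> hpoly 0 W) \<and> bas (2, k) = lift_sum c"
proof -
  have b: "bas (2, k) \<in> F" by (rule fm_bas) (rule k)
  obtain c where c: "\<And>e. e \<in> E \<Longrightarrow> c e \<in> hpoly 0 W" "d1 (bas (2, k)) = (\<Sum>e\<in>E. c e * ebin e)"
    using bideal_homogeneous_element(2)[OF into[OF b] d1_hom[OF b fhom_bas]] by auto
  then have pr: "\<And>e. e \<in> E \<Longrightarrow> c e \<in> poly_ring W" by (simp add: hpoly_def)
  define x where "x = bas (2, k) - lift_sum c"
  have xF: "x \<in> F" unfolding x_def by (intro fm_diff b lift_sum_F[OF pr])
  have "d1 x = 0" unfolding x_def using d1_diff[OF b lift_sum_F[OF pr]] d1_lift_sum[OF pr] c(2) by simp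
  then have x0: "lookup (lookup x q) 0 = 0" for q using minimal[OF xF] by blast
  have "fvec_homogeneous 2 (lift_sum c)" using c(1) by (intro lift_sum_hom[of 0]) (simp_all add: hpoly_def)
  then have xh: "fvec_homogeneous 2 x" unfolding x_def by (intro fhom_diff fhom_bas)
  have "lookup x (j, k) = 0" for j k
  proof (cases "j = 2")
    case True
    then have "poly_homogeneous 0 (lookup x (j, k))" using fhom_lookup[OF xh, of 2 k] by simp
    then show ?thesis using phom_0_single x0 by (metis single_zero)
  qed (use lookup_F[OF xF] in blast)
  then have "x = 0" by (intro poly_mapping_eqI) auto
  then show ?thesis using c(1) by (intro exI[of _ c]) (auto simp: x_def)
qed

lemma lift_sum_onto:
  assumes w: "w \<in> F" "fvec_homogeneous (d + 2) w"
  shows "\<exists>c. (\<forall>e\<in>E. c e \<in> hpoly d W) \<and> w = lift_sum c"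
proof -
  obtain ck where ck: "\<And>k e. k < r 2 \<Longrightarrow> e \<in> E \<Longrightarrow> ck k e \<in> hpoly 0 W" "\<And>k. k < r 2 \<Longrightarrow> bas (2, k) = lift_sum (ck k)"
    using basis_lift by metis
  define c where "c e = (\<Sum>k<r 2. lookup w (2, k) * ck k e)" for e
  have "c e \<in> hpoly d W" if e: "e \<in> E" for e
    unfolding c_def
  proof (rule mp.subspace_sum[OF hpoly_subspace])
    fix k assume "k \<in> {..<r 2}"
    then have "ck k e \<in> hpoly 0 W" using ck(1) e by simp
    then have "poly_homogeneous (d + 0) (lookup w (2, k) * ck k e)"
      using fhom_lookup[OF w(2), of 2 k] by (intro phom_mult) (auto simp: hpoly_def)
    then show "lookup w (2, k) * ck k e \<in> hpoly d W"
      using \<open>ck k e \<in> hpoly 0 W\<close> fm_lookup[OF w(1)] by (simp add: hpoly_def pr_mult)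
  qed
  moreover have "w = lift_sum c"
  proof -
    have "w = (\<Sum>q\<in>Pair 2 ` {..<r 2}. scal (lookup w q) (bas q))"
    proof (rule fvec_expand)
      show "keys w \<subseteq> Pair 2 ` {..<r 2}"
      proof
        fix q assume q: "q \<in> keys w"
        obtain j k where jk: "q = (j, k)" by (cases q)
        then have nz: "lookup w (j, k) \<noteq> 0" using q by (simp add: in_keys_iff)
        then have "j = 2" using lookup_F[OF w(1)] by blast
        moreover have "k < r j" using nz fm_lookup_0[OF w(1), of j k] by (meson not_le)
        ultimately show "q \<in> Pair 2 ` {..<r 2}" using jk by simp
      qed
    qed simp
    also have "\<dots> = (\<Sum>k<r 2. scal (lookup w (2, k)) (bas (2, k)))"
      by (simp add: sum.reindex inj_on_def)
    also have "\<dots> = (\<Sum>k<r 2. \<Sum>e\<in>E. scal (lookup w (2, k) * ck k e) (gen_lift e))"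
      by (intro sum.cong refl) (simp add: ck(2) lift_sum_def scal_sum_right scal_scal)
    also have "\<dots> = (\<Sum>e\<in>E. \<Sum>k<r 2. scal (lookup w (2, k) * ck k e) (gen_lift e))"
      by (rule sum.swap)
    also have "\<dots> = lift_sum c" by (simp add: lift_sum_def c_def scal_sum_left)
    finally show ?thesis .
  qed
  ultimately show ?thesis by blast
qed

text \<open>
  The lifts have constant coordinates, so a relation between them holds for the coefficients of
  each monomial \<open>\<mu>\<close> separately, and constant coefficients can be compared after applying \<open>d1\<close>.
\<close>

lemma lift_sum_inj:
  assumes "lift_sum c = 0" "e \<in> E"
  shows "c e = 0"
proof (rule poly_mapping_eqI)
  fix \<mu>
  define a where "a e = (single 0 (lookup (c e) \<mu>) :: ('v bvar, 'k) mpoly)" for e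
  have "lift_sum a = 0"
  proof (rule poly_mapping_eqI)
    fix q :: "nat \<times> nat" obtain j k where q: "q = (j, k)" by (cases q)
    have "lookup (lookup (lift_sum a) (2, k)) 0 = (\<Sum>e\<in>E. lookup (c e) \<mu> * lookup (lookup (gen_lift e) (2, k)) 0)"
      by (simp add: lift_sum_def lookup_sum lookup_mult_0 a_def)
    also have "\<dots> = lookup (lookup (lift_sum c) (2, k)) \<mu>"
    proof -
      have "lookup (c e * lookup (gen_lift e) (2, k)) \<mu> = lookup (c e) \<mu> * lookup (lookup (gen_lift e) (2, k)) 0"
        if "e \<in> E" for e
      proof -
        have "c e * lookup (gen_lift e) (2, k) = csc (lookup (lookup (gen_lift e) (2, k)) 0) (c e)"
          using gen_lift_lookup[OF that, of 2 k] by (simp add: csc_def mult.commute)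
        then show ?thesis by (simp add: mult.commute)
      qed
      then show ?thesis by (simp add: lift_sum_def lookup_sum)
    qed
    finally have z: "lookup (lookup (lift_sum a) (2, k)) 0 = 0" using assms(1) by simp
    have aF: "lift_sum a \<in> F" by (intro lift_sum_F) (simp add: a_def)
    have "fvec_homogeneous 2 (lift_sum a)" by (intro lift_sum_hom[of 0]) (simp_all add: a_def phom_single)
    then have "poly_homogeneous 0 (lookup (lift_sum a) (2, k))"
      using fhom_lookup[of 2 "lift_sum a" 2 k] by simp
    then have "lookup (lift_sum a) (2, k) = 0" using phom_0_single z by (metis single_zero)
    then show "lookup (lift_sum a) q = lookup 0 q" using q lookup_F[OF aF, of j k] by (cases "j = 2") auto
  qed
  moreover have "a x \<in> poly_ring W" "poly_homogeneous 0 (a x)" for x by (simp_all add: a_def phom_single)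
  note a = this
  have "d1 (lift_sum a) = (\<Sum>e\<in>E. a e * ebin e)" by (rule d1_lift_sum[OF a(1)])
  ultimately have s: "(\<Sum>e\<in>E. a e * ebin e) = 0" using d1_0 by simp
  have "a e = 0"
    by (rule no_linear_syzygies[OF finE bip _ a(2) s assms(2)]) simp
  then have "lookup (a e) 0 = 0" by simp
  then show "lookup (c e) \<mu> = lookup 0 \<mu>" by (simp add: a_def)
qed

text \<open>
  In degrees two and three a kernel element would be a syzygy with coefficients of degree at
  most one.
\<close>

lemma kernel_low:
  assumes x: "x \<in> F" "fvec_homogeneous d x" "d1 x = 0" "d \<le> 3"
  shows "x = 0"
proof (cases "d < 2")
  case True
  have "lookup x (j, k) = 0" for j k
    using lookup_F[OF x(1), of j k] fhom_lookup_low[OF x(2), of j k] True by (cases "j = 2") auto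
  then show ?thesis by (intro poly_mapping_eqI) auto
next
  case False
  then have d: "d = (d - 2) + 2" by simp
  obtain c where c: "\<And>e. e \<in> E \<Longrightarrow> c e \<in> hpoly (d - 2) W" "x = lift_sum c"
    using lift_sum_onto[OF x(1), of "d - 2"] x(2) d by auto
  have "(\<Sum>e\<in>E. c e * ebin e) = 0" using d1_lift_sum[of c] c x(3) by (simp add: hpoly_def)
  then have "c e = 0" if "e \<in> E" for e
    using that c(1) x(4) by (intro no_linear_syzygies[OF finE bip, of "d - 2" c]) (auto simp: hpoly_def)
  then show ?thesis unfolding c(2) lift_sum_def by simp
qed

lemma kernel_four_has_dim:
  "fv.has_dim {v \<in> F. fvec_homogeneous 4 v \<and> d1 v = 0} (syz_count T E)"
proof -
  have im: "lift_sum ` syz 2 W E = {v \<in> F. fvec_homogeneous 4 v \<and> d1 v = 0}"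
  proof (intro equalityI subsetI)
    fix v assume "v \<in> lift_sum ` syz 2 W E"
    then obtain c where c: "v = lift_sum c" "c \<in> syz 2 W E" by blast
    then have h: "\<And>e. e \<in> E \<Longrightarrow> c e \<in> poly_ring W" "\<And>e. e \<in> E \<Longrightarrow> poly_homogeneous 2 (c e)"
      and s: "(\<Sum>e\<in>E. c e * ebin e) = 0"
      unfolding syz_def hpoly_def by blast+
    have "fvec_homogeneous 4 (lift_sum c)" by (rule lift_sum_hom[OF h(2)]) simp_all
    then show "v \<in> {v \<in> F. fvec_homogeneous 4 v \<and> d1 v = 0}"
      using lift_sum_F[OF h(1)] d1_lift_sum[OF h(1)] s c(1) by simp
  next
    fix v assume v: "v \<in> {v \<in> F. fvec_homogeneous 4 v \<and> d1 v = 0}"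
    then obtain c where c: "\<And>e. e \<in> E \<Longrightarrow> c e \<in> hpoly 2 W" "v = lift_sum c"
      using lift_sum_onto[of v 2] by auto
    define c' where "c' e = (if e \<in> E then c e else 0)" for e
    have eq: "v = lift_sum c'" unfolding c(2) lift_sum_def by (simp add: c'_def)
    have pr: "\<And>e. e \<in> E \<Longrightarrow> c' e \<in> poly_ring W" using c(1) by (auto simp: hpoly_def c'_def)
    have "(\<Sum>e\<in>E. c' e * ebin e) = 0" using d1_lift_sum[of c', OF pr] eq v by simp
    then have "c' \<in> syz 2 W E" unfolding syz_def using c(1) by (simp add: c'_def)
    then show "v \<in> lift_sum ` syz 2 W E" using eq by blast
  qed
  have "fv.has_dim (lift_sum ` syz 2 W E) (syz_count T E)"
  proof (rule vector_space_pair.has_dim_image[OF fun_fvec_pair syz_subspace])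
    show "fam.has_dim (syz 2 W E :: ('v \<times> 'v \<Rightarrow> ('v bvar, 'k) mpoly) set) (syz_count T E)"
      by (rule syz_has_dim[OF finT ET bip])
    show "lift_sum (x + y) = lift_sum x + lift_sum y" for x y
      by (simp add: lift_sum_def scal_add_left sum.distrib)
    show "lift_sum (csf k x) = csv k (lift_sum x)" for k x
      by (simp add: lift_sum_def csf_def csv_def csc_def scal_sum_right scal_scal)
    show "x = 0" if "x \<in> syz 2 W E" "lift_sum x = 0" for x
    proof
      fix e
      have "x e = 0" if "e \<notin> E" using that \<open>x \<in> syz 2 W E\<close> unfolding syz_def by blast
      then show "x e = 0 e" using lift_sum_inj[OF that(2), of e] by (cases "e \<in> E") auto
    qed
  qed
  then show ?thesis unfolding im .
qed

end

subsection \<open>Arbitrary minimal resolutions\<close>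

text \<open>
  The module \<open>F\<^sub>0\<close> has rank one: some basis vector is mapped to a unit, and any other one could be
  reduced by it to a kernel element with a constant coefficient \<open>1\<close>. So \<open>F\<^sub>1\<close> is a minimal
  cover of the ideal. Its kernel vanishes in degrees below four, hence so do the ranks of \<open>F\<^sub>2\<close>,
  and in degree four the second map is injective on the constant vectors.
\<close>

lemma resolution_betti_2_4:
  fixes \<epsilon> :: "('v bvar, 'k::field) fvec \<Rightarrow> ('v bvar, 'k) mpoly"
  assumes fT: "finite T" and ET: "E \<subseteq> T \<times> T" and bip: "bip E"
    and res: "minimal_graded_free_resolution (bvars T) (bideal (bvars T) E) b \<epsilon> \<delta>"
  shows "b 2 4 = syz_count T E"
proof -
  let ?W = "bvars T" and ?J = "bideal (bvars T) E :: ('v bvar, 'k) mpoly set"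
  let ?F = "\<lambda>i. free_module (bvars T) (b i) :: ('v bvar, 'k) fvec set"
  note J = bideal_homogeneous_ideal[OF ET, where 'k = 'k, unfolded homogeneous_ideal_def]
  have J0: "0 \<in> ?J" by (rule J[THEN conjunct2, THEN conjunct1])
  have JW: "?J \<subseteq> poly_ring ?W" by (rule J[THEN conjunct1])
  have "\<forall>c\<in>poly_ring ?W. \<forall>p\<in>?J. c * p \<in> ?J"
    by (rule J[THEN conjunct2, THEN conjunct2, THEN conjunct2, THEN conjunct1])
  then have Jm: "c * p \<in> ?J" if "c \<in> poly_ring ?W" "p \<in> ?J" for c p using that by simp
  note r = res[unfolded minimal_graded_free_resolution_def]
  have eh: "graded_hom_to_ring ?W (b 0) \<epsilon>" using r by (elim conjE)
  have eps: "\<epsilon> (v + w) = \<epsilon> v + \<epsilon> w" "c \<in> poly_ring ?W \<Longrightarrow> \<epsilon> (scal c v) = c * \<epsilon> v" "\<epsilon> v \<in> poly_ring ?W"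
    "fvec_homogeneous d v \<Longrightarrow> poly_homogeneous d (\<epsilon> v)"
    if "v \<in> ?F 0" "w \<in> ?F 0" for v w c d
    using eh that unfolding graded_hom_to_ring_def by simp_all
  have hom: "graded_hom ?W (b (Suc i)) (b i) (\<delta> (Suc i))" for i using r by simp
  have surj: "\<exists>v\<in>?F 0. \<epsilon> v - s \<in> ?J" if "s \<in> poly_ring ?W" for s using r that by simp
  have ex0: "{v \<in> ?F 0. \<epsilon> v \<in> ?J} = \<delta> 1 ` ?F 1" using r by (elim conjE)
  have ex: "i \<ge> 1 \<Longrightarrow> {v \<in> ?F i. \<delta> i v = 0} = \<delta> (Suc i) ` ?F (Suc i)" for i using r by simp
  have mini: "v \<in> ?F (Suc i) \<Longrightarrow> lookup (lookup (\<delta> (Suc i) v) p) 0 = 0" for i v p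
    using r by (elim conjE) blast
  have min0: "lookup (lookup v p) 0 = 0" if "v \<in> ?F 0" "\<epsilon> v \<in> ?J" for v p
  proof -
    have "v \<in> \<delta> 1 ` ?F 1" unfolding ex0[symmetric] using that by simp
    then obtain u where "v = \<delta> 1 u" "u \<in> ?F 1" by (rule imageE)
    then show ?thesis using mini[of u 0] by simp
  qed
  have minK: "lookup (lookup v p) 0 = 0" if "v \<in> ?F (Suc i)" "\<delta> (Suc i) v = 0" for v p i
  proof -
    have "v \<in> {v \<in> ?F (Suc i). \<delta> (Suc i) v = 0}" using that by simp
    then have "v \<in> \<delta> (Suc (Suc i)) ` ?F (Suc (Suc i))" using ex[of "Suc i"] by simp
    then obtain u where "v = \<delta> (Suc (Suc i)) u" "u \<in> ?F (Suc (Suc i))" by (rule imageE)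
    then show ?thesis using mini[of u "Suc i"] by simp
  qed

  have eps_sum: "\<epsilon> (sum h A) = (\<Sum>x\<in>A. \<epsilon> (h x))" if "\<And>x. x \<in> A \<Longrightarrow> h x \<in> ?F 0" for h and A :: "(nat \<times> nat) set"
    using that
  proof (induct A rule: infinite_finite_induct)
    case (insert x A)
    then have "sum h A \<in> ?F 0" by (intro fm_sum) auto
    then show ?case using insert eps(1) by simp
  qed (use eps(1)[of 0 0] in auto)
  \<comment> \<open>The constant term of a preimage of \<open>1\<close> exhibits a basis vector \<open>q0\<close> with invertible image \<open>\<gamma>\<close>.\<close>
  obtain v1 where v1: "v1 \<in> ?F 0" "\<epsilon> v1 - 1 \<in> ?J" using surj[of 1] by auto
  have basF: "bas q \<in> ?F 0" if "q \<in> keys v1" for q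
  proof -
    obtain j k where q: "q = (j, k)" by (cases q)
    then have "k < b 0 j" using that fm_lookup_0[OF v1(1), of j k] by (auto simp: in_keys_iff not_le[symmetric])
    then show ?thesis unfolding q by (rule fm_bas)
  qed
  have "lookup (\<epsilon> v1 - 1) 0 = 0" by (rule bideal_const[OF v1(2)])
  then have one: "lookup (\<epsilon> v1) 0 = 1" by (simp add: lookup_minus)
  have "v1 = (\<Sum>q\<in>keys v1. scal (lookup v1 q) (bas q))" by (rule fvec_expand) auto
  then have "\<epsilon> v1 = \<epsilon> (\<Sum>q\<in>keys v1. scal (lookup v1 q) (bas q))" by (rule arg_cong)
  also have "\<dots> = (\<Sum>q\<in>keys v1. \<epsilon> (scal (lookup v1 q) (bas q)))"
    by (intro eps_sum fm_scal fm_lookup[OF v1(1)] basF)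
  also have "\<dots> = (\<Sum>q\<in>keys v1. lookup v1 q * \<epsilon> (bas q))"
    by (intro sum.cong refl eps(2)[OF basF basF] fm_lookup[OF v1(1)])
  finally have "lookup (\<epsilon> v1) 0 = (\<Sum>q\<in>keys v1. lookup (lookup v1 q) 0 * lookup (\<epsilon> (bas q)) 0)"
    by (simp add: lookup_sum lookup_mult_0)
  then have "\<exists>q0\<in>keys v1. lookup (\<epsilon> (bas q0)) 0 \<noteq> 0"
    using one sum.neutral[of "keys v1" "\<lambda>q. lookup (lookup v1 q) 0 * lookup (\<epsilon> (bas q)) 0"] by fastforce
  then obtain q0 where q0: "q0 \<in> keys v1" "lookup (\<epsilon> (bas q0)) 0 \<noteq> 0" by blast
  define \<gamma> where "\<gamma> = lookup (\<epsilon> (bas q0)) 0"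
  have bq0: "bas q0 \<in> ?F 0" by (rule basF[OF q0(1)])
  have "poly_homogeneous (fst q0) (\<epsilon> (bas q0))"
    using eps(4)[OF bq0 bq0] fhom_bas[of "fst q0" "snd q0"] by simp
  then have fst0: "fst q0 = 0" and eg: "\<epsilon> (bas q0) = single 0 \<gamma>"
  proof -
    assume h: "poly_homogeneous (fst q0) (\<epsilon> (bas q0))"
    show "fst q0 = 0" using phomD[OF h q0(2)] by simp
    then show "\<epsilon> (bas q0) = single 0 \<gamma>" using h phom_0_single unfolding \<gamma>_def by metis
  qed
  have only: "(j, k) = q0" if k: "k < b 0 j" for j k
  proof (rule ccontr)
    assume ne: "(j, k) \<noteq> q0"
    have bF: "bas (j, k) \<in> ?F 0" by (rule fm_bas) (rule k)
    define c where "c = \<epsilon> (bas (j, k)) * single 0 (1 / \<gamma>)"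
    have c: "c \<in> poly_ring ?W" unfolding c_def by (intro pr_mult eps(3)[OF bF bF]) simp
    have u: "scal (- c) (bas q0) \<in> ?F 0" by (intro fm_scal pr_uminus c bq0)
    have "\<epsilon> (bas (j, k) + scal (- c) (bas q0)) = \<epsilon> (bas (j, k)) - c * single 0 \<gamma>"
      using eps(1)[OF bF u] eps(2)[OF bq0 bq0 pr_uminus[OF c]] eg by simp
    also have "\<dots> = 0" using q0(2) by (simp add: c_def mult.assoc mult_single \<gamma>_def)
    finally have "\<epsilon> (bas (j, k) + scal (- c) (bas q0)) \<in> ?J" using J0 by simp
    then have "lookup (lookup (bas (j, k) + scal (- c) (bas q0)) (j, k)) 0 = 0"
      by (intro min0 fm_add bF u)
    then show False using ne by (simp add: lookup_add lookup_bas)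
  qed
  have "snd q0 < b 0 0"
  proof (rule ccontr)
    assume "\<not> snd q0 < b 0 0"
    then have "lookup (bas q0 :: ('v bvar, 'k) fvec) (0, snd q0) = 0" by (intro fm_lookup_0[OF bq0]) simp
    moreover have "q0 = (0, snd q0)" using fst0 by (metis prod.collapse)
    ultimately show False by (simp add: lookup_bas)
  qed
  then have q00: "q0 = (0, 0)" using only[of 0 0] by simp
  have F0: "v = scal (lookup v (0, 0)) (bas (0, 0))" if v: "v \<in> ?F 0" for v
  proof (rule poly_mapping_eqI)
    fix q :: "nat \<times> nat" obtain j k where q: "q = (j, k)" by (cases q)
    show "lookup v q = lookup (scal (lookup v (0, 0)) (bas (0, 0))) q"
      using only[of k j] fm_lookup_0[OF v, of j k] q q00 by (cases "k < b 0 j") (auto simp: lookup_bas)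
  qed
  have eps_eq: "\<epsilon> v = lookup v (0, 0) * single 0 \<gamma>" if v: "v \<in> ?F 0" for v
    using F0[OF v] eps(2)[OF bq0 bq0 fm_lookup[OF v]] eg unfolding q00 by metis
  have inv: "p \<in> ?J" if "p * single 0 \<gamma> \<in> ?J" for p
  proof -
    have "single 0 (1 / \<gamma>) * (p * single 0 \<gamma>) \<in> ?J"
      by (rule Jm[OF pr_const that])
    then show ?thesis using q0(2) by (simp add: mult.left_commute mult_single \<gamma>_def)
  qed

  have d1: "\<delta> 1 v \<in> ?F 0" if "v \<in> ?F 1" for v using graded_homD(1)[OF hom[of 0]] that by simp
  have d1_zero: "\<delta> 1 v = 0" if "v \<in> ?F 1" "lookup (\<delta> 1 v) (0, 0) = 0" for v
    using F0[OF d1[OF that(1)]] that(2) by simp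
  \<comment> \<open>As \<open>\<epsilon>\<close> is multiplication by \<open>\<gamma>\<close>, the coordinate of \<open>\<delta> 1 v\<close> runs through the ideal.\<close>
  interpret minimal_ideal_cover T E "b 1" "\<lambda>v. lookup (\<delta> 1 v) (0, 0)"
  proof
    show "finite T" "E \<subseteq> T \<times> T" "bip E" by (fact fT ET bip)+
    fix v w :: "('v bvar, 'k) fvec" and c :: "('v bvar, 'k) mpoly" and d assume v: "v \<in> ?F 1"
    show "w \<in> ?F 1 \<Longrightarrow> lookup (\<delta> 1 (v + w)) (0, 0) = lookup (\<delta> 1 v) (0, 0) + lookup (\<delta> 1 w) (0, 0)"
      using graded_homD(2)[OF hom[of 0]] v by (simp add: lookup_add)
    show "c \<in> poly_ring ?W \<Longrightarrow> lookup (\<delta> 1 (scal c v)) (0, 0) = c * lookup (\<delta> 1 v) (0, 0)"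
      using graded_homD(3)[OF hom[of 0]] v by simp
    show "lookup (\<delta> 1 (fcomp d v)) (0, 0) = pcomp d (lookup (\<delta> 1 v) (0, 0))"
      using graded_hom_fcomp[OF hom[of 0], of v d] v by (simp add: lookup_fcomp)
    show "lookup (\<delta> 1 v) (0, 0) \<in> ?J"
    proof (rule inv)
      have "\<delta> 1 v \<in> {v \<in> ?F 0. \<epsilon> v \<in> ?J}" unfolding ex0 using v by (rule imageI)
      then show "lookup (\<delta> 1 v) (0, 0) * single 0 \<gamma> \<in> ?J" using eps_eq[OF d1[OF v]] by simp
    qed
    show "lookup (\<delta> 1 v) (0, 0) = 0 \<Longrightarrow> lookup (lookup v q) 0 = 0" for q
      using minK[of v 0] d1_zero[OF v] v by simp
  next
    fix p :: "('v bvar, 'k) mpoly" assume p: "p \<in> ?J"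
    have pW: "p \<in> poly_ring ?W" using p JW by (rule subsetD[rotated])
    have "\<epsilon> (scal p (bas (0, 0))) = single 0 \<gamma> * p"
      using eps(2)[OF bq0 bq0 pW] eg q00 by (simp add: mult.commute)
    then have "\<epsilon> (scal p (bas (0, 0))) \<in> ?J" using Jm[OF pr_const p] by simp
    moreover have "scal p (bas (0, 0)) \<in> ?F 0" using bq0 q00 by (intro fm_scal pW) simp
    ultimately have "scal p (bas (0, 0)) \<in> \<delta> 1 ` ?F 1" unfolding ex0[symmetric] by simp
    then obtain v where v: "v \<in> ?F 1" "scal p (bas (0, 0)) = \<delta> 1 v" by (rule imageE)
    have "lookup (\<delta> 1 v) (0, 0) = p" unfolding v(2)[symmetric] by (simp add: lookup_bas)
    then show "\<exists>v\<in>?F 1. lookup (\<delta> 1 v) (0, 0) = p" using v(1) by (rule bexI)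
  qed

  have hom2: "graded_hom ?W (b 2) (b 1) (\<delta> 2)" using hom[of 1] by (simp add: numeral_2_eq_2)
  have ex1: "{v \<in> ?F 1. \<delta> 1 v = 0} = \<delta> 2 ` ?F 2" using ex[of 1] by (simp add: numeral_2_eq_2)
  have mink2: "lookup (lookup v p) 0 = 0" if "v \<in> ?F 2" "\<delta> 2 v = 0" for v p
    using minK[of v 1 p] that by (simp add: numeral_2_eq_2)
  have ker1: "\<delta> 2 v \<in> ?F 1 \<and> \<delta> 1 (\<delta> 2 v) = 0" if "v \<in> ?F 2" for v
  proof -
    have "\<delta> 2 v \<in> {v \<in> ?F 1. \<delta> 1 v = 0}" unfolding ex1 using that by (rule imageI)
    then show ?thesis by simp
  qed
  have low: "b 2 j = 0" if "j \<le> 3" for j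
  proof (rule ccontr)
    assume "b 2 j \<noteq> 0"
    then have bF: "bas (j, 0) \<in> ?F 2" by (intro fm_bas) simp
    have "\<delta> 2 (bas (j, 0)) = 0"
      using ker1[OF bF] graded_homD(4)[OF hom2 bF fhom_bas] that
      by (intro kernel_low[of _ j]) auto
    then show False using mink2[OF bF, of "(j, 0)"] by (simp add: lookup_bas)
  qed
  \<comment> \<open>The degree four part of \<open>F\<^sub>2\<close> consists of constant vectors, and \<open>\<delta> 2\<close> maps it onto the quadratic syzygies.\<close>
  define D where "D = {v \<in> ?F 2. fvec_homogeneous 4 v}"
  have Dsub: "fv.subspace D" using hpart_subspace[OF fm_subspace] unfolding D_def hpart_def .
  have Dsep: "v = 0" if v: "v \<in> D" and z: "\<And>k. k < b 2 4 \<Longrightarrow> lookup (lookup v (4, k)) 0 = 0" for v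
  proof (rule poly_mapping_eqI)
    fix q :: "nat \<times> nat" obtain j k where q: "q = (j, k)" by (cases q)
    have vF: "v \<in> ?F 2" "fvec_homogeneous 4 v" using v by (auto simp: D_def)
    consider "j \<le> 3" | "j > 4" | "j = 4" "k \<ge> b 2 4" | "j = 4" "k < b 2 4" by linarith
    then have "lookup v (j, k) = 0"
    proof cases
      case 4
      then have "poly_homogeneous 0 (lookup v (j, k))" using fhom_lookup[OF vF(2), of 4 k] by simp
      then show ?thesis using phom_0_single z[OF 4(2)] 4(1) by (metis single_zero)
    qed (use low fm_lookup_0[OF vF(1), of j k] fhom_lookup_low[OF vF(2), of j k] in auto)
    then show "lookup v q = lookup 0 q" using q by simp
  qed
  have "fv.has_dim D (card {..<b 2 4})"
  proof (rule fv.has_dim_dual_family[where g = "\<lambda>k. bas (4, k)" and \<phi> = "\<lambda>k v. lookup (lookup v (4, k)) 0"])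
    show "bas (4, i) \<in> D" if "i \<in> {..<b 2 4}" for i using that by (simp add: D_def fm_bas fhom_bas)
    show "v = 0" if "v \<in> D" "\<And>i. i \<in> {..<b 2 4} \<Longrightarrow> lookup (lookup v (4, i)) 0 = 0" for v
      using Dsep that by auto
  qed (auto simp: Dsub lookup_add lookup_bas)
  then have "fv.has_dim (\<delta> 2 ` D) (b 2 4)"
  proof (intro vector_space_pair.has_dim_image[OF fvec_pair Dsub])
    fix x y c assume x: "x \<in> D"
    show "y \<in> D \<Longrightarrow> \<delta> 2 (x + y) = \<delta> 2 x + \<delta> 2 y" using x graded_homD(2)[OF hom2] by (simp add: D_def)
    show "\<delta> 2 (csv c x) = csv c (\<delta> 2 x)" using x graded_homD(3)[OF hom2] by (simp add: D_def csv_def)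
    show "\<delta> 2 x = 0 \<Longrightarrow> x = 0" using Dsep[OF x] mink2[of x] x by (simp add: D_def)
  qed simp
  moreover have "\<delta> 2 ` D = {v \<in> ?F 1. fvec_homogeneous 4 v \<and> lookup (\<delta> 1 v) (0, 0) = 0}"
  proof (intro equalityI subsetI)
    fix v assume "v \<in> \<delta> 2 ` D"
    then obtain w where w: "v = \<delta> 2 w" "w \<in> ?F 2" "fvec_homogeneous 4 w" by (auto simp: D_def)
    then show "v \<in> {v \<in> ?F 1. fvec_homogeneous 4 v \<and> lookup (\<delta> 1 v) (0, 0) = 0}"
      using ker1[OF w(2)] graded_homD(4)[OF hom2 w(2,3)] by simp
  next
    fix v assume v: "v \<in> {v \<in> ?F 1. fvec_homogeneous 4 v \<and> lookup (\<delta> 1 v) (0, 0) = 0}"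
    then have "v \<in> \<delta> 2 ` ?F 2" unfolding ex1[symmetric] using d1_zero by simp
    then obtain w where w: "v = \<delta> 2 w" "w \<in> ?F 2" by (rule imageE)
    have "v = fcomp 4 v" using v fcomp_id[of 4 v 4] by simp
    also have "\<dots> = \<delta> 2 (fcomp 4 w)" using w graded_hom_fcomp[OF hom2] by simp
    finally show "v \<in> \<delta> 2 ` D" using w(2) by (auto simp: D_def fcomp_hom fcomp_fm)
  qed
  ultimately show ?thesis using kernel_four_has_dim fv.has_dim_unique by metis
qed

text \<open>
  Existence and the value for every minimal resolution determine the definite description.
\<close>

theorem graded_betti_bideal:
  assumes fT: "finite T" and ET: "E \<subseteq> T \<times> T" and bip: "bip E"
  shows "graded_betti (bvars T) (bideal (bvars T) E :: ('v bvar, 'k::field) mpoly set) 2 4 = syz_count T E"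
  unfolding graded_betti_def
proof (rule the_equality)
  have "finite (bvars T)" using fT by (simp add: bvars_def)
  then obtain b \<epsilon> \<delta> where res: "minimal_graded_free_resolution (bvars T) (bideal (bvars T) E :: ('v bvar, 'k) mpoly set) b \<epsilon> \<delta>"
    using minimal_resolution_exists[OF _ bideal_homogeneous_ideal[OF ET], where 'k = 'k] bideal_const by blast
  then show "\<exists>b \<epsilon> \<delta>. minimal_graded_free_resolution (bvars T) (bideal (bvars T) E :: ('v bvar, 'k) mpoly set) b \<epsilon> \<delta>
      \<and> syz_count T E = b 2 4"
    using resolution_betti_2_4[OF fT ET bip res] by metis
next
  fix n assume "\<exists>b \<epsilon> \<delta>. minimal_graded_free_resolution (bvars T) (bideal (bvars T) E :: ('v bvar, 'k) mpoly set) b \<epsilon> \<delta>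
      \<and> n = b 2 4"
  then show "n = syz_count T E" using resolution_betti_2_4[OF fT ET bip] by metis
qed

section \<open>The graph\<close>

definition oriented_edges :: "nat \<Rightarrow> (gvertex \<times> gvertex) set" where
  "oriented_edges n = {(U i, V j) | i j. i < n \<and> j < n \<and> j \<noteq> i \<and> Suc j mod n \<noteq> i}"

definition pred_mod :: "nat \<Rightarrow> nat \<Rightarrow> nat" where
  "pred_mod n i = (if i = 0 then n - 1 else i - 1)"

text \<open>
  The vertex \<open>u\<^sub>i\<close> is not adjacent to \<open>v\<^sub>j\<close> for \<open>j = i\<close> and for the cyclic predecessor \<open>j\<close> of \<open>i\<close>.
\<close>

lemma Suc_mod_eq_iff: "i < n \<Longrightarrow> j < n \<Longrightarrow> Suc j mod n = i \<longleftrightarrow> j = pred_mod n i"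
  by (cases "Suc j = n") (auto simp: pred_mod_def)

lemma edges_G_graph:
  "edges (G_graph n) = {{a, b} | a b. (a, b) \<in> oriented_edges n}"
proof -
  have c: "[int j = int i] (mod int n) \<longleftrightarrow> j = i" "[int j = int i - 1] (mod int n) \<longleftrightarrow> Suc j mod n = i"
    if "i < n" "j < n" for i j
  proof -
    show "[int j = int i] (mod int n) \<longleftrightarrow> j = i"
      unfolding cong_int_iff cong_def using that by simp
    have "[int j = int i - 1] (mod int n) \<longleftrightarrow> [int j + 1 = int i - 1 + 1] (mod int n)"
      by (simp only: cong_add_rcancel)
    also have "\<dots> \<longleftrightarrow> [int (Suc j) = int i] (mod int n)" by (simp add: add.commute)
    also have "\<dots> \<longleftrightarrow> [Suc j = i] (mod n)" by (rule cong_int_iff)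
    also have "\<dots> \<longleftrightarrow> Suc j mod n = i" unfolding cong_def using that by simp
    finally show "[int j = int i - 1] (mod int n) \<longleftrightarrow> Suc j mod n = i" .
  qed
  have "edges (G_graph n) = {{U i, V j} | i j. i < n \<and> j < n \<and> j \<noteq> i \<and> Suc j mod n \<noteq> i}"
  proof -
    have "(i < n \<and> j < n \<and> [int j \<noteq> int i] (mod int n) \<and> [int j \<noteq> int i - 1] (mod int n)) =
      (i < n \<and> j < n \<and> j \<noteq> i \<and> Suc j mod n \<noteq> i)" for i j
      using c by blast
    then show ?thesis unfolding G_graph_def by (simp only: graph.select_convs)
  qed
  also have "\<dots> = {{a, b} | a b. (a, b) \<in> oriented_edges n}"
  proof (intro equalityI subsetI)
    fix x assume "x \<in> {{U i, V j} | i j. i < n \<and> j < n \<and> j \<noteq> i \<and> Suc j mod n \<noteq> i}"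
    then obtain i j where "x = {U i, V j}" "(U i, V j) \<in> oriented_edges n"
      unfolding oriented_edges_def by blast
    then show "x \<in> {{a, b} | a b. (a, b) \<in> oriented_edges n}" by blast
  next
    fix x assume "x \<in> {{a, b} | a b. (a, b) \<in> oriented_edges n}"
    then obtain a b where "x = {a, b}" "(a, b) \<in> oriented_edges n" by blast
    then show "x \<in> {{U i, V j} | i j. i < n \<and> j < n \<and> j \<noteq> i \<and> Suc j mod n \<noteq> i}"
      unfolding oriented_edges_def by auto
  qed
  finally show ?thesis .
qed

lemma oriented_edges_bip: "bip (oriented_edges n)"
  by (auto simp: bip_def oriented_edges_def)

lemma oriented_edges_sub: "oriented_edges n \<subseteq> verts (G_graph n) \<times> verts (G_graph n)"
  by (auto simp: oriented_edges_def G_graph_def)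

text \<open>
  The generating set of the ideal contains both \<open>f\<^sub>a\<^sub>b\<close> and \<open>f\<^sub>b\<^sub>a = - f\<^sub>a\<^sub>b\<close> for each edge; one of
  them suffices.
\<close>

lemma binomial_edge_ideal_eq:
  assumes G: "edges G = {{a, b} | a b. (a, b) \<in> E}" and sub: "E \<subseteq> verts G \<times> verts G" and fin: "finite E"
  shows "(binomial_edge_ideal G :: ('v bvar, 'k::field) mpoly set) = bideal (bvars (verts G)) E"
proof -
  let ?W = "bvars (verts G)"
  let ?A = "{mvar (Xvar a) * mvar (Yvar b) - mvar (Xvar b) * mvar (Yvar a) | a b. {a, b} \<in> edges G} :: ('v bvar, 'k) mpoly set"
  let ?J = "bideal ?W E :: ('v bvar, 'k) mpoly set"
  have J: "homogeneous_ideal ?W ?J" by (rule bideal_homogeneous_ideal[OF sub])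
  have Jadd: "\<And>p q. p \<in> ?J \<Longrightarrow> q \<in> ?J \<Longrightarrow> p + q \<in> ?J" and J0: "0 \<in> ?J"
    and Jm: "\<And>c p. c \<in> poly_ring ?W \<Longrightarrow> p \<in> ?J \<Longrightarrow> c * p \<in> ?J"
    using J unfolding homogeneous_ideal_def by simp_all
  have Jsum: "sum f B \<in> ?J" if "\<And>x. x \<in> B \<Longrightarrow> f x \<in> ?J" for f and B :: "('v bvar, 'k) mpoly set"
    using that by (induct B rule: infinite_finite_induct) (auto simp: J0 Jadd)
  have g: "ebin e \<in> ?J" if "e \<in> E" for e
  proof -
    have "ebin e = (\<Sum>x\<in>E. (if x = e then 1 else 0) * (ebin x :: ('v bvar, 'k) mpoly))"
      using that fin by (simp add: if_distrib[of "\<lambda>x. x * _"] cong: if_cong)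
    then show ?thesis unfolding bideal_def by (intro CollectI exI[of _ "\<lambda>x. if x = e then 1 else 0"]) auto
  qed
  have A: "x \<in> ?J" if "x \<in> ?A" for x
  proof -
    obtain a b where x: "x = ebin (a, b)" and "{a, b} \<in> edges G" using \<open>x \<in> ?A\<close> by (auto simp: ebin_def)
    then obtain c d where "{a, b} = {c, d}" "(c, d) \<in> E" unfolding G by blast
    then consider "(a, b) \<in> E" | "(b, a) \<in> E" by (auto simp: doubleton_eq_iff)
    then show ?thesis
    proof cases
      case 2
      have "x = (- 1) * ebin (b, a)" by (simp add: x ebin_def)
      moreover have "- 1 \<in> (poly_ring ?W :: ('v bvar, 'k) mpoly set)" by (rule pr_uminus) simp
      ultimately show ?thesis using Jm g[OF 2] by blast
    qed (use g x in blast)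
  qed
  have W: "edge_ring_vars G = ?W" by (simp add: edge_ring_vars_def bvars_def)
  show ?thesis unfolding binomial_edge_ideal_def W
  proof (intro equalityI subsetI)
    fix p :: "('v bvar, 'k) mpoly" assume "p \<in> ideal_generated ?W ?A"
    then obtain B c where p: "p = (\<Sum>a\<in>B. c a * a)" "B \<subseteq> ?A" "\<forall>a\<in>B. c a \<in> poly_ring ?W"
      unfolding ideal_generated_def by blast
    have "c x * x \<in> ?J" if "x \<in> B" for x by (rule Jm[OF bspec[OF p(3) that] A[OF subsetD[OF p(2) that]]])
    then show "p \<in> ?J" unfolding p(1) by (rule Jsum)
  next
    fix p :: "('v bvar, 'k) mpoly" assume "p \<in> ?J"
    then obtain c where p: "p = (\<Sum>e\<in>E. c e * ebin e)" and c: "\<forall>e\<in>E. c e \<in> poly_ring ?W"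
      unfolding bideal_def by blast
    define f where "f = (ebin :: 'v \<times> 'v \<Rightarrow> ('v bvar, 'k) mpoly)"
    have "p = (\<Sum>a\<in>f ` E. \<Sum>e\<in>{e \<in> E. f e = a}. c e * f e)"
      unfolding p f_def[symmetric] by (rule sum.image_gen[OF fin])
    also have "\<dots> = (\<Sum>a\<in>f ` E. (\<Sum>e\<in>{e \<in> E. f e = a}. c e) * a)"
      by (simp add: sum_distrib_right)
    finally have eq: "p = (\<Sum>a\<in>f ` E. (\<Sum>e\<in>{e \<in> E. f e = a}. c e) * a)" .
    have sA: "f ` E \<subseteq> ?A"
    proof
      fix x :: "('v bvar, 'k) mpoly" assume "x \<in> f ` E"
      then obtain a b where "x = ebin (a, b)" "(a, b) \<in> E" unfolding f_def by auto
      then show "x \<in> ?A" unfolding G ebin_def by auto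
    qed
    show "p \<in> ideal_generated ?W ?A"
      unfolding ideal_generated_def
      using eq sA fin c
      by (intro CollectI exI[of _ "f ` E"] exI[of _ "\<lambda>a. \<Sum>e\<in>{e \<in> E. f e = a}. c e"])
        (auto intro!: pr_sum)
  qed
qed

subsection \<open>Degrees\<close>

lemma neighbours_U:
  assumes "i < n"
  shows "{d. (U i, d) \<in> oriented_edges n} = V ` ({..<n} - {i, pred_mod n i})"
  using assms Suc_mod_eq_iff[of i n] by (auto simp: oriented_edges_def)

lemma neighbours_V:
  assumes "j < n"
  shows "{c. (c, V j) \<in> oriented_edges n} = U ` ({..<n} - {j, Suc j mod n})"
  using assms by (auto simp: oriented_edges_def)

lemma pred_mod_less: "i < n \<Longrightarrow> pred_mod n i < n"
  by (auto simp: pred_mod_def)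

lemma card_neighbours_U:
  assumes "i < n" "2 \<le> n"
  shows "card {d. (U i, d) \<in> oriented_edges n} = n - 2"
proof -
  have "i \<noteq> pred_mod n i" using assms by (auto simp: pred_mod_def)
  then have "card ({..<n} - {i, pred_mod n i}) = n - 2"
    using assms pred_mod_less[OF assms(1)] by (subst card_Diff_subset) auto
  then show ?thesis unfolding neighbours_U[OF assms(1)] by (simp add: card_image inj_on_def)
qed

lemma card_neighbours_V:
  assumes "j < n" "2 \<le> n"
  shows "card {c. (c, V j) \<in> oriented_edges n} = n - 2"
proof -
  have "j \<noteq> Suc j mod n" "Suc j mod n < n" using assms by (cases "Suc j = n"; auto)+
  then have "card ({..<n} - {j, Suc j mod n}) = n - 2"
    using assms by (subst card_Diff_subset) auto
  then show ?thesis unfolding neighbours_V[OF assms(1)] by (simp add: card_image inj_on_def)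
qed

lemma card_oriented_edges:
  assumes "2 \<le> n"
  shows "card (oriented_edges n) = n * (n - 2)"
proof -
  have eq: "oriented_edges n = (SIGMA a:U ` {..<n}. {d. (a, d) \<in> oriented_edges n})"
    by (auto simp: oriented_edges_def)
  have "card (oriented_edges n) = (\<Sum>a\<in>U ` {..<n}. card {d. (a, d) \<in> oriented_edges n})"
    by (subst eq, rule card_SigmaI) (auto simp: neighbours_U)
  also have "\<dots> = (\<Sum>i<n. n - 2)"
    using assms by (subst sum.reindex) (auto simp: inj_on_def card_neighbours_U)
  finally show ?thesis by simp
qed

lemma degree_sum:
  assumes "2 \<le> n"
  shows "(\<Sum>v\<in>verts (G_graph n). (card {d. (v, d) \<in> oriented_edges n} choose 3)
      + (card {c. (c, v) \<in> oriented_edges n} choose 3)) = 2 * n * ((n - 2) choose 3)"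
proof -
  have 0: "{c. (c, U i) \<in> oriented_edges n} = {}" "{d. (V i, d) \<in> oriented_edges n} = {}" for i
    by (auto simp: oriented_edges_def)
  have z: "(0::nat) choose 3 = 0" by (simp add: binomial_eq_0)
  have "(\<Sum>v\<in>verts (G_graph n). (card {d. (v, d) \<in> oriented_edges n} choose 3)
      + (card {c. (c, v) \<in> oriented_edges n} choose 3)) =
    (\<Sum>v\<in>U ` {..<n}. (card {d. (v, d) \<in> oriented_edges n} choose 3)
      + (card {c. (c, v) \<in> oriented_edges n} choose 3)) +
    (\<Sum>v\<in>V ` {..<n}. (card {d. (v, d) \<in> oriented_edges n} choose 3)
      + (card {c. (c, v) \<in> oriented_edges n} choose 3))"
    unfolding G_graph_def by (subst sum.union_disjoint[symmetric]) auto
  also have "(\<Sum>v\<in>U ` {..<n}. (card {d. (v, d) \<in> oriented_edges n} choose 3)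
      + (card {c. (c, v) \<in> oriented_edges n} choose 3)) = n * ((n - 2) choose 3)"
    using assms by (subst sum.reindex) (auto simp: inj_on_def card_neighbours_U 0 z)
  also have "(\<Sum>v\<in>V ` {..<n}. (card {d. (v, d) \<in> oriented_edges n} choose 3)
      + (card {c. (c, v) \<in> oriented_edges n} choose 3)) = n * ((n - 2) choose 3)"
    using assms by (subst sum.reindex) (auto simp: inj_on_def card_neighbours_V 0 z)
  finally show ?thesis by simp
qed

subsection \<open>Four-cycles\<close>

lemma edges_cycle_4: "edges (cycle_graph 4) = {{0, 1}, {1, 2}, {2, 3}, {3, 0}}"
proof -
  have "{i. i < (4::nat)} = {0, 1, 2, 3}" by auto
  moreover have "(1 + 1) mod 4 = (2 :: nat)" "(2 + 1) mod 4 = (3 :: nat)" "(3 + 1) mod 4 = (0 :: nat)"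
    "(0 + 1) mod 4 = (1 :: nat)" by simp_all
  moreover have "edges (cycle_graph 4) = (\<lambda>i. {i, (i + 1) mod 4}) ` {i. i < (4::nat)}"
    by (auto simp: cycle_graph_def)
  ultimately show ?thesis by (simp only: image_insert image_empty)
qed

text \<open>
  Going around the cycle, the vertices alternate between the two sides. Conversely, two vertices
  on each side span no further edges.
\<close>

lemma induced_four_cycle_iff:
  assumes G: "edges G = {{a, b} | a b. (a, b) \<in> E}" and sub: "E \<subseteq> verts G \<times> verts G" and bip: "bip E"
  shows "W \<in> induced_four_cycles G \<longleftrightarrow> (\<exists>A B. (A, B) \<in> quads E \<and> W = A \<union> B)"
proof
  have dbl: "{a, b} \<in> edges G \<longleftrightarrow> (a, b) \<in> E \<or> (b, a) \<in> E" for a b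
    unfolding G by (auto simp: doubleton_eq_iff)
  {
    assume "W \<in> induced_four_cycles G"
    then obtain f where f: "bij_betw f W {..<4::nat}"
      and e: "\<And>a b. a \<in> W \<Longrightarrow> b \<in> W \<Longrightarrow> {a, b} \<in> edges G \<longleftrightarrow> {f a, f b} \<in> edges (cycle_graph 4)"
      unfolding induced_four_cycles_def graph_iso_def induced_subgraph_def
      by (auto simp: cycle_graph_def)
    \<comment> \<open>\<open>g k\<close> is the vertex at position \<open>k\<close> of the cycle.\<close>
    define g where "g = inv_into W f"
    have gW: "g k \<in> W" and fg: "f (g k) = k" if "k < 4" for k
      using f that unfolding g_def bij_betw_def
      by (metis inv_into_into lessThan_iff, metis f_inv_into_f lessThan_iff)
    have Wg: "W = {g 0, g 1, g 2, g 3}"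
    proof -
      have "W = g ` {..<4}" using f unfolding g_def by (metis bij_betw_def bij_betw_inv_into)
      moreover have "{..<4} = {0, 1, 2, 3 :: nat}" by auto
      ultimately show ?thesis by simp
    qed
    have edge: "(g k, g l) \<in> E \<or> (g l, g k) \<in> E"
      if "(k, l) \<in> {(0, 1), (1, 2), (2, 3), (3, 0)}" for k l
    proof -
      have kl: "k < 4" "l < 4" using that by auto
      have "{f (g k), f (g l)} \<in> edges (cycle_graph 4)"
        unfolding fg[OF kl(1)] fg[OF kl(2)] edges_cycle_4 using that by auto
      then show ?thesis using e[OF gW[OF kl(1)] gW[OF kl(2)]] dbl by simp
    qed
    have ne: "g 0 \<noteq> g 2" "g 1 \<noteq> g 3" using fg[of 0] fg[of 1] fg[of 2] fg[of 3] by force+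
    have side: "(a, b) \<in> E \<Longrightarrow> (b, c) \<notin> E" "(a, b) \<in> E \<Longrightarrow> (c, a) \<notin> E" for a b c
      using bipD[OF bip] by blast+
    have E4: "(g 0, g 1) \<in> E \<or> (g 1, g 0) \<in> E" "(g 1, g 2) \<in> E \<or> (g 2, g 1) \<in> E"
      "(g 2, g 3) \<in> E \<or> (g 3, g 2) \<in> E" "(g 3, g 0) \<in> E \<or> (g 0, g 3) \<in> E"
      using edge[of 0 1] edge[of 1 2] edge[of 2 3] edge[of 3 0] by simp_all
    show "\<exists>A B. (A, B) \<in> quads E \<and> W = A \<union> B"
    proof (cases "(g 0, g 1) \<in> E")
      case True
      then have "(g 2, g 1) \<in> E" "(g 2, g 3) \<in> E" "(g 0, g 3) \<in> E" using E4 side by blast+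
      then have "({g 0, g 2}, {g 1, g 3}) \<in> quads E" using True ne by (simp add: quads_def)
      then show ?thesis using Wg by (intro exI[of _ "{g 0, g 2}"] exI[of _ "{g 1, g 3}"]) auto
    next
      case False
      then have "(g 1, g 0) \<in> E" "(g 1, g 2) \<in> E" "(g 3, g 2) \<in> E" "(g 3, g 0) \<in> E" using E4 side by blast+
      then have "({g 1, g 3}, {g 0, g 2}) \<in> quads E" using ne by (simp add: quads_def)
      then show ?thesis using Wg by (intro exI[of _ "{g 1, g 3}"] exI[of _ "{g 0, g 2}"]) auto
    qed
  }
  assume "\<exists>A B. (A, B) \<in> quads E \<and> W = A \<union> B"
  then obtain A B where AB: "card A = 2" "card B = 2" "A \<times> B \<subseteq> E" "W = A \<union> B"
    unfolding quads_def by blast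
  obtain a c where A: "A = {a, c}" "a \<noteq> c" using AB(1) by (auto simp: card_2_iff)
  obtain b d where B: "B = {b, d}" "b \<noteq> d" using AB(2) by (auto simp: card_2_iff)
  have ed: "(a, b) \<in> E" "(a, d) \<in> E" "(c, b) \<in> E" "(c, d) \<in> E" using AB(3) A B by auto
  then have ne: "a \<noteq> b" "a \<noteq> d" "c \<noteq> b" "c \<noteq> d" using bipD(3)[OF bip] by blast+
  have nE: "(x, a) \<notin> E" "(x, c) \<notin> E" "(b, x) \<notin> E" "(d, x) \<notin> E" for x
    using bipD(1,2)[OF bip] ed by blast+
  have W: "W = {a, b, c, d}" using AB(4) A B by auto
  define f where "f x = (if x = a then 0 else if x = b then 1 else if x = c then 2 else 3 :: nat)" for x
  have fv: "f a = 0" "f b = 1" "f c = 2" "f d = 3" using A B ne by (auto simp: f_def)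
  have "bij_betw f W {..<4}"
  proof (rule bij_betw_imageI)
    show "inj_on f W" unfolding W using fv by (auto simp: inj_on_def)
    have "{..<4} = {0, 1, 2, 3 :: nat}" by auto
    then show "f ` W = {..<4}" unfolding W using fv by auto
  qed
  moreover have "\<forall>x\<in>W. \<forall>y\<in>W. {x, y} \<in> edges G \<longleftrightarrow> {f x, f y} \<in> edges (cycle_graph 4)"
    unfolding dbl edges_cycle_4 W by (simp add: fv ed nE doubleton_eq_iff)
  ultimately have "graph_iso (induced_subgraph G W) (cycle_graph 4)"
    unfolding graph_iso_def induced_subgraph_def by (auto simp: cycle_graph_def)
  moreover have "card W = 4" unfolding W using A B ne by simp
  moreover have "W \<subseteq> verts G" unfolding W using ed sub by auto
  ultimately show "W \<in> induced_four_cycles G" unfolding induced_four_cycles_def by blast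
qed

lemma card_induced_four_cycles:
  assumes G: "edges G = {{a, b} | a b. (a, b) \<in> E}" and sub: "E \<subseteq> verts G \<times> verts G" and bip: "bip E"
  shows "card (induced_four_cycles G) = card (quads E)"
proof -
  have sides: "A \<subseteq> fst ` E" "B \<subseteq> snd ` E" if q: "(A, B) \<in> quads E" for A B
  proof -
    have "A \<noteq> {}" "B \<noteq> {}" "A \<times> B \<subseteq> E" using q by (auto simp: quads_def)
    then show "A \<subseteq> fst ` E" "B \<subseteq> snd ` E" by force+
  qed
  have "bij_betw (\<lambda>(A, B). A \<union> B) (quads E) (induced_four_cycles G)"
  proof (rule bij_betw_imageI)
    show "inj_on (\<lambda>(A, B). A \<union> B) (quads E)"
    proof (rule inj_onI, clarify)
      fix A B A' B' assume q: "(A, B) \<in> quads E" "(A', B') \<in> quads E" and u: "A \<union> B = A' \<union> B'"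
      have "A = (A \<union> B) \<inter> fst ` E" "B = (A \<union> B) \<inter> snd ` E"
        "A' = (A' \<union> B') \<inter> fst ` E" "B' = (A' \<union> B') \<inter> snd ` E"
        using sides[OF q(1)] sides[OF q(2)] bip unfolding bip_def by blast+
      then show "A = A' \<and> B = B'" using u by metis
    qed
    show "(\<lambda>(A, B). A \<union> B) ` quads E = induced_four_cycles G"
    proof (intro equalityI subsetI)
      fix W assume "W \<in> (\<lambda>(A, B). A \<union> B) ` quads E"
      then obtain A B where "(A, B) \<in> quads E" "W = A \<union> B" by (auto elim!: imageE)
      then show "W \<in> induced_four_cycles G" unfolding induced_four_cycle_iff[OF assms] by blast
    next
      fix W assume "W \<in> induced_four_cycles G"
      then obtain A B where "(A, B) \<in> quads E" "W = A \<union> B"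
        unfolding induced_four_cycle_iff[OF assms] by blast
      then show "W \<in> (\<lambda>(A, B). A \<union> B) ` quads E" by force
    qed
  qed
  then show ?thesis by (simp add: bij_betw_same_card)
qed

text \<open>
  A four-cycle is a pair \<open>i, k\<close> of indices together with two common neighbours. The non-neighbours
  of \<open>i\<close> and \<open>k\<close> are \<open>i, k\<close> and their cyclic predecessors: three indices for the \<open>n\<close> cyclically
  consecutive pairs, and four for all others.
\<close>

lemma card_quads_oriented_edges:
  assumes n: "5 \<le> n"
  shows "card (quads (oriented_edges n)) =
    n * ((n - 3) choose 2) + ((n choose 2) - n) * ((n - 4) choose 2)"
proof -
  define p where "p = pred_mod n"
  define common where "common A = {..<n} - (A \<union> p ` A)" for A
  define Pairs where "Pairs = {A. A \<subseteq> {..<n} \<and> card A = 2}"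
  define Cyc where "Cyc = (\<lambda>i. {i, p i}) ` {..<n}"
  have p_less: "p i < n" if "i < n" for i using that pred_mod_less by (simp add: p_def)
  have p_inj: "p i = p k \<longleftrightarrow> i = k" if "i < n" "k < n" for i k
    using that by (auto simp: p_def pred_mod_def split: if_splits)
  have p_ne: "p i \<noteq> i" "p (p i) \<noteq> i" "p (p i) \<noteq> p i" if "i < n" for i
    using that n by (auto simp: p_def pred_mod_def)
  have fP: "finite Pairs" unfolding Pairs_def by (rule finite_subset[of _ "Pow {..<n}"]) auto
  have cP: "card Pairs = n choose 2" unfolding Pairs_def using n_subsets[of "{..<n}" 2] by simp
  have CP: "Cyc \<subseteq> Pairs"
    unfolding Cyc_def Pairs_def using p_less p_ne(1) by (auto simp: card_2_iff doubleton_eq_iff eq_commute)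
  have cC: "card Cyc = n"
  proof -
    have "inj_on (\<lambda>i. {i, p i}) {..<n}"
    proof (rule inj_onI)
      fix i k assume ik: "i \<in> {..<n}" "k \<in> {..<n}" "{i, p i} = {k, p k}"
      then have "i = k \<or> i = p k \<and> k = p i" by (auto simp: doubleton_eq_iff)
      then show "i = k" using p_ne(2)[of i] ik by auto
    qed
    then show ?thesis unfolding Cyc_def by (simp add: card_image)
  qed
  have cyc: "card (common A) = n - 3" if A: "A \<in> Cyc" for A
  proof -
    obtain i where i: "i < n" "A = {i, p i}" using A unfolding Cyc_def by blast
    have "card {i, p i, p (p i)} = 3" using p_ne[OF i(1)] by auto
    moreover have "A \<union> p ` A = {i, p i, p (p i)}" using i by auto
    moreover have "{i, p i, p (p i)} \<subseteq> {..<n}" using i(1) p_less by auto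
    ultimately show ?thesis unfolding common_def by (subst card_Diff_subset) auto
  qed
  have noncyc: "card (common A) = n - 4" if A: "A \<in> Pairs - Cyc" for A
  proof -
    obtain i k where i: "i \<noteq> k" "A = {i, k}" "i < n" "k < n"
      using A by (auto simp: Pairs_def card_2_iff)
    have "k \<noteq> p i" "i \<noteq> p k" using A i by (auto simp: Cyc_def insert_commute)
    moreover have "i \<noteq> p i" "k \<noteq> p k" "p i \<noteq> p k" using i p_ne(1) p_inj by metis+
    ultimately have "card {i, k, p i, p k} = 4" using i(1) by simp
    moreover have "A \<union> p ` A = {i, k, p i, p k}" using i by auto
    moreover have "{i, k, p i, p k} \<subseteq> {..<n}" using i p_less by auto
    ultimately show ?thesis unfolding common_def by (subst card_Diff_subset) auto
  qed
  let ?S = "SIGMA A:Pairs. {B. B \<subseteq> common A \<and> card B = 2}"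
  have E: "(U i, V j) \<in> oriented_edges n \<longleftrightarrow> i < n \<and> j < n \<and> j \<noteq> i \<and> j \<noteq> p i" for i j
    using Suc_mod_eq_iff[of i n j] by (auto simp: oriented_edges_def p_def)
  have "bij_betw (\<lambda>(A, B). (U ` A, V ` B)) ?S (quads (oriented_edges n))"
  proof (rule bij_betw_imageI)
    have "inj U" "inj V" by (auto simp: inj_on_def)
    then show "inj_on (\<lambda>(A, B). (U ` A, V ` B)) ?S"
      by (auto simp: inj_on_def inj_image_eq_iff)
    show "(\<lambda>(A, B). (U ` A, V ` B)) ` ?S = quads (oriented_edges n)"
    proof (intro equalityI subsetI)
      fix q assume "q \<in> (\<lambda>(A, B). (U ` A, V ` B)) ` ?S"
      then obtain A B where q: "q = (U ` A, V ` B)" "A \<in> Pairs" "B \<subseteq> common A" "card B = 2" by auto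
      have "card (U ` A) = 2" "card (V ` B) = 2"
        using q by (auto simp: card_image inj_on_def Pairs_def)
      moreover have "U ` A \<times> V ` B \<subseteq> oriented_edges n"
      proof clarify
        fix i j assume ij: "i \<in> A" "j \<in> B"
        have "j \<in> common A" "i < n" using ij q(2,3) by (auto simp: Pairs_def)
        then show "(U i, V j) \<in> oriented_edges n" using ij(1) unfolding E common_def by blast
      qed
      ultimately show "q \<in> quads (oriented_edges n)" using q(1) by (simp add: quads_def)
    next
      fix q assume "q \<in> quads (oriented_edges n)"
      then obtain A' B' where q: "q = (A', B')" "card A' = 2" "card B' = 2" "A' \<times> B' \<subseteq> oriented_edges n"
        by (auto simp: quads_def)
      have ne: "A' \<noteq> {}" "B' \<noteq> {}" using q by auto
      have sA: "A' \<subseteq> U ` {..<n}" and sB: "B' \<subseteq> V ` {..<n}"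
        using q(4) ne by (auto simp: oriented_edges_def)
      obtain A where A: "A' = U ` A" "A \<subseteq> {..<n}" using sA by (metis subset_imageE)
      obtain B where B: "B' = V ` B" "B \<subseteq> {..<n}" using sB by (metis subset_imageE)
      have c: "card A = 2" "card B = 2" using q A B by (auto simp: card_image inj_on_def)
      have "B \<subseteq> common A"
      proof
        fix j assume j: "j \<in> B"
        then have "\<And>i. i \<in> A \<Longrightarrow> (U i, V j) \<in> oriented_edges n" using q(4) A B by auto
        then have "\<And>i. i \<in> A \<Longrightarrow> j \<noteq> i \<and> j \<noteq> p i" using E by blast
        then show "j \<in> common A" using B(2) j by (auto simp: common_def)
      qed
      then show "q \<in> (\<lambda>(A, B). (U ` A, V ` B)) ` ?S"
        using q(1) A B c by (intro image_eqI[of _ _ "(A, B)"]) (auto simp: Pairs_def)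
    qed
  qed
  then have "card (quads (oriented_edges n)) = card ?S" by (rule bij_betw_same_card[symmetric])
  also have "\<dots> = (\<Sum>A\<in>Pairs. card {B. B \<subseteq> common A \<and> card B = 2})"
  proof (rule card_SigmaI[OF fP], rule ballI)
    fix A show "finite {B. B \<subseteq> common A \<and> card B = 2}"
      by (rule finite_subset[of _ "Pow {..<n}"]) (auto simp: common_def)
  qed
  also have "\<dots> = (\<Sum>A\<in>Pairs. card (common A) choose 2)"
    by (intro sum.cong refl n_subsets) (simp add: common_def)
  also have "\<dots> = (\<Sum>A\<in>Cyc. card (common A) choose 2) + (\<Sum>A\<in>Pairs - Cyc. card (common A) choose 2)"
    using sum.subset_diff[OF CP fP] by (simp add: add.commute)
  also have "(\<Sum>A\<in>Cyc. card (common A) choose 2) = n * ((n - 3) choose 2)"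
    by (simp add: cyc cC)
  also have "(\<Sum>A\<in>Pairs - Cyc. card (common A) choose 2) = ((n choose 2) - n) * ((n - 4) choose 2)"
    using CP fP cC cP by (simp add: noncyc card_Diff_subset finite_subset)
  finally show ?thesis .
qed

theorem theorem5p2:
  fixes n m q :: nat
  assumes "n \<ge> 5"
    and "m = n * (n - 2)"
    and "q = card (induced_four_cycles (G_graph n))"
  shows "real q = real n * real ((n - 3) choose 2)
           + real n * (real n - 3) / 2 * real ((n - 4) choose 2) \<and>
         graded_betti (edge_ring_vars (G_graph n))
           (binomial_edge_ideal (G_graph n) :: (gvertex bvar, 'k::field) mpoly set) 2 4
         = (m choose 2) + 2 * n * ((n - 2) choose 3) + 3 * q"
proof
  have fT: "finite (verts (G_graph n))" by (simp add: G_graph_def)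
  note G = edges_G_graph[of n] oriented_edges_sub[of n]
  have q: "q = card (quads (oriented_edges n))"
    unfolding assms(3) by (rule card_induced_four_cycles[OF G oriented_edges_bip])
  have le: "n \<le> n choose 2"
  proof -
    have "n * 2 \<le> n * (n - 1)" using assms(1) by (intro mult_le_mono2) simp
    then have "n * 2 div 2 \<le> n * (n - 1) div 2" by (rule div_le_mono)
    then show ?thesis by (simp add: choose_two)
  qed
  have "even (n * (n - 1))" by (cases n) auto
  then have "real (n choose 2) = real (n * (n - 1)) / 2"
    unfolding choose_two by (simp add: real_of_nat_div)
  also have "\<dots> = real n * (real n - 1) / 2" using assms(1) by (simp add: of_nat_diff)
  finally have "real ((n choose 2) - n) = real n * (real n - 3) / 2"
    using le by (simp add: of_nat_diff field_simps)
  then show "real q = real n * real ((n - 3) choose 2)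
           + real n * (real n - 3) / 2 * real ((n - 4) choose 2)"
    unfolding q card_quads_oriented_edges[OF assms(1)] by simp
  have fE: "finite (oriented_edges n)"
    using fT oriented_edges_sub by (meson finite_SigmaI finite_subset)
  have W: "edge_ring_vars (G_graph n) = bvars (verts (G_graph n))"
    by (simp add: edge_ring_vars_def bvars_def)
  have "graded_betti (edge_ring_vars (G_graph n))
      (binomial_edge_ideal (G_graph n) :: (gvertex bvar, 'k) mpoly set) 2 4
    = syz_count (verts (G_graph n)) (oriented_edges n)"
    unfolding W binomial_edge_ideal_eq[OF G fE]
    by (rule graded_betti_bideal[OF fT oriented_edges_sub oriented_edges_bip])
  also have "\<dots> = (m choose 2) + 2 * n * ((n - 2) choose 3) + 3 * q"
  proof -
    have "2 \<le> n" using assms(1) by simp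
    then show ?thesis
      unfolding syz_count_def assms(2) q by (simp only: card_oriented_edges degree_sum)
  qed
  finally show "graded_betti (edge_ring_vars (G_graph n))
      (binomial_edge_ideal (G_graph n) :: (gvertex bvar, 'k) mpoly set) 2 4
    = (m choose 2) + 2 * n * ((n - 2) choose 3) + 3 * q" .
qed

end
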